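(* Let $\gamma>1$, let $k\ge0$ be an integer and $r\in\mathbb{R}$. Then the sub-Leray operator $\mathbf{L}_k$ is bounded from $L^2_k(M_\gamma,\mu_r)$ to $L^2_k(M_\gamma,\mu_r)$ if and only if $r\in\mathcal{I}_k$, where $$\mathcal{I}_k=\big(-2k-1,\ (2k+2)(\gamma-1)+1\big).$$ Furthermore, when $r\in\mathcal{I}_k$, $$\|\mathbf{L}_k\|_{L^2(M_\gamma,\mu_r)}=\sqrt{C_{\mu_r}(\gamma,k)},$$ where $$C_{\mu_r}(\gamma,k)=\frac{\Gamma\big(\frac{2k+1+r}{\gamma}\big)\,\Gamma\big(2k+2-\frac{2k+1+r}{\gamma}\big)}{\Gamma(k+1)^2}\Big(\frac{\gamma}{2}\Big)^{2k+2}(\gamma-1)^{-\left(2k+2-\frac{2k+1+r}{\gamma}\right)}.$$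
   Context: For $\gamma>1$ let $M_\gamma=\{(\zeta_1,\zeta_2)\in\mathbb{C}^2:\operatorname{Im}\zeta_2=|\zeta_1|^\gamma\}$, parametrized up to a null set by $(s,\alpha,\theta)\in\mathbb{R}\times(0,\infty)\times[0,2\pi)$ via $\zeta=(\alpha e^{i\theta},\,s+i\alpha^\gamma)$. For $r\in\mathbb{R}$, $\mu_r$ is the measure $\alpha^{r}\,ds\,d\alpha\,d\theta$ on $M_\gamma$. Each $f\in L^2(M_\gamma,\mu_r)$ has a partial Fourier expansion $f=\sum_{k\in\mathbb{Z}}f_k(s,\alpha)e^{ik\theta}$, and $L^2_k(M_\gamma,\mu_r)$ denotes the closed subspace of functions of the form $f_k(s,\alpha)e^{ik\theta}$. The sub-Leray operator $\mathbf{L}_k$ ($k\ge 0$) is the restriction to $k$-th Fourier components of the Leray transform $$\mathbf{L}f(z)=\frac{\gamma^2}{8\pi^2 i}\int_{M_\gamma}f(\zeta)\frac{|\zeta_1|^{\gamma-2}\,d\zeta_2\wedge d\bar\zeta_1\wedge d\zeta_1}{[\gamma\bar\zeta_1|\zeta_1|^{\gamma-2}(\zeta_1-z_1)+i(\zeta_2-z_2)]^2}.$$ Explicitly, for $z=(\alpha_ze^{i\theta_z},s_z+i\alpha_z^\gamma)\in M_\gamma$, with $A=(\gamma-1)\alpha_\zeta^\gamma+\alpha_z^\gamma+i(s_\zeta-s_z)$ and $B=\gamma\alpha_z\alpha_\zeta^{\gamma-1}$, $$\mathbf{L}_kf(s_z,\alpha_z,\theta_z)=e^{ik\theta_z}\,\frac{\gamma^2(k+1)}{2\pi}\int_0^\infty\!\int_{-\infty}^\infty\frac{B^k}{A^{k+2}}f_k(s_\zeta,\alpha_\zeta)\,\alpha_\zeta^{\gamma-1}\,ds_\zeta\,d\alpha_\zeta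 .$$ "Bounded on $L^2_k(M_\gamma,\mu_r)$" means that this formula, applied on the dense subspace of bounded functions in $L^2_k(M_\gamma,\mu_r)$ with compact support in $M_\gamma\setminus\{\zeta_1=0\}$, satisfies $\|\mathbf{L}_kf\|_{L^2(\mu_r)}\le C\|f\|_{L^2(\mu_r)}$ for some constant $C$; $\mathbf{L}_k$ is then identified with its continuous extension, and $\|\mathbf{L}_k\|_{L^2(M_\gamma,\mu_r)}$ is its operator norm. *)

theory Defs
  imports "HOL-Analysis.Analysis"
begin

definition M_hyp :: "real \<Rightarrow> (complex \<times> complex) set" where
  "M_hyp \<gamma> = {(\<zeta>1, \<zeta>2). Im \<zeta>2 = cmod \<zeta>1 powr \<gamma>}"

definition M_param :: "real \<Rightarrow> real \<Rightarrow> real \<Rightarrow> real \<Rightarrow> complex \<times> complex" where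
  "M_param \<gamma> s \<alpha> \<theta> = (complex_of_real \<alpha> * cis \<theta>, Complex s (\<alpha> powr \<gamma>))"

text \<open>The measure \<open>\<alpha> powr r ds d\<alpha> d\<theta>\<close>, transported to the hypersurface; the points with
  \<open>\<zeta>1 = 0\<close>, which the parametrization misses, form a null set.\<close>

definition \<mu>_meas :: "real \<Rightarrow> real \<Rightarrow> (complex \<times> complex) measure" where
  "\<mu>_meas \<gamma> r =
     distr (density (restrict_space (lborel :: (real \<times> real \<times> real) measure)
                       (UNIV \<times> {0<..} \<times> {0..<2*pi}))
              (\<lambda>(s, \<alpha>, \<theta>). ennreal (\<alpha> powr r)))
       (restrict_space borel (M_hyp \<gamma>))
       (\<lambda>(s, \<alpha>, \<theta>). M_param \<gamma> s \<alpha> \<theta>)"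

text \<open>Elements of \<open>L\<^sup>2\<close> are represented by functions; equality in \<open>L\<^sup>2\<close> is equality almost
  everywhere, so values off the hypersurface are irrelevant. \<open>L2_norm\<close> is
  meaningful only on members of \<open>L2_space\<close>.\<close>

definition L2_space :: "'a measure \<Rightarrow> ('a \<Rightarrow> complex) set" where
  "L2_space M = {f \<in> borel_measurable M. integrable M (\<lambda>x. (cmod (f x))\<^sup>2)}"

definition L2_norm :: "'a measure \<Rightarrow> ('a \<Rightarrow> complex) \<Rightarrow> real" where
  "L2_norm M f = sqrt (\<integral>x. (cmod (f x))\<^sup>2 \<partial>M)"

definition fourier_comp :: "real \<Rightarrow> int \<Rightarrow> (complex \<times> complex \<Rightarrow> complex) \<Rightarrow> real \<Rightarrow> real \<Rightarrow> complex" where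
  "fourier_comp \<gamma> k f s \<alpha> =
     (1 / (2 * pi)) * (LBINT \<theta>:{0..<2*pi}. f (M_param \<gamma> s \<alpha> \<theta>) * cis (- (of_int k * \<theta>)))"

text \<open>On \<open>M_hyp \<gamma>\<close> the coordinates of \<open>\<zeta>\<close> are
  \<open>s = Re (snd \<zeta>)\<close>, \<open>\<alpha> = cmod (fst \<zeta>)\<close> and \<open>\<theta> = Arg2pi (fst \<zeta>)\<close>.\<close>

definition L2_comp :: "real \<Rightarrow> real \<Rightarrow> int \<Rightarrow> (complex \<times> complex \<Rightarrow> complex) set" where
  "L2_comp \<gamma> r k =
     {f \<in> L2_space (\<mu>_meas \<gamma> r).
        \<exists>g :: real \<times> real \<Rightarrow> complex. g \<in> borel_measurable borel \<and>
          (AE \<zeta> in \<mu>_meas \<gamma> r.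
             f \<zeta> = g (Re (snd \<zeta>), cmod (fst \<zeta>)) * cis (of_int k * Arg2pi (fst \<zeta>)))}"

definition L2_comp_core :: "real \<Rightarrow> real \<Rightarrow> int \<Rightarrow> (complex \<times> complex \<Rightarrow> complex) set" where
  "L2_comp_core \<gamma> r k =
     {f \<in> L2_comp \<gamma> r k. bounded (f ` M_hyp \<gamma>) \<and>
        (\<exists>K. compact K \<and> K \<subseteq> M_hyp \<gamma> - {\<zeta>. fst \<zeta> = 0} \<and> (\<forall>\<zeta> \<in> M_hyp \<gamma> - K. f \<zeta> = 0))}"

definition kernel_A :: "real \<Rightarrow> real \<Rightarrow> real \<Rightarrow> real \<Rightarrow> real \<Rightarrow> complex" where
  "kernel_A \<gamma> s\<^sub>\<zeta> \<alpha>\<^sub>\<zeta> s\<^sub>z \<alpha>\<^sub>z =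
     Complex ((\<gamma> - 1) * \<alpha>\<^sub>\<zeta> powr \<gamma> + \<alpha>\<^sub>z powr \<gamma>) (s\<^sub>\<zeta> - s\<^sub>z)"

definition kernel_B :: "real \<Rightarrow> real \<Rightarrow> real \<Rightarrow> real" where
  "kernel_B \<gamma> \<alpha>\<^sub>\<zeta> \<alpha>\<^sub>z = \<gamma> * \<alpha>\<^sub>z * \<alpha>\<^sub>\<zeta> powr (\<gamma> - 1)"

definition sub_leray :: "real \<Rightarrow> nat \<Rightarrow> (complex \<times> complex \<Rightarrow> complex) \<Rightarrow> complex \<times> complex \<Rightarrow> complex" where
  "sub_leray \<gamma> k f z =
     (let s\<^sub>z = Re (snd z); \<alpha>\<^sub>z = cmod (fst z); \<theta>\<^sub>z = Arg2pi (fst z)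
      in cis (of_nat k * \<theta>\<^sub>z) * complex_of_real (\<gamma>\<^sup>2 * (of_nat k + 1) / (2 * pi)) *
         (LBINT \<alpha>\<^sub>\<zeta>:{0<..}. LBINT s\<^sub>\<zeta>.
            complex_of_real (kernel_B \<gamma> \<alpha>\<^sub>\<zeta> \<alpha>\<^sub>z) ^ k / kernel_A \<gamma> s\<^sub>\<zeta> \<alpha>\<^sub>\<zeta> s\<^sub>z \<alpha>\<^sub>z ^ (k + 2) *
            fourier_comp \<gamma> (int k) f s\<^sub>\<zeta> \<alpha>\<^sub>\<zeta> * complex_of_real (\<alpha>\<^sub>\<zeta> powr (\<gamma> - 1))))"

definition sub_leray_bounded :: "real \<Rightarrow> real \<Rightarrow> nat \<Rightarrow> bool" where
  "sub_leray_bounded \<gamma> r k \<longleftrightarrow>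
     (\<exists>C. \<forall>f \<in> L2_comp_core \<gamma> r (int k).
        sub_leray \<gamma> k f \<in> L2_comp \<gamma> r (int k) \<and>
        L2_norm (\<mu>_meas \<gamma> r) (sub_leray \<gamma> k f) \<le> C * L2_norm (\<mu>_meas \<gamma> r) f)"

text \<open>\<open>T\<close> represents a bounded linear operator on the \<open>k\<close>-th component space
  that agrees with \<open>sub_leray\<close> on the dense subspace. Linearity and the
  norm bound together make \<open>T\<close> respect almost-everywhere equality.\<close>

definition sub_leray_extension ::
  "real \<Rightarrow> real \<Rightarrow> nat \<Rightarrow> ((complex \<times> complex \<Rightarrow> complex) \<Rightarrow> complex \<times> complex \<Rightarrow> complex) \<Rightarrow> bool" where
  "sub_leray_extension \<gamma> r k T \<longleftrightarrow>
     (\<forall>f \<in> L2_comp \<gamma> r (int k). T f \<in> L2_comp \<gamma> r (int k)) \<and>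
     (\<forall>f \<in> L2_comp \<gamma> r (int k). \<forall>g \<in> L2_comp \<gamma> r (int k). \<forall>a b.
        AE \<zeta> in \<mu>_meas \<gamma> r. T (\<lambda>\<eta>. a * f \<eta> + b * g \<eta>) \<zeta> = a * T f \<zeta> + b * T g \<zeta>) \<and>
     (\<exists>C. \<forall>f \<in> L2_comp \<gamma> r (int k). L2_norm (\<mu>_meas \<gamma> r) (T f) \<le> C * L2_norm (\<mu>_meas \<gamma> r) f) \<and>
     (\<forall>f \<in> L2_comp_core \<gamma> r (int k). AE \<zeta> in \<mu>_meas \<gamma> r. T f \<zeta> = sub_leray \<gamma> k f \<zeta>)"

text \<open>As in \<open>onorm\<close>, functions of norm 0 contribute the quotient 0.\<close>

definition L2_opnorm ::
  "real \<Rightarrow> real \<Rightarrow> nat \<Rightarrow> ((complex \<times> complex \<Rightarrow> complex) \<Rightarrow> complex \<times> complex \<Rightarrow> complex) \<Rightarrow> real" where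
  "L2_opnorm \<gamma> r k T =
     (SUP f \<in> L2_comp \<gamma> r (int k). L2_norm (\<mu>_meas \<gamma> r) (T f) / L2_norm (\<mu>_meas \<gamma> r) f)"

definition r_interval :: "real \<Rightarrow> nat \<Rightarrow> real set" where
  "r_interval \<gamma> k = {- 2 * real k - 1 <..< (2 * real k + 2) * (\<gamma> - 1) + 1}"

definition C_const :: "real \<Rightarrow> real \<Rightarrow> nat \<Rightarrow> real" where
  "C_const \<gamma> r k =
     Gamma ((2 * real k + 1 + r) / \<gamma>) * Gamma (2 * real k + 2 - (2 * real k + 1 + r) / \<gamma>)
       / (Gamma (real k + 1))\<^sup>2
     * (\<gamma> / 2) ^ (2 * k + 2)
     * (\<gamma> - 1) powr (- (2 * real k + 2 - (2 * real k + 1 + r) / \<gamma>))"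

end

theory Submission
  imports Defs "HOL-Probability.Probability"
begin

text \<open>
  Rotations and translations in \<open>s\<close> act on the hypersurface and commute with the operator.  On the
  \<open>k\<close>-th Fourier mode it therefore becomes an operator on functions \<open>g (s, \<alpha>)\<close> that is a
  convolution in \<open>s\<close>.  Its kernel contains \<open>1 / A ^ (k + 2)\<close> with
  \<open>A = (\<gamma> - 1) \<alpha>\<^sup>\<gamma> + \<beta>\<^sup>\<gamma> + \<i> (s - t)\<close>, and
  \<open>(k + 1)! / A ^ (k + 2)\<close> is the integral of \<open>\<xi> ^ (k + 1) exp (- \<xi> A)\<close> over \<open>\<xi> > 0\<close>.  The
  exponential factors into a function of \<open>\<alpha>\<close> and a function of \<open>\<beta>\<close>.  So after a Fourier transform in
  \<open>s\<close> the operator acts, at each frequency \<open>\<xi> > 0\<close>, with rank one: it pairs the slice of \<open>g\<close> with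
  \<open>\<alpha>\<^bsup>(\<gamma> - 1)(k + 1)\<^esup> exp (- \<xi> (\<gamma> - 1) \<alpha>\<^sup>\<gamma>)\<close> and multiplies
  \<open>\<beta> ^ k exp (- \<xi> \<beta>\<^sup>\<gamma>)\<close> by the result and by a multiple of \<open>\<xi> ^ (k + 1)\<close>.

  The squared norm of a rank one operator on \<open>L\<^sup>2 (\<alpha>\<^sup>r d\<alpha>)\<close> is the product of the squared norms of its
  two factors, the one paired with the input being measured with the dual weight \<open>\<alpha>\<^bsup>-r\<^esup>\<close>.  Here
  these are, up to explicit factors, the Gamma integrals \<open>synthesis_weight\<close>, finite exactly for
  \<open>r > - 2k - 1\<close>, and \<open>analysis_weight\<close>, finite exactly for \<open>r < (2k + 2)(\<gamma> - 1) + 1\<close>.  The powers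
  of \<open>\<xi>\<close> cancel (\<open>weights_scaling\<close>), so every frequency contributes the same norm, and its square is
  \<open>C_const\<close>.

  Upper bound: \<open>reduced_leray_fourier\<close> is the decomposition into frequencies, and
  \<open>half_norm2_reduced_leray_le\<close> combines the Cauchy-Schwarz inequality at each frequency with the
  inequality half of Plancherel's theorem (\<open>fourier_L2_le\<close>), used once for the input and once for the
  output.  The kernel is square integrable against the dual weight (\<open>leray_kernel_L2\<close>); the
  integral formula therefore makes sense on the whole space, where truncation and Fatou's lemma carry
  the bound over, and it provides the bounded extension.

  Lower bound: wave packets \<open>exp (\<i> s)\<close> on \<open>\<bar>s\<bar> \<le> n\<close>, times the optimal function of \<open>\<alpha>\<close> for
  \<open>\<xi> = 1\<close> cut off to a compact interval, belong to the dense subspace and concentrate at frequency 1.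
  As \<open>n\<close> grows, Fatou's lemma shows that any bound on the dense subspace dominates
  the product of the two weights (\<open>leray_lower_bound\<close>).  This forces both
  weights to be finite, which yields the interval, and it makes the constant optimal.
\<close>

section \<open>Fourier transforms on the line\<close>

lemma borel_measurable_cnj [measurable (raw)]:
  "f \<in> borel_measurable M \<Longrightarrow> (\<lambda>x. cnj (f x)) \<in> borel_measurable M"
  by (rule borel_measurable_continuous_on[OF continuous_on_cnj[OF continuous_on_id]])

lemma borel_measurable_cis [measurable (raw)]:
  fixes f :: "'a \<Rightarrow> real"
  shows "f \<in> borel_measurable M \<Longrightarrow> (\<lambda>x. cis (f x)) \<in> borel_measurable M"
  by (rule borel_measurable_continuous_on[OF continuous_on_cis[OF continuous_on_id]])

text \<open>A rescaled characteristic function of the standard normal distribution.  The Gaussian serves as a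
  convergence factor: it makes Fubini's theorem applicable, and its transform is a multiple of an
  approximate identity.\<close>

lemma gaussian_fourier:
  fixes e t :: real
  assumes "e > 0"
  shows "integrable lborel (\<lambda>\<xi>. cis (\<xi> * t) * of_real (exp (-(e * \<xi>)\<^sup>2 / 2)))"
    and "(LBINT \<xi>. cis (\<xi> * t) * of_real (exp (-(e * \<xi>)\<^sup>2 / 2)))
           = of_real (sqrt (2 * pi) / e * exp (-(t / e)\<^sup>2 / 2))"
proof -
  have dens: "integrable lborel std_normal_density" by simp
  have i0: "integrable lborel (\<lambda>x. complex_of_real (std_normal_density x) * iexp (u * x))" for u
    by (rule Bochner_Integration.integrable_bound[OF dens]) (auto simp: norm_mult)
  have e0: "(LBINT x. complex_of_real (std_normal_density x) * iexp (u * x))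
      = of_real (exp (-(u\<^sup>2) / 2))" for u
    using fun_cong[OF char_std_normal_distribution, of u] unfolding char_def
    by (subst (asm) integral_density) (auto simp: scaleR_conv_of_real)
  have eq: "complex_of_real (std_normal_density (0 + e * \<xi>)) * iexp ((t / e) * (0 + e * \<xi>))
      * of_real (sqrt (2 * pi))
      = cis (\<xi> * t) * of_real (exp (-(e * \<xi>)\<^sup>2 / 2))" for \<xi>
    using assms by (simp add: std_normal_density_def cis_conv_exp field_simps)
  have "integrable lborel (\<lambda>\<xi>. complex_of_real (std_normal_density (0 + e * \<xi>))
      * iexp ((t / e) * (0 + e * \<xi>)))"
    by (rule lborel_integrable_real_affine[OF i0]) (use assms in auto)
  then have "integrable lborel (\<lambda>\<xi>. complex_of_real (std_normal_density (0 + e * \<xi>))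
      * iexp ((t / e) * (0 + e * \<xi>)) * of_real (sqrt (2 * pi)))"
    by (rule integrable_mult_left)
  then show "integrable lborel (\<lambda>\<xi>. cis (\<xi> * t) * of_real (exp (-(e * \<xi>)\<^sup>2 / 2)))"
    unfolding eq .
  have "of_real (exp (-((t/e)\<^sup>2) / 2))
      = \<bar>e\<bar> *\<^sub>R (LBINT \<xi>. complex_of_real (std_normal_density (0 + e * \<xi>)) * iexp ((t / e) * (0 + e * \<xi>)))"
    unfolding e0[symmetric] by (rule lborel_integral_real_affine) (use assms in auto)
  then have "(LBINT \<xi>. complex_of_real (std_normal_density (0 + e * \<xi>)) * iexp ((t / e) * (0 + e * \<xi>)))
      = of_real (exp (-((t/e)\<^sup>2) / 2)) / of_real e"
    using assms by (simp add: scaleR_conv_of_real field_simps)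
  then have "(LBINT \<xi>. complex_of_real (std_normal_density (0 + e * \<xi>)) * iexp ((t / e) * (0 + e * \<xi>))
      * of_real (sqrt (2 * pi)))
     =  of_real (exp (-((t/e)\<^sup>2) / 2)) / of_real e * of_real (sqrt (2 * pi))"
    by (subst integral_mult_left_zero) simp
  then show "(LBINT \<xi>. cis (\<xi> * t) * of_real (exp (-(e * \<xi>)\<^sup>2 / 2)))
           = of_real (sqrt (2 * pi) / e * exp (-(t / e)\<^sup>2 / 2))"
    unfolding eq by simp
qed

lemma nn_integral_gaussian:
  fixes e x :: real
  assumes "e > 0"
  shows "(\<integral>\<^sup>+y. ennreal (sqrt (2 * pi) / e * exp (-((x - y) / e)\<^sup>2 / 2)) \<partial>lborel) = ennreal (2 * pi)"
proof -
  have eq: "sqrt (2 * pi) / e * exp (-((x - y) / e)\<^sup>2 / 2) = 2 * pi * normal_density x e y" for y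
    using assms by (simp add: normal_density_def power2_commute power_divide real_sqrt_mult field_simps)
  have "(\<integral>\<^sup>+y. ennreal (normal_density x e y) \<partial>lborel) = 1"
    using integral_normal_density[OF assms] integrable_normal_density[OF assms]
    by (subst nn_integral_eq_integral) auto
  then show ?thesis unfolding eq
    by (simp add: ennreal_mult' nn_integral_cmult)
qed

lemma integrable_product:
  fixes f :: "'a \<Rightarrow> complex" and g :: "'b \<Rightarrow> complex"
  assumes "sigma_finite_measure M" "sigma_finite_measure N"
  assumes f: "integrable M f" and g: "integrable N g"
  shows "integrable (M \<Otimes>\<^sub>M N) (\<lambda>z. f (fst z) * g (snd z))"
proof -
  interpret pair_sigma_finite M N using assms by (simp add: pair_sigma_finite_def)
  have [measurable]: "f \<in> borel_measurable M" "g \<in> borel_measurable N" using f g by auto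
  show ?thesis
    by (rule Fubini_integrable) (use f g in \<open>auto simp: norm_mult\<close>)
qed

lemma norm_product_le_squares:
  fixes a b :: complex and G :: real
  assumes "0 \<le> G"
  shows "ennreal (norm (a * cnj b * of_real G))
      \<le> ennreal ((cmod a)\<^sup>2 / 2) * ennreal G + ennreal ((cmod b)\<^sup>2 / 2) * ennreal G"
proof -
  have "cmod a * cmod b \<le> (cmod a)\<^sup>2 / 2 + (cmod b)\<^sup>2 / 2"
    using sum_squares_bound[of "cmod a" "cmod b"] by simp
  then have "cmod a * cmod b * G \<le> ((cmod a)\<^sup>2 / 2 + (cmod b)\<^sup>2 / 2) * G"
    using assms by (rule mult_right_mono)
  then show ?thesis using assms
    by (simp add: norm_mult ennreal_mult'[symmetric] ennreal_plus[symmetric] distrib_right del: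
        ennreal_plus)
qed

abbreviation plane :: "(real \<times> real) measure" where
  "plane \<equiv> lborel \<Otimes>\<^sub>M lborel"

lemma sigma_finite_plane: "sigma_finite_measure plane"
  by (simp add: lborel_prod lborel.sigma_finite_measure_axioms)

text \<open>The half of Plancherel's theorem that an operator bound needs.  A Gaussian factor in \<open>\<xi>\<close> turns
  the left-hand side into the double integral of \<open>h x * cnj (h y)\<close> against a nonnegative
  convolution kernel of mass \<open>2 * pi\<close>.  The arithmetic-geometric mean inequality bounds it, uniformly
  in the factor, and Fatou's lemma removes the factor.\<close>

lemma fourier_L2_le:
  fixes h :: "real \<Rightarrow> complex"
  assumes int: "integrable lborel h"
  shows "(\<integral>\<^sup>+\<xi>. ennreal ((cmod (LBINT x. h x * cis (\<xi> * x)))\<^sup>2) \<partial>lborel)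
           \<le> ennreal (2 * pi) * (\<integral>\<^sup>+x. ennreal ((cmod (h x))\<^sup>2) \<partial>lborel)"
proof -
  let ?q = "\<lambda>x. ennreal ((cmod (h x))\<^sup>2 / 2)"
  let ?G = "\<lambda>e t. sqrt (2 * pi) / e * exp (-(t / e)\<^sup>2 / 2)"
  let ?H = "\<lambda>e z. h (fst z) * cnj (h (snd z)) * of_real (?G e (fst z - snd z))"
  let ?I = "\<integral>\<^sup>+x. ennreal ((cmod (h x))\<^sup>2) \<partial>lborel"
  have [measurable]: "h \<in> borel_measurable borel" using int by auto
  define F where "F \<xi> = (LBINT x. h x * cis (\<xi> * x))" for \<xi>
  have Fm[measurable]: "F \<in> borel_measurable borel" unfolding F_def by measurable
  have ih: "integrable lborel (\<lambda>x. h x * cis (\<xi> * x))" for \<xi>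
    by (rule Bochner_Integration.integrable_bound[OF int]) (auto simp: norm_mult)
  have ihc: "integrable lborel (\<lambda>x. cnj (h x * cis (\<xi> * x)))" for \<xi>
    using ih by (simp only: integrable_cnj)
  let ?w = "\<lambda>e \<xi>. exp (-(e * \<xi>)\<^sup>2 / 2)"
  have F2: "of_real ((cmod (F \<xi>))\<^sup>2) = (\<integral>z. h (fst z) * cnj (h (snd z)) * cis (\<xi> * (fst z - snd z)) \<partial>plane)"
    (is "_ = integral\<^sup>L _ (?k \<xi>)") for \<xi>
  proof -
    have cF: "cnj (F \<xi>) = (LBINT y. cnj (h y * cis (\<xi> * y)))"
      unfolding F_def by (rule integral_bounded_linear[OF bounded_linear_cnj ih, symmetric])
    have "of_real ((cmod (F \<xi>))\<^sup>2) = F \<xi> * cnj (F \<xi>)" by (rule complex_norm_square)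
    also have "\<dots> = (LBINT x. LBINT y. (h x * cis (\<xi> * x)) * cnj (h y * cis (\<xi> * y)))"
      unfolding cF by (simp add: F_def del: complex_cnj_mult)
    also have "\<dots> = (\<integral>z. (h (fst z) * cis (\<xi> * fst z)) * cnj (h (snd z) * cis (\<xi> * snd z)) \<partial>plane)"
      by (subst lborel_pair.integral_fst'[symmetric])
         (auto intro!: integrable_product[where g="\<lambda>x. cnj (h x * cis (\<xi> * x))"] ih ihc
             lborel.sigma_finite_measure_axioms simp del: complex_cnj_mult)
    also have "\<dots> = integral\<^sup>L plane (?k \<xi>)"
    proof (rule Bochner_Integration.integral_cong[OF refl])
      fix z :: "real \<times> real"
      have "cis (\<xi> * (fst z - snd z)) = cis (\<xi> * fst z) * cis (- (\<xi> * snd z))"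
        by (simp add: cis_mult right_diff_distrib)
      then show "(h (fst z) * cis (\<xi> * fst z)) * cnj (h (snd z) * cis (\<xi> * snd z)) = ?k \<xi> z"
        by (simp add: cis_cnj)
    qed
    finally show ?thesis .
  qed
  have ik: "integrable plane (\<lambda>z. h (fst z) * cnj (h (snd z)))"
    by (rule integrable_product) (use int lborel.sigma_finite_measure_axioms in auto)
  have main: "(\<integral>\<^sup>+\<xi>. ennreal ((cmod (F \<xi>))\<^sup>2 * ?w e \<xi>) \<partial>lborel)
        \<le> ennreal (2 * pi) * ?I" if e: "e > 0" for e
  proof -
    have iw: "integrable lborel (\<lambda>\<xi>. complex_of_real (?w e \<xi>))"
      using gaussian_fourier(1)[OF e, of 0] by simp
    have i3: "integrable (plane \<Otimes>\<^sub>M lborel)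
        (\<lambda>p. (h (fst (fst p)) * cnj (h (snd (fst p)))) * complex_of_real (?w e (snd p)))"
      by (rule integrable_product[OF sigma_finite_plane lborel.sigma_finite_measure_axioms ik iw])
    have i4: "integrable (plane \<Otimes>\<^sub>M lborel) (\<lambda>p. ?k (snd p) (fst p) * complex_of_real (?w e (snd p)))"
      by (rule Bochner_Integration.integrable_bound[OF i3]) (auto simp: norm_mult)
    interpret P: pair_sigma_finite "plane" "lborel :: real measure"
      using sigma_finite_plane lborel.sigma_finite_measure_axioms by (simp add: pair_sigma_finite_def)
    have i4': "integrable (plane \<Otimes>\<^sub>M lborel) (\<lambda>(z, \<xi>). ?k \<xi> z * complex_of_real (?w e \<xi>))"
      using i4 by (simp add: case_prod_beta')
    have fw: "integrable lborel (\<lambda>\<xi>. \<integral>z. ?k \<xi> z * complex_of_real (?w e \<xi>) \<partial>plane)"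
      using P.integrable_snd[OF i4'] .
    have fweq: "(\<integral>z. ?k \<xi> z * complex_of_real (?w e \<xi>) \<partial>plane) = of_real ((cmod (F \<xi>))\<^sup>2 * ?w e \<xi>)" for \<xi>
      by (subst integral_mult_left_zero) (simp only: F2[symmetric] of_real_mult)
    have fint: "integrable lborel (\<lambda>\<xi>. (cmod (F \<xi>))\<^sup>2 * ?w e \<xi>)"
      using fw unfolding fweq by (simp only: complex_of_real_integrable_eq)
    have "complex_of_real (LBINT \<xi>. (cmod (F \<xi>))\<^sup>2 * ?w e \<xi>) = (LBINT \<xi>. of_real ((cmod (F \<xi>))\<^sup>2 * ?w e \<xi>))"
      by (rule integral_complex_of_real[symmetric])
    also have "\<dots> = (LBINT \<xi>. \<integral>z. ?k \<xi> z * complex_of_real (?w e \<xi>) \<partial>plane)"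
      by (simp only: fweq)
    also have "\<dots> = (\<integral>z. (LBINT \<xi>. ?k \<xi> z * complex_of_real (?w e \<xi>)) \<partial>plane)"
      by (rule P.Fubini_integral[OF i4'])
    also have "\<dots> = (\<integral>z. ?H e z \<partial>plane)"
    proof (rule Bochner_Integration.integral_cong[OF refl])
      fix z :: "real \<times> real"
      have "(LBINT \<xi>. ?k \<xi> z * complex_of_real (?w e \<xi>))
          = (LBINT \<xi>. (h (fst z) * cnj (h (snd z)))
          * (cis (\<xi> * (fst z - snd z)) * complex_of_real (?w e \<xi>)))"
        by (simp only: mult.assoc)
      also have "\<dots> = ?H e z"
        by (subst integral_mult_right_zero) (simp only: gaussian_fourier(2)[OF e])
      finally show "(LBINT \<xi>. ?k \<xi> z * complex_of_real (?w e \<xi>)) = ?H e z" .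
    qed
    finally have A: "complex_of_real (LBINT \<xi>. (cmod (F \<xi>))\<^sup>2 * ?w e \<xi>) = (\<integral>z. ?H e z \<partial>plane)" .
    have iG: "integrable plane (\<lambda>z. ?H e z)"
    proof (rule Bochner_Integration.integrable_bound)
      show "integrable plane (\<lambda>z. (h (fst z) * cnj (h (snd z))) * of_real (sqrt (2*pi) / e))"
        by (rule integrable_mult_left[OF ik])
      have "?G e t \<le> sqrt (2*pi) / e" "0 \<le> ?G e t" for t
        using e by (auto intro!: divide_right_mono mult_left_le)
      then have "cmod (h (fst z) * cnj (h (snd z))) * \<bar>?G e (fst z - snd z)\<bar>
          \<le> cmod (h (fst z) * cnj (h (snd z))) * \<bar>sqrt (2*pi) / e\<bar>" for z
        using e by (intro mult_left_mono) auto
      then show "AE z in plane. norm (?H e z)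
           \<le> norm (h (fst z) * cnj (h (snd z)) * of_real (sqrt (2*pi) / e))"
        by (simp only: norm_mult norm_of_real) simp
    qed measurable
    have "(\<integral>\<^sup>+\<xi>. ennreal ((cmod (F \<xi>))\<^sup>2 * ?w e \<xi>) \<partial>lborel) = ennreal (LBINT \<xi>. (cmod (F \<xi>))\<^sup>2 * ?w e \<xi>)"
      by (rule nn_integral_eq_integral[OF fint]) auto
    also have "\<dots> = ennreal (cmod (\<integral>z. ?H e z \<partial>plane))"
      unfolding A[symmetric] by (subst norm_of_real) (simp add: Bochner_Integration.integral_nonneg)
    also have "\<dots> \<le> (\<integral>\<^sup>+z. ennreal (norm (?H e z)) \<partial>plane)"
      by (rule integral_norm_bound_ennreal[OF iG])
    also have "\<dots> \<le> (\<integral>\<^sup>+z. ?q (fst z) * ennreal (?G e (fst z - snd z)) + ?q (snd z)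
        * ennreal (?G e (fst z - snd z)) \<partial>plane)"
    proof (rule nn_integral_mono)
      fix z :: "real \<times> real"
      have "0 \<le> ?G e (fst z - snd z)" using e by simp
      then show "ennreal (norm (?H e z))
          \<le> ?q (fst z) * ennreal (?G e (fst z - snd z)) + ?q (snd z) * ennreal (?G e (fst z - snd z))"
        by (rule norm_product_le_squares)
    qed
    also have "\<dots> = (\<integral>\<^sup>+z. ?q (fst z) * ennreal (?G e (fst z - snd z)) \<partial>plane)
        + (\<integral>\<^sup>+z. ?q (snd z) * ennreal (?G e (fst z - snd z)) \<partial>plane)"
      by (rule nn_integral_add) auto
    also have "(\<integral>\<^sup>+z. ?q (fst z) * ennreal (?G e (fst z - snd z)) \<partial>plane)
         = (\<integral>\<^sup>+x. \<integral>\<^sup>+y. ?q x * ennreal (?G e (x - y)) \<partial>lborel \<partial>lborel)"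
      by (subst lborel.nn_integral_fst[symmetric]) auto
    also have "\<dots> = (\<integral>\<^sup>+x. ?q x * ennreal (2 * pi) \<partial>lborel)"
      by (subst nn_integral_cmult) (auto simp only: nn_integral_gaussian[OF e], simp)
    also have "(\<integral>\<^sup>+z. ?q (snd z) * ennreal (?G e (fst z - snd z)) \<partial>plane)
         = (\<integral>\<^sup>+y. \<integral>\<^sup>+x. ?q y * ennreal (?G e (y - x)) \<partial>lborel \<partial>lborel)"
      by (subst lborel_pair.nn_integral_snd[symmetric]) (auto simp: power_divide power2_commute)
    also have "\<dots> = (\<integral>\<^sup>+x. ?q x * ennreal (2 * pi) \<partial>lborel)"
      by (subst nn_integral_cmult) (auto simp only: nn_integral_gaussian[OF e], simp)
    also have "(\<integral>\<^sup>+x. ?q x * ennreal (2 * pi) \<partial>lborel) + (\<integral>\<^sup>+x. ?q x * ennreal (2 * pi) \<partial>lborel)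
        = (\<integral>\<^sup>+x. ennreal (2 * pi) * ennreal ((cmod (h x))\<^sup>2) \<partial>lborel)"
      by (subst nn_integral_add[symmetric])
          (auto simp: ennreal_mult'[symmetric] ennreal_plus[symmetric] simp del: ennreal_plus intro!:
          nn_integral_cong)
    also have "\<dots> = ennreal (2 * pi) * ?I"
      by (rule nn_integral_cmult) auto
    finally show ?thesis .
  qed
  have lim: "(\<lambda>n. ennreal ((cmod (F \<xi>))\<^sup>2 * ?w (inverse (real (Suc n))) \<xi>))
      \<longlonglongrightarrow> ennreal ((cmod (F \<xi>))\<^sup>2)" for \<xi>
  proof -
    have "(\<lambda>n. (cmod (F \<xi>))\<^sup>2 * ?w (inverse (real (Suc n))) \<xi>) \<longlonglongrightarrow> (cmod (F \<xi>))\<^sup>2 * ?w 0 \<xi>"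
      by (intro tendsto_intros LIMSEQ_inverse_real_of_nat) simp
    then show ?thesis by (intro tendsto_ennrealI) simp
  qed
  have "(\<integral>\<^sup>+\<xi>. ennreal ((cmod (F \<xi>))\<^sup>2) \<partial>lborel)
      = (\<integral>\<^sup>+\<xi>. liminf (\<lambda>n. ennreal ((cmod (F \<xi>))\<^sup>2 * ?w (inverse (real (Suc n))) \<xi>)) \<partial>lborel)"
    by (intro nn_integral_cong lim_imp_Liminf[OF _ lim, symmetric]) simp
  also have "\<dots> \<le> liminf (\<lambda>n. \<integral>\<^sup>+\<xi>. ennreal ((cmod (F \<xi>))\<^sup>2 * ?w (inverse (real (Suc n))) \<xi>) \<partial>lborel)"
    by (rule nn_integral_liminf) measurable
  also have "\<dots> \<le> liminf (\<lambda>n::nat. ennreal (2 * pi) * ?I)"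
    by (intro Liminf_mono always_eventually allI main) simp
  finally show ?thesis by (simp add: F_def Liminf_const)
qed

section \<open>Gamma integrals and Laplace transforms\<close>

text \<open>Euler's integral for the Gamma function after the substitution \<open>t = c * \<alpha> powr \<gamma>\<close>.\<close>

lemma nn_integral_powr_exp:
  fixes p c \<gamma> :: real
  assumes "\<gamma> > 0" "c > 0" "p > -1"
  shows "(\<integral>\<^sup>+\<alpha>. ennreal (indicator {0<..} \<alpha> * (\<alpha> powr p * exp (- (c * \<alpha> powr \<gamma>)))) \<partial>lborel)
           = ennreal (Gamma ((p + 1) / \<gamma>) / \<gamma> * c powr (- ((p + 1) / \<gamma>)))"
proof -
  define q where "q = (p + 1) / \<gamma>"
  have q: "q > 0" using assms by (simp add: q_def)
  have pq: "\<gamma> * q = p + 1" using assms by (simp add: q_def)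
  let ?f = "\<lambda>t::real. t powr (q - 1) / exp t"
  let ?g = "\<lambda>\<alpha>::real. c * \<alpha> powr \<gamma>"
  let ?h = "\<lambda>\<alpha>::real. c * (\<gamma> * \<alpha> powr (\<gamma> - 1))"
  have f1: "(?f has_integral Gamma q) {0<..}"
  proof -
    have "negligible {t \<in> {0..} - {0<..}. ?f t \<noteq> 0}" "negligible {t \<in> {0<..} - {0..}. ?f t \<noteq> 0}"
      by (auto intro: negligible_subset[of "{0}"])
    from has_integral_spike_set_eq[OF this] show ?thesis using Gamma_integral_real[OF q] by simp
  qed
  have f2: "?f absolutely_integrable_on {0<..}"
    by (rule nonnegative_absolutely_integrable_1) (use f1 in auto)
  have im: "?g ` {0<..} = {0<..}"
  proof (intro equalityI subsetI)
    fix y :: real assume y: "y \<in> {0<..}"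
    have "y = ?g ((y / c) powr (1 / \<gamma>))" "(y / c) powr (1 / \<gamma>) > 0"
      using y assms by (auto simp: powr_powr)
    then show "y \<in> ?g ` {0<..}" by blast
  qed (use assms in auto)
  have "inj_on ?g {0<..}"
  proof (intro inj_onI)
    fix x y assume xy: "x \<in> {0<..}" "y \<in> {0<..}" "?g x = ?g y"
    then have "(x powr \<gamma>) powr (1 / \<gamma>) = (y powr \<gamma>) powr (1 / \<gamma>)" using assms by simp
    then show "x = y" using xy assms by (simp add: powr_powr)
  qed
  then have "(\<lambda>\<alpha>. \<bar>?h \<alpha>\<bar> * ?f (?g \<alpha>)) absolutely_integrable_on {0<..} \<and>
      integral {0<..} (\<lambda>\<alpha>. \<bar>?h \<alpha>\<bar> * ?f (?g \<alpha>)) = Gamma q"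
    by (subst has_absolute_integral_change_of_variables_1'[where g="?g"])
       (use f1 f2 im in \<open>auto intro!: derivative_eq_intros integral_unique\<close>)
  then have "((\<lambda>\<alpha>. \<bar>?h \<alpha>\<bar> * ?f (?g \<alpha>)) has_integral Gamma q) {0<..}"
    by (simp only: has_integral_iff) (blast intro: set_lebesgue_integral_eq_integral(1))
  then have "((\<lambda>\<alpha>. (\<bar>?h \<alpha>\<bar> * ?f (?g \<alpha>)) * (c powr (-q) / \<gamma>)) has_integral Gamma q * (c powr (-q) / \<gamma>))
      {0<..}"
    by (rule has_integral_mult_left)
  moreover have "(\<bar>?h \<alpha>\<bar> * ?f (?g \<alpha>)) * (c powr (-q) / \<gamma>) = \<alpha> powr p * exp (- (c * \<alpha> powr \<gamma>))"
      if "\<alpha> \<in> {0<..}" for \<alpha>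
  proof -
    have "\<alpha> powr (\<gamma> - 1) * (\<alpha> powr \<gamma>) powr (q - 1) = \<alpha> powr p"
      using that pq by (simp add: powr_powr powr_add[symmetric] algebra_simps)
    moreover have "c * c powr (q - 1) * c powr (- q) = 1"
      using assms by (simp add: powr_mult_base powr_add[symmetric])
    ultimately show ?thesis
      using that assms by (simp add: powr_mult exp_minus field_simps)
  qed
  ultimately have "((\<lambda>\<alpha>. \<alpha> powr p * exp (- (c * \<alpha> powr \<gamma>))) has_integral Gamma q * (c powr (-q) / \<gamma>))
      {0<..}"
    by (rule has_integral_eq[rotated])
  from nn_integral_has_integral_lebesgue[OF _ this] show ?thesis
    by (simp add: q_def)
qed

text \<open>Near 0 the integrand dominates \<open>exp (- c) / \<alpha>\<close>, whose integral diverges logarithmically.\<close>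

lemma nn_integral_powr_exp_infinite:
  fixes p c \<gamma> :: real
  assumes "\<gamma> > 0" "c > 0" "p \<le> -1"
  shows "(\<integral>\<^sup>+\<alpha>. ennreal (indicator {0<..} \<alpha> * (\<alpha> powr p * exp (- (c * \<alpha> powr \<gamma>)))) \<partial>lborel) = \<infinity>"
    (is "?I = _")
proof -
  have "ennreal (real n) \<le> ?I" for n :: nat
  proof -
    \<comment> \<open>Chosen so that \<open>exp (- c)\<close> times the integral of \<open>1 / \<alpha>\<close> over \<open>{\<delta>..1}\<close> is exactly \<open>n\<close>.\<close>
    define \<delta> where "\<delta> = exp (- (real n * exp c))"
    have \<delta>: "0 < \<delta>" "\<delta> \<le> 1" by (auto simp: \<delta>_def)
    have "ennreal (real n) = ennreal (exp (- c)) * ennreal (ln 1 - ln \<delta>)"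
      unfolding \<delta>_def by (simp only: ln_exp) (simp add: ennreal_mult'[symmetric] exp_minus)
    also have "ennreal (ln 1 - ln \<delta>) = (\<integral>\<^sup>+\<alpha>. ennreal (1 / \<alpha>) * indicator {\<delta>..1} \<alpha> \<partial>lborel)"
      by (rule nn_integral_FTC_Icc[symmetric]) (use \<delta> in \<open>auto intro!: derivative_eq_intros\<close>)
    also have "ennreal (exp (- c)) * \<dots>
        = (\<integral>\<^sup>+\<alpha>. ennreal (exp (- c)) * (ennreal (1 / \<alpha>) * indicator {\<delta>..1} \<alpha>) \<partial>lborel)"
      by (rule nn_integral_cmult[symmetric]) auto
    also have "\<dots> \<le> ?I"
    proof (rule nn_integral_mono)
      fix \<alpha> :: real
      have "exp (- c) * (1 / \<alpha>) \<le> \<alpha> powr p * exp (- (c * \<alpha> powr \<gamma>))" if "\<delta> \<le> \<alpha>" "\<alpha> \<le> 1"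
      proof -
        have "\<alpha> > 0" using that \<delta> by auto
        have "1 / \<alpha> = \<alpha> powr (-1)" using \<open>\<alpha> > 0\<close> by (simp add: powr_minus divide_simps)
        also have "\<dots> \<le> \<alpha> powr p" using assms that \<open>\<alpha> > 0\<close> by (intro powr_mono') auto
        finally have 1: "1 / \<alpha> \<le> \<alpha> powr p" .
        have "c * \<alpha> powr \<gamma> \<le> c" using assms that \<open>\<alpha> > 0\<close> by (simp add: powr_le1)
        then have "exp (- c) \<le> exp (- (c * \<alpha> powr \<gamma>))" by simp
        from mult_mono[OF this 1] show ?thesis using \<open>\<alpha> > 0\<close> by (simp add: mult.commute)
      qed
      then show "ennreal (exp (- c)) * (ennreal (1 / \<alpha>) * indicator {\<delta>..1} \<alpha>)
          \<le> ennreal (indicator {0<..} \<alpha> * (\<alpha> powr p * exp (- (c * \<alpha> powr \<gamma>))))"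
        using \<delta> by (auto simp: indicator_def ennreal_mult'[symmetric])
    qed
    finally show ?thesis .
  qed
  then show ?thesis
    by (metis ennreal_of_nat_eq_real_of_nat ennreal_Ex_less_of_nat infinity_ennreal_def leD
        top.not_eq_extremum)
qed

text \<open>The recursion in \<open>n\<close> comes from integrating the derivative of \<open>\<xi> ^ (n + 1) * exp (- \<xi> * w)\<close>, which
  vanishes at both ends of the half-line.\<close>

lemma laplace_power:
  fixes w :: complex
  assumes w: "Re w > 0"
  shows laplace_power_integrable:
      "integrable lborel (\<lambda>\<xi>. indicator {0<..} \<xi> *\<^sub>R (of_real \<xi> ^ n * exp (- (of_real \<xi> * w))))" (is ?A)
    and laplace_power_integral:
      "(LBINT \<xi>. indicator {0<..} \<xi> *\<^sub>R (of_real \<xi> ^ n * exp (- (of_real \<xi> * w))))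
          = fact n / w ^ (n + 1)" (is ?B)
proof -
  let ?f = "\<lambda>n \<xi>. of_real \<xi> ^ n * exp (- (of_real \<xi> * w))"
  have int: "integrable lborel (\<lambda>\<xi>. indicator {0<..} \<xi> *\<^sub>R ?f n \<xi>)" for n
  proof (rule integrableI_bounded)
    have "(\<integral>\<^sup>+\<xi>. ennreal (norm (indicator {0<..} \<xi> *\<^sub>R ?f n \<xi>)) \<partial>lborel)
       = (\<integral>\<^sup>+\<xi>. ennreal (indicator {0<..} \<xi> * (\<xi> powr real n * exp (- (Re w * \<xi> powr 1)))) \<partial>lborel)"
      by (rule nn_integral_cong) (auto simp: norm_mult norm_power indicator_def powr_realpow mult.commute)
    also have "\<dots> < \<infinity>" using w by (subst nn_integral_powr_exp) auto
    finally show "(\<integral>\<^sup>+\<xi>. ennreal (norm (indicator {0<..} \<xi> *\<^sub>R ?f n \<xi>)) \<partial>lborel) < \<infinity>" .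
  qed measurable
  show ?A by (rule int)
  have w0: "w \<noteq> 0" using w by auto
  have si: "set_integrable lborel (einterval 0 \<infinity>) (?f n)" for n
    using int[of n] by (simp add: set_integrable_def einterval_def zero_ereal_def[symmetric]
        greaterThan_def)
  have conv: "(LBINT x=0..\<infinity>. F x) = (LBINT \<xi>. indicator {0<..} \<xi> *\<^sub>R F \<xi>)" for F :: "real \<Rightarrow> complex"
    by (simp add: interval_lebesgue_integral_def set_lebesgue_integral_def einterval_def greaterThan_def)
  have tend: "((\<lambda>\<xi>. ?f n \<xi>) \<longlongrightarrow> 0) at_top" for n
  proof (rule tendsto_norm_zero_cancel)
    have "((\<lambda>\<xi>. (Re w * \<xi>) ^ n / exp (Re w * \<xi>)) \<longlongrightarrow> 0) at_top"
      by (rule filterlim_compose[OF tendsto_power_div_exp_0])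
         (use w in \<open>auto intro!: filterlim_tendsto_pos_mult_at_top[OF tendsto_const] filterlim_ident\<close>)
    then have "((\<lambda>\<xi>. (Re w * \<xi>) ^ n / exp (Re w * \<xi>) / Re w ^ n) \<longlongrightarrow> 0 / Re w ^ n) at_top"
      by (intro tendsto_intros) (use w in auto)
    moreover have "\<forall>\<^sub>F \<xi> in at_top. (Re w * \<xi>) ^ n / exp (Re w * \<xi>) / Re w ^ n = norm (?f n \<xi>)"
      using eventually_gt_at_top[of 0]
    proof eventually_elim
      case (elim \<xi>)
      have "norm (?f n \<xi>) = \<xi> ^ n * exp (- (\<xi> * Re w))"
        using elim by (simp add: norm_mult norm_power)
      then show ?case using w by (simp add: power_mult_distrib exp_minus field_simps)
    qed
    ultimately show "((\<lambda>\<xi>. norm (?f n \<xi>)) \<longlongrightarrow> 0) at_top"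
      by (auto elim: Lim_transform_eventually)
  qed
  have at0: "((\<lambda>\<xi>. ?f n \<xi>) \<longlongrightarrow> ?f n 0) (at_right 0)" for n
    by (intro tendsto_intros) 
  have d0: "(?f 0 has_vector_derivative - w * ?f 0 x) (at x)" for x
    by (rule has_vector_derivative_real_field[where f="\<lambda>z. z ^ 0 * exp (- (z * w))"])
       (auto intro!: derivative_eq_intros)
  have d1: "(?f (Suc n) has_vector_derivative of_nat (Suc n) * ?f n x - w * ?f (Suc n) x) (at x)" for n x
    by (rule has_vector_derivative_real_field[where f="\<lambda>z. z ^ Suc n * exp (- (z * w))"])
       (rule derivative_eq_intros refl | simp add: algebra_simps del: power_Suc of_nat_Suc)+
  show ?B
  proof (induction n)
    case 0
    have "(LBINT x=0..\<infinity>. - w * ?f 0 x) = 0 - 1"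
    proof (rule interval_integral_FTC_integrable[where F="?f 0"])
      show "set_integrable lborel (einterval 0 \<infinity>) (\<lambda>x. - w * ?f 0 x)"
        using si by (rule set_integrable_mult_right)
      show "((?f 0 \<circ> real_of_ereal) \<longlongrightarrow> 1) (at_right 0)"
        using at0[of 0] by (simp add: zero_ereal_def ereal_tendsto_simps1)
      show "((?f 0 \<circ> real_of_ereal) \<longlongrightarrow> 0) (at_left \<infinity>)"
        using tend[of 0] by (simp add: ereal_tendsto_simps1)
      show "isCont (\<lambda>x. - w * ?f 0 x) x" for x
        by (intro continuous_intros)
    qed (simp, rule d0)
    then have "(LBINT x. - w * (indicator {0<..} x *\<^sub>R ?f 0 x)) = - 1"
      unfolding conv by (simp add: mult_scaleR_right del: integral_mult_right_zero)
    then have "w * (LBINT x. indicator {0<..} x *\<^sub>R ?f 0 x) = 1"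
      by (subst (asm) integral_mult_right_zero) simp
    then show ?case using w0 by (simp add: eq_divide_eq mult.commute)
  next
    case (Suc n)
    have "(LBINT x=0..\<infinity>. of_nat (Suc n) * ?f n x - w * ?f (Suc n) x) = 0 - 0"
    proof (rule interval_integral_FTC_integrable[where F="?f (Suc n)"])
      show "set_integrable lborel (einterval 0 \<infinity>) (\<lambda>x. of_nat (Suc n) * ?f n x - w * ?f (Suc n) x)"
        by (intro set_integral_diff set_integrable_mult_right si)
      show "((?f (Suc n) \<circ> real_of_ereal) \<longlongrightarrow> 0) (at_right 0)"
        using at0[of "Suc n"] by (simp add: zero_ereal_def ereal_tendsto_simps1)
      show "((?f (Suc n) \<circ> real_of_ereal) \<longlongrightarrow> 0) (at_left \<infinity>)"
        using tend[of "Suc n"] by (simp add: ereal_tendsto_simps1)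
      show "isCont (\<lambda>x. of_nat (Suc n) * ?f n x - w * ?f (Suc n) x) x" for x
        by (intro continuous_intros)
    qed (simp, rule d1)
    then have "(LBINT x. of_nat (Suc n) * (indicator {0<..} x *\<^sub>R ?f n x) - w
        * (indicator {0<..} x *\<^sub>R ?f (Suc n) x)) = 0"
      unfolding conv mult_scaleR_right scaleR_diff_right[symmetric] by (simp only: diff_0_right diff_self)
    then have "of_nat (Suc n) * (LBINT x. indicator {0<..} x *\<^sub>R ?f n x) - w
        * (LBINT x. indicator {0<..} x *\<^sub>R ?f (Suc n) x) = 0"
      by (simp only: Bochner_Integration.integral_diff[OF integrable_mult_right[OF int]
          integrable_mult_right[OF int]] integral_mult_right_zero)
    then have "w * (LBINT x. indicator {0<..} x *\<^sub>R ?f (Suc n) x) = of_nat (Suc n) * (fact n / w ^ (n + 1))"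
      unfolding Suc.IH by (simp only: right_minus_eq)
    then have "(LBINT x. indicator {0<..} x *\<^sub>R ?f (Suc n) x) = of_nat (Suc n) * (fact n / w ^ (n + 1)) / w"
      using w0 by (simp only: eq_divide_eq mult.commute[of w]) simp
    also have "\<dots> = fact (Suc n) / w ^ (Suc n + 1)"
      by (simp only: fact_Suc) (simp add: mult.commute)
    finally show ?case .
  qed
qed

section \<open>Fourier inversion for powers\<close>

lemma borel_measurable_Complex [measurable (raw)]:
  fixes f g :: "'a \<Rightarrow> real"
  assumes [measurable]: "f \<in> borel_measurable M" "g \<in> borel_measurable M"
  shows "(\<lambda>x. Complex (f x) (g x)) \<in> borel_measurable M"
  unfolding Complex_eq by measurable

lemma integrable_inverse_square_plus:
  fixes b :: real
  assumes "b > 0"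
  shows "integrable lborel (\<lambda>t. 1 / (b\<^sup>2 + t\<^sup>2))"
proof -
  have "integrable lborel (\<lambda>t::real. inverse (1 + t\<^sup>2))"
    using integrable_inverse_1_plus_square by (simp add: set_integrable_def)
  then have "integrable lborel (\<lambda>t::real. (1 / min 1 (b\<^sup>2)) * inverse (1 + t\<^sup>2))"
    by (rule integrable_mult_right)
  then show ?thesis
  proof (rule Bochner_Integration.integrable_bound)
    have "norm (1 / (b\<^sup>2 + t\<^sup>2)) \<le> norm ((1 / min 1 (b\<^sup>2)) * inverse (1 + t\<^sup>2))" for t
    proof -
      have "min 1 (b\<^sup>2) * (1 + t\<^sup>2) \<le> b\<^sup>2 + t\<^sup>2"
        using mult_right_mono[of "min 1 (b\<^sup>2)" 1 "t\<^sup>2"] by (simp add: algebra_simps)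
      moreover have "0 < min 1 (b\<^sup>2) * (1 + t\<^sup>2)"
        using assms by (intro mult_pos_pos) (auto simp: add_pos_nonneg)
      ultimately have "1 / (b\<^sup>2 + t\<^sup>2) \<le> 1 / (min 1 (b\<^sup>2) * (1 + t\<^sup>2))"
        by (intro divide_left_mono) (auto intro!: mult_pos_pos)
      then show ?thesis using assms
        by (simp add: inverse_eq_divide add_nonneg_nonneg)
    qed
    then show "AE t in lborel. norm (1 / (b\<^sup>2 + t\<^sup>2)) \<le> norm ((1 / min 1 (b\<^sup>2)) * inverse (1 + t\<^sup>2))"
      by simp
  qed measurable
qed

text \<open>Two of the \<open>m + 2\<close> factors supply integrable decay in \<open>t\<close>; the others are bounded in terms of \<open>a\<close>
  alone.\<close>

lemma norm_power_Complex_ge: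
  fixes a b t :: real
  assumes "0 < b" "b \<le> a"
  shows "a ^ m * (b\<^sup>2 + t\<^sup>2) \<le> cmod (Complex a t) ^ (m + 2)"
proof -
  have "a \<le> cmod (Complex a t)" using abs_Re_le_cmod[of "Complex a t"] by simp
  moreover have "b\<^sup>2 + t\<^sup>2 \<le> (cmod (Complex a t))\<^sup>2"
    using assms by (simp add: cmod_power2 power_mono)
  ultimately show ?thesis
    using assms unfolding power_add by (intro mult_mono power_mono) auto
qed

lemma power_times_exp_le:
  fixes a \<xi> :: real
  assumes "a > 0" "\<xi> \<ge> 0"
  shows "\<xi> ^ n * exp (- (\<xi> * a)) \<le> fact n / a ^ n"
proof -
  have "(\<xi> * a) ^ n / fact n \<le> exp (\<xi> * a)"
    using sum_le_suminf[OF sums_summable[OF exp_converges[of "\<xi> * a"]], of "{n}"] assms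
    by (simp add: exp_def scaleR_conv_of_real divide_inverse mult.commute)
  then show ?thesis using assms by (simp add: exp_minus field_simps power_mult_distrib)
qed

text \<open>Fourier inversion of \<open>laplace_power\<close>, evaluated at the frequency 1.  Inserting the Laplace integral
  for the power yields a double integral over \<open>t\<close> and \<open>\<xi>\<close> that does not converge absolutely.
  With a Gaussian factor in \<open>t\<close> it does, and the integral over \<open>t\<close> becomes an approximate identity at
  \<open>\<xi> = 1\<close>.\<close>

lemma fourier_inverse_power:
  fixes a :: real
  assumes a: "a > 0"
  shows fourier_inverse_power_integrable: "integrable lborel (\<lambda>t. cis t / Complex a t ^ (m + 2))" (is ?A)
    and fourier_inverse_power_integral:
      "(LBINT t. cis t / Complex a t ^ (m + 2)) = of_real (2 * pi * exp (- a) / fact (m + 1))" (is ?B)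
proof -
  let ?n = "\<lambda>x::real. exp (- x\<^sup>2 / 2)"
  let ?F = "fact (m + 1)"
  define K where "K t = cis t / Complex a t ^ (m + 2)" for t
  have [measurable]: "K \<in> borel_measurable borel" unfolding K_def by measurable
  have Kb: "norm (K t) \<le> 1 / a ^ m * (1 / (a\<^sup>2 + t\<^sup>2))" for t
  proof -
    have "0 < a ^ m * (a\<^sup>2 + t\<^sup>2)" using a by (intro mult_pos_pos add_pos_nonneg) auto
    with norm_power_Complex_ge[OF a order_refl, of m t]
    have "1 / cmod (Complex a t) ^ (m + 2) \<le> 1 / (a ^ m * (a\<^sup>2 + t\<^sup>2))"
      by (intro divide_left_mono) auto
    then show ?thesis by (simp add: K_def norm_divide norm_power norm_mult)
  qed
  have iK: "integrable lborel K"
    by (rule Bochner_Integration.integrable_bound[OF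
        integrable_mult_right[OF integrable_inverse_square_plus[OF a], of "1 / a ^ m"]])
       (use order_trans[OF Kb abs_ge_self] in \<open>auto simp del: times_divide_eq_right abs_divide intro!:
           AE_I2\<close>)
  then show ?A by (simp only: K_def[abs_def])
  let ?w = "\<lambda>e t::real. exp (-(e * t)\<^sup>2 / 2)"
  \<comment> \<open>Up to the factorial, the Laplace density of the power: its value at 1 is the result.\<close>
  define q where "q \<xi> = indicator {0<..} \<xi> * (\<xi> ^ (m + 1) * exp (- (\<xi> * a)))" for \<xi> :: real
  have qm[measurable]: "q \<in> borel_measurable borel" unfolding q_def by measurable
  have Rea: "Re (Complex a t) > 0" for t using a by simp
  have lap: "1 / Complex a t ^ (m + 2) = (LBINT \<xi>. of_real (q \<xi>) * cis (- (\<xi> * t))) / fact (m + 1)" for t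
  proof -
    have "(LBINT \<xi>. of_real (q \<xi>) * cis (- (\<xi> * t))) = fact (m + 1) / Complex a t ^ (m + 1 + 1)"
      unfolding laplace_power_integral[OF Rea, symmetric]
      by (intro Bochner_Integration.integral_cong refl)
         (auto simp: q_def scaleR_conv_of_real complex_eq_iff exp_eq_polar Re_exp Im_exp indicator_def)
    then show ?thesis by (simp del: fact_Suc)
  qed
  have iq: "integrable lborel (\<lambda>\<xi>. complex_of_real (q \<xi>))"
  proof -
    have "integrable lborel (\<lambda>\<xi>. indicator {0<..} \<xi> *\<^sub>R
        (of_real \<xi> ^ (m + 1) * exp (- (of_real \<xi> * complex_of_real a))))"
      by (rule laplace_power_integrable) (use a in simp)
    then show ?thesis
      by (simp add: q_def scaleR_conv_of_real exp_of_real[symmetric] del: exp_of_real)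
  qed
  have gauss: "(LBINT t. K t * of_real (?w e t)) = 
      (LBINT x. of_real (sqrt (2 * pi) * (q (1 + e * x) * ?n x) / fact (m + 1)))" if e: "e > 0" for e
  proof -
    have iw: "integrable lborel (\<lambda>t. complex_of_real (?w e t))"
      using gaussian_fourier(1)[OF e, of 0] by simp
    have i1: "integrable plane (\<lambda>p. complex_of_real (q (fst p)) * complex_of_real (?w e (snd p)))"
      by (rule integrable_product[OF lborel.sigma_finite_measure_axioms lborel.sigma_finite_measure_axioms
          iq iw])
    have i2: "integrable plane (\<lambda>(\<xi>, t). of_real (q \<xi>) * (cis ((1 - \<xi>) * t) * of_real (?w e t)))"
      by (rule Bochner_Integration.integrable_bound[OF i1]) (auto simp: norm_mult)
    have inner: "(LBINT t. cis ((1 - \<xi>) * t) * of_real (?w e t))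
        = of_real (sqrt (2 * pi) / e * exp (-((1 - \<xi>) / e)\<^sup>2 / 2))" for \<xi>
      using gaussian_fourier(2)[OF e, of "1 - \<xi>"] by (simp only: mult.commute[of _ "1 - \<xi>"])
    have "(LBINT t. K t * of_real (?w e t))
        = (LBINT t. (LBINT \<xi>. of_real (q \<xi>) * (cis ((1 - \<xi>) * t) * of_real (?w e t))) / fact (m + 1))"
    proof (rule Bochner_Integration.integral_cong[OF refl])
      fix t :: real
      have "K t * of_real (?w e t) = (LBINT \<xi>. of_real (q \<xi>) * cis (- (\<xi> * t)))
          * (cis t * of_real (?w e t)) / fact (m + 1)"
      proof -
        have "K t = cis t * (1 / Complex a t ^ (m + 2))" by (simp add: K_def)
        then show ?thesis unfolding lap by (simp only: mult_ac times_divide_eq_left times_divide_eq_right)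
      qed
      also have "\<dots> = (LBINT \<xi>. of_real (q \<xi>) * cis (- (\<xi> * t)) * (cis t * of_real (?w e t))) / fact (m + 1)"
        by (subst integral_mult_left_zero) simp
      also have "(\<lambda>\<xi>. of_real (q \<xi>) * cis (- (\<xi> * t)) * (cis t * of_real (?w e t)))
          = (\<lambda>\<xi>. of_real (q \<xi>) * (cis ((1 - \<xi>) * t) * of_real (?w e t)))"
      proof
        fix \<xi>
        have "cis ((1 - \<xi>) * t) = cis (- (\<xi> * t)) * cis t" by (simp add: cis_mult algebra_simps)
        then show "of_real (q \<xi>) * cis (- (\<xi> * t)) * (cis t * of_real (?w e t))
            = of_real (q \<xi>) * (cis ((1 - \<xi>) * t) * of_real (?w e t))"
          by simp
      qed
      finally show "K t * of_real (?w e t)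
          = (LBINT \<xi>. of_real (q \<xi>) * (cis ((1 - \<xi>) * t) * of_real (?w e t))) / fact (m + 1)" .
    qed
    also have "\<dots> = (LBINT t. (LBINT \<xi>. of_real (q \<xi>) * (cis ((1 - \<xi>) * t) * of_real (?w e t))))
        / fact (m + 1)"
      by (rule integral_divide_zero)
    also have "(LBINT t. (LBINT \<xi>. of_real (q \<xi>) * (cis ((1 - \<xi>) * t) * of_real (?w e t)))) = 
        (LBINT \<xi>. (LBINT t. of_real (q \<xi>) * (cis ((1 - \<xi>) * t) * of_real (?w e t))))"
      by (rule lborel_pair.Fubini_integral[OF i2])
    also have "\<dots> = (LBINT \<xi>. of_real (q \<xi> * (sqrt (2 * pi) / e * exp (-((1 - \<xi>) / e)\<^sup>2 / 2))))"
      unfolding integral_mult_right_zero inner by (simp only: of_real_mult)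
    also have "\<dots> = \<bar>e\<bar> *\<^sub>R (LBINT x. of_real
        (q (1 + e * x) * (sqrt (2 * pi) / e * exp (-((1 - (1 + e * x)) / e)\<^sup>2 / 2))))"
      by (rule lborel_integral_real_affine) (use e in auto)
    also have "\<dots> / fact (m + 1) = (LBINT x.
        (of_real e * of_real (q (1 + e * x) * (sqrt (2 * pi) / e * exp (-((1 - (1 + e * x)) / e)\<^sup>2 / 2))))
        / fact (m + 1))"
      unfolding integral_divide_zero integral_mult_right_zero using e by (simp add: scaleR_conv_of_real)
    also have "\<dots> = (LBINT x. of_real (sqrt (2 * pi) * (q (1 + e * x) * ?n x) / fact (m + 1)))"
      using e by (intro Bochner_Integration.integral_cong) (auto simp: field_simps)
    finally show ?thesis .
  qed
  define \<epsilon> where "\<epsilon> = (\<lambda>j. inverse (real (Suc j)))"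
  have \<epsilon>: "\<epsilon> \<longlonglongrightarrow> 0" "\<epsilon> j > 0" for j
    unfolding \<epsilon>_def by (rule LIMSEQ_inverse_real_of_nat, simp)
  have lim1: "(\<lambda>j. LBINT t. K t * of_real (?w (\<epsilon> j) t)) \<longlonglongrightarrow> (LBINT t. K t)"
  proof (rule integral_dominated_convergence[where w="\<lambda>t. norm (K t)"])
    have "(\<lambda>j. K t * of_real (?w (\<epsilon> j) t)) \<longlonglongrightarrow> K t * of_real (?w 0 t)" for t
      by (intro tendsto_intros \<epsilon>) simp
    then show "AE t in lborel. (\<lambda>j. K t * of_real (?w (\<epsilon> j) t)) \<longlonglongrightarrow> K t" by simp
    show "AE t in lborel. norm (K t * of_real (?w (\<epsilon> j) t)) \<le> norm (K t)" for j
      by (auto simp: norm_mult intro!: mult_left_le)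
  qed (use iK in auto)
  have gint: "integrable lborel ?n"
    using gaussian_fourier(1)[of 1 0] by (simp add: complex_of_real_integrable_eq)
  have gval: "(LBINT x. ?n x) = sqrt (2 * pi)"
    using gaussian_fourier(2)[of 1 0] by (simp del: of_real_mult of_real_divide)
  have q0: "\<bar>q \<xi>\<bar> \<le> fact (m + 1) / a ^ (m + 1)" for \<xi>
    using power_times_exp_le[OF a, of \<xi> "m+1"] a by (auto simp: q_def indicator_def abs_mult)
  have lim2: "(\<lambda>j. LBINT x. sqrt (2 * pi) * (q (1 + \<epsilon> j * x) * ?n x) / fact (m + 1))
      \<longlonglongrightarrow> (LBINT x. sqrt (2 * pi) * (q 1 * ?n x) / fact (m + 1))"
  proof (rule integral_dominated_convergence[where w="\<lambda>x. sqrt (2 * pi)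
      * (fact (m + 1) / a ^ (m + 1) * ?n x) / fact (m + 1)"])
    have "(\<lambda>j. q (1 + \<epsilon> j * x)) \<longlonglongrightarrow> q 1" for x
    proof -
      have l1: "(\<lambda>j. 1 + \<epsilon> j * x) \<longlonglongrightarrow> 1 + 0 * x" by (intro tendsto_intros \<epsilon>)
      have "isCont q 1"
      proof -
        have c: "isCont (\<lambda>\<xi>. \<xi> ^ (m + 1) * exp (- (\<xi> * a))) 1" by (intro continuous_intros)
        have "\<forall>\<^sub>F \<xi> in nhds 1. q \<xi> = \<xi> ^ (m + 1) * exp (- (\<xi> * a))"
          unfolding eventually_nhds by (intro exI[of _ "{0<..}"]) (auto simp: q_def)
        from isCont_cong[OF this] c show ?thesis by simp
      qed
      then show ?thesis using isCont_tendsto_compose[of 1 q] l1 by simp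
    qed
    then show "AE x in lborel. (\<lambda>j. sqrt (2 * pi) * (q (1 + \<epsilon> j * x) * ?n x) / fact (m + 1))
        \<longlonglongrightarrow> sqrt (2 * pi) * (q 1 * ?n x) / fact (m + 1)"
      by (intro AE_I2 tendsto_intros) auto
    show "AE x in lborel. norm (sqrt (2 * pi) * (q (1 + \<epsilon> j * x) * ?n x) / fact (m + 1))
        \<le> sqrt (2 * pi) * (fact (m + 1) / a ^ (m + 1) * ?n x) / fact (m + 1)" for j
    proof (rule AE_I2)
      fix x :: real
      have "norm (sqrt (2 * pi) * (q (1 + \<epsilon> j * x) * ?n x) / fact (m + 1))
          = sqrt (2 * pi) * (\<bar>q (1 + \<epsilon> j * x)\<bar> * ?n x) / fact (m + 1)"
        by (simp add: abs_mult del: fact_Suc)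
      also have "\<dots> \<le> sqrt (2 * pi) * (fact (m + 1) / a ^ (m + 1) * ?n x) / fact (m + 1)"
        by (intro divide_right_mono mult_left_mono mult_right_mono q0) auto
      finally show "norm (sqrt (2 * pi) * (q (1 + \<epsilon> j * x) * ?n x) / fact (m + 1))
          \<le> sqrt (2 * pi) * (fact (m + 1) / a ^ (m + 1) * ?n x) / fact (m + 1)" .
    qed
  qed (use gint in auto)
  have "(\<lambda>j. LBINT t. K t * of_real (?w (\<epsilon> j) t))
      \<longlonglongrightarrow> of_real (LBINT x. sqrt (2 * pi) * (q 1 * ?n x) / fact (m + 1))"
    using tendsto_of_real[OF lim2, where 'a=complex] unfolding gauss[OF \<epsilon>(2)]
    by (simp only: integral_complex_of_real)
  from LIMSEQ_unique[OF lim1 this] have "(LBINT t. K t)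
      = of_real (LBINT x. sqrt (2 * pi) * (q 1 * ?n x) / fact (m + 1))" .
  also have "(LBINT x. sqrt (2 * pi) * (q 1 * ?n x) / fact (m + 1)) = 2 * pi * exp (- a) / fact (m + 1)"
    unfolding integral_divide_zero integral_mult_right_zero gval by (simp add: q_def)
  finally show ?B by (simp only: K_def)
qed

section \<open>The operator in the coordinates \<open>s\<close> and \<open>\<alpha>\<close>\<close>

text \<open>The squared norm on \<open>L\<^sup>2\<close> of the half-plane \<open>\<alpha> > 0\<close> with the measure \<open>\<alpha>\<^sup>r ds d\<alpha>\<close>.  Its values are
  extended reals, so that finiteness can be a conclusion.\<close>

definition half_norm2 :: "real \<Rightarrow> (real \<times> real \<Rightarrow> complex) \<Rightarrow> ennreal" where
  "half_norm2 r g = (\<integral>\<^sup>+\<alpha>. \<integral>\<^sup>+s. ennreal (indicator {0<..} \<alpha> * \<alpha> powr r * (cmod (g (s, \<alpha>)))\<^sup>2)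
      \<partial>lborel \<partial>lborel)"

definition leray_const :: "real \<Rightarrow> nat \<Rightarrow> real" where
  "leray_const \<gamma> k = \<gamma>\<^sup>2 * (of_nat k + 1) / (2 * pi)"

definition leray_kernel :: "real \<Rightarrow> nat \<Rightarrow> real \<times> real \<Rightarrow> real \<times> real \<Rightarrow> complex" where
  "leray_kernel \<gamma> k z w =
     complex_of_real (kernel_B \<gamma> (snd w) (snd z)) ^ k / kernel_A \<gamma> (fst w) (snd w) (fst z) (snd z) ^ (k + 2)
       * complex_of_real (snd w powr (\<gamma> - 1))"

definition reduced_leray :: "real \<Rightarrow> nat \<Rightarrow> (real \<times> real \<Rightarrow> complex) \<Rightarrow> real \<times> real \<Rightarrow> complex" where
  "reduced_leray \<gamma> k g z = complex_of_real (leray_const \<gamma> k) *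
     (LBINT \<alpha>:{0<..}. LBINT s. leray_kernel \<gamma> k z (s, \<alpha>) * g (s, \<alpha>))"

text \<open>At frequency \<open>\<xi>\<close>, the squared norm of the output function \<open>\<beta> ^ k * exp (- \<xi> * \<beta> powr \<gamma>)\<close> for
  the weight \<open>\<alpha> powr r\<close>.\<close>

definition synthesis_weight :: "real \<Rightarrow> nat \<Rightarrow> real \<Rightarrow> real \<Rightarrow> ennreal" where
  "synthesis_weight \<gamma> k r \<xi> =
     (\<integral>\<^sup>+\<alpha>. ennreal (indicator {0<..} \<alpha> * (\<alpha> powr (2 * real k + r) * exp (- (2 * \<xi> * \<alpha> powr \<gamma>)))) \<partial>lborel)"

text \<open>At frequency \<open>\<xi>\<close>, the squared norm of the function paired with the input.  It is
  taken for the dual weight \<open>\<alpha> powr (- r)\<close>, as the pairing itself is unweighted.\<close>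

definition analysis_weight :: "real \<Rightarrow> nat \<Rightarrow> real \<Rightarrow> real \<Rightarrow> ennreal" where
  "analysis_weight \<gamma> k r \<xi> =
     (\<integral>\<^sup>+\<alpha>. ennreal (indicator {0<..} \<alpha>
         * (\<alpha> powr (2 * (\<gamma> - 1) * (real k + 1) - r) * exp (- (2 * \<xi> * (\<gamma> - 1) * \<alpha> powr \<gamma>)))) \<partial>lborel)"

lemma leray_const_pos: "\<gamma> > 1 \<Longrightarrow> leray_const \<gamma> k > 0"
  by (simp add: leray_const_def add_nonneg_pos)

lemma two_pi_leray_const: "2 * pi * leray_const \<gamma> k * \<gamma> ^ k / fact (k + 1) = \<gamma> ^ (k + 2) / fact k"
proof -
  have "2 * pi * leray_const \<gamma> k = \<gamma>\<^sup>2 * (real k + 1)" by (simp add: leray_const_def)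
  moreover have "fact (k + 1) = (real k + 1) * fact k" by (simp add: add.commute)
  ultimately show ?thesis by (simp add: power_add power2_eq_square mult.commute del: fact_Suc)
qed

lemma weights_eq:
  assumes "\<gamma> > 1" "r \<in> r_interval \<gamma> k" "\<xi> > 0"
  defines "x \<equiv> (2 * real k + 1 + r) / \<gamma>"
  defines "y \<equiv> 2 * real k + 2 - x"
  shows "x > 0" "y > 0"
    and "synthesis_weight \<gamma> k r \<xi> = ennreal (Gamma x / \<gamma> * (2 * \<xi>) powr (- x))"
    and "analysis_weight \<gamma> k r \<xi> = ennreal (Gamma y / \<gamma> * (2 * \<xi> * (\<gamma> - 1)) powr (- y))"
proof -
  have r: "- 2 * real k - 1 < r" "r < (2 * real k + 2) * (\<gamma> - 1) + 1"
    using assms(2) by (auto simp: r_interval_def)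
  show "x > 0" using assms(1) r by (simp add: x_def)
  have y: "y = (2 * (\<gamma> - 1) * (real k + 1) - r + 1) / \<gamma>"
    using assms(1) by (simp add: y_def x_def field_simps)
  show "y > 0" unfolding y using assms(1) r by (simp add: field_simps)
  have x: "x = (2 * real k + r + 1) / \<gamma>" by (simp add: x_def add_ac)
  show "synthesis_weight \<gamma> k r \<xi> = ennreal (Gamma x / \<gamma> * (2 * \<xi>) powr (- x))"
    unfolding synthesis_weight_def x
    by (rule nn_integral_powr_exp) (use assms r in auto)
  show "analysis_weight \<gamma> k r \<xi> = ennreal (Gamma y / \<gamma> * (2 * \<xi> * (\<gamma> - 1)) powr (- y))"
    unfolding analysis_weight_def y
    by (rule nn_integral_powr_exp) (use assms r in \<open>auto simp: algebra_simps\<close>)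
qed

text \<open>The exponents \<open>x\<close> and \<open>y\<close> of \<open>1 / \<xi>\<close> in the two weights add up to \<open>2 * k + 2\<close>.  Hence the rank
  one operators at all frequencies have the same norm.\<close>

lemma weights_scaling:
  assumes \<gamma>: "\<gamma> > 1" and r: "r \<in> r_interval \<gamma> k" and \<xi>: "\<xi> > 0"
  shows "ennreal (\<xi> ^ (2 * k + 2)) * (synthesis_weight \<gamma> k r \<xi> * analysis_weight \<gamma> k r \<xi>)
       = synthesis_weight \<gamma> k r 1 * analysis_weight \<gamma> k r 1"
proof -
  define x where "x = (2 * real k + 1 + r) / \<gamma>"
  define y where "y = 2 * real k + 2 - x"
  note W = weights_eq[OF \<gamma> r, folded x_def, folded y_def]
  have pos: "Gamma x > 0" "Gamma y > 0" using W(1,2)[OF zero_less_one] by (auto intro: Gamma_real_pos)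
  have "\<xi> ^ (2 * k + 2) * \<xi> powr (- x) * \<xi> powr (- y) = \<xi> powr (real (2 * k + 2) - x - y)"
    using \<xi> by (subst powr_realpow[symmetric]) (auto simp: powr_add[symmetric])
  also have "real (2 * k + 2) - x - y = 0" by (simp add: y_def)
  finally have *: "\<xi> ^ (2 * k + 2) * \<xi> powr (- x) * \<xi> powr (- y) = 1" using \<xi> by simp
  have a: "(2 * \<xi>) powr (- x) = 2 powr (- x) * \<xi> powr (- x)"
    using \<xi> by (simp add: powr_mult)
  have b: "(2 * \<xi> * (\<gamma> - 1)) powr (- y) = (2 * (\<gamma> - 1)) powr (- y) * \<xi> powr (- y)"
    using powr_mult[of "2 * (\<gamma> - 1)" \<xi> "- y"] \<xi> \<gamma> by (simp add: mult_ac)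
  have "\<xi> ^ (2 * k + 2) * ((Gamma x / \<gamma> * (2 * \<xi>) powr (- x))
      * (Gamma y / \<gamma> * (2 * \<xi> * (\<gamma> - 1)) powr (- y)))
    = (\<xi> ^ (2 * k + 2) * \<xi> powr (- x) * \<xi> powr (- y))
        * ((Gamma x / \<gamma> * 2 powr (- x)) * (Gamma y / \<gamma> * (2 * (\<gamma> - 1)) powr (- y)))"
    unfolding a b by (simp only: mult_ac times_divide_eq_left times_divide_eq_right)
  then show ?thesis
    unfolding W(3,4)[OF \<xi>] W(3,4)[OF zero_less_one] * using \<gamma> \<xi> pos
    by (simp add: ennreal_mult'[symmetric] less_imp_le)
qed

lemma C_const_eq_weights:
  assumes \<gamma>: "\<gamma> > 1" and r: "r \<in> r_interval \<gamma> k"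
  shows "ennreal (C_const \<gamma> r k)
      = ennreal ((\<gamma> ^ (k + 2) / fact k)\<^sup>2) * (synthesis_weight \<gamma> k r 1 * analysis_weight \<gamma> k r 1)"
    and "C_const \<gamma> r k > 0"
proof -
  define x where "x = (2 * real k + 1 + r) / \<gamma>"
  define y where "y = 2 * real k + 2 - x"
  note W = weights_eq[OF \<gamma> r zero_less_one, folded x_def, folded y_def]
  have pos: "Gamma x > 0" "Gamma y > 0" using W(1,2) by (auto intro: Gamma_real_pos)
  have C: "C_const \<gamma> r k = Gamma x * Gamma y / (fact k)\<^sup>2 * (\<gamma> / 2) ^ (2 * k + 2) * (\<gamma> - 1) powr (- y)"
    using Gamma_fact[of k, where 'a=real] by (simp add: C_const_def x_def y_def add.commute)
  show "C_const \<gamma> r k > 0" unfolding C using pos \<gamma> by (intro mult_pos_pos divide_pos_pos) auto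
  have "2 powr (-x) * 2 powr (-y) = 2 powr (- real (2 * k + 2))"
    by (simp add: powr_add[symmetric] y_def algebra_simps)
  also have "\<dots> = 1 / 2 ^ (2 * k + 2)"
    by (subst powr_minus_divide, subst powr_realpow) auto
  finally have two: "2 powr (-x) * 2 powr (-y) = 1 / (2::real) ^ (2 * k + 2)" .
  have "(\<gamma> ^ (k + 2) / fact k)\<^sup>2
      * ((Gamma x / \<gamma> * (2 * 1) powr (- x)) * (Gamma y / \<gamma> * (2 * 1 * (\<gamma> - 1)) powr (- y)))
     = (\<gamma> ^ (k + 2) / fact k)\<^sup>2 * (Gamma x / \<gamma>) * (Gamma y / \<gamma>) * (2 powr (-x) * 2 powr (-y))
         * (\<gamma> - 1) powr (- y)"
    using powr_mult[of 2 "\<gamma> - 1" "- y"] \<gamma> by simp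
  also have "\<dots> = C_const \<gamma> r k"
    unfolding C two using \<gamma> by (simp add: power_divide power_add power_mult power2_eq_square field_simps
        power_mult_distrib)
  finally show "ennreal (C_const \<gamma> r k)
      = ennreal ((\<gamma> ^ (k + 2) / fact k)\<^sup>2) * (synthesis_weight \<gamma> k r 1 * analysis_weight \<gamma> k r 1)"
    unfolding W using \<gamma> pos by (simp add: ennreal_mult'[symmetric] less_imp_le)
qed

text \<open>The lower end of the interval is where the synthesis weight diverges, the upper end is where the
  analysis weight does.\<close>

lemma weights_infinite:
  assumes \<gamma>: "\<gamma> > 1" and r: "r \<notin> r_interval \<gamma> k"
  shows "synthesis_weight \<gamma> k r 1 = \<infinity> \<or> analysis_weight \<gamma> k r 1 = \<infinity>"
proof (cases "r \<le> - 2 * real k - 1")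
  case True
  then have "synthesis_weight \<gamma> k r 1 = \<infinity>"
    unfolding synthesis_weight_def using \<gamma> by (intro nn_integral_powr_exp_infinite) auto
  then show ?thesis ..
next
  case False
  then have "(2 * real k + 2) * (\<gamma> - 1) + 1 \<le> r" using r by (auto simp: r_interval_def)
  then have "analysis_weight \<gamma> k r 1 = \<infinity>"
    unfolding analysis_weight_def using \<gamma>
    by (intro nn_integral_powr_exp_infinite) (auto simp: algebra_simps)
  then show ?thesis ..
qed

lemma leray_kernel_eq:
  assumes "\<gamma> > 1" "\<alpha> > 0" "\<beta> > 0"
  shows "leray_kernel \<gamma> k (t, \<beta>) (s, \<alpha>) =
     of_real (\<gamma> ^ k * \<beta> ^ k * \<alpha> powr ((\<gamma> - 1) * (real k + 1))) / Complex ((\<gamma> - 1) * \<alpha> powr \<gamma> + \<beta> powr \<gamma>)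
         (s - t) ^ (k + 2)"
proof -
  have "(\<alpha> powr (\<gamma> - 1)) ^ k * \<alpha> powr (\<gamma> - 1) = \<alpha> powr ((\<gamma> - 1) * (real k + 1))"
    using assms by (simp add: powr_realpow[symmetric] powr_powr powr_add[symmetric] algebra_simps)
  then have "complex_of_real ((\<alpha> powr (\<gamma> - 1)) ^ k * \<alpha> powr (\<gamma> - 1))
      = of_real (\<alpha> powr ((\<gamma> - 1) * (real k + 1)))"
    by (rule arg_cong)
  then show ?thesis
    by (simp add: leray_kernel_def kernel_A_def kernel_B_def power_mult_distrib)
qed

section \<open>Decomposition into frequencies and the upper bound\<close>

text \<open>The pairing of the frequency slice of \<open>g\<close> with the analysing function: all that the operator
  retains of \<open>g\<close> at the frequency \<open>\<xi>\<close>.\<close>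

definition leray_profile :: "real \<Rightarrow> nat \<Rightarrow> (real \<times> real \<Rightarrow> complex) \<Rightarrow> real \<Rightarrow> complex" where
  "leray_profile \<gamma> k g \<xi> = (LBINT \<alpha>.
     of_real (indicator {0<..} \<alpha> * \<alpha> powr ((\<gamma> - 1) * (real k + 1)) * exp (- (\<xi> * ((\<gamma> - 1) * \<alpha> powr \<gamma>)))) *
     (LBINT s. g (s, \<alpha>) * cis (- (\<xi> * s))))"

text \<open>Inserting \<open>laplace_power\<close> for \<open>1 / A ^ (k + 2)\<close> and exchanging the integrals over \<open>(s, \<alpha>)\<close> and
  \<open>\<xi>\<close> exhibits the operator, in its output variable \<open>t\<close>, as a Fourier integral over positive
  frequencies.\<close>

lemma reduced_leray_fourier:
  fixes g :: "real \<times> real \<Rightarrow> complex"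
  assumes \<gamma>: "\<gamma> > 1" and \<beta>: "\<beta> > 0"
    and iu: "integrable plane (\<lambda>z. g z
        * of_real (indicator {0<..} (snd z) * snd z powr ((\<gamma> - 1) * (real k + 1))))"
    and gm[measurable]: "g \<in> borel_measurable (borel \<Otimes>\<^sub>M borel)"
  defines "h \<equiv> (\<lambda>\<xi>. of_real (indicator {0<..} \<xi> * (\<xi> ^ (k + 1) * exp (- (\<xi> * \<beta> powr \<gamma>))))
      * leray_profile \<gamma> k g \<xi>)"
  shows "integrable lborel h"
    and "reduced_leray \<gamma> k g (t, \<beta>)
        = of_real (leray_const \<gamma> k * \<gamma> ^ k / fact (k + 1) * \<beta> ^ k) * (LBINT \<xi>. h \<xi> * cis (\<xi> * t))"
proof -
  define u where "u z = g z * of_real (indicator {0<..} (snd z) * snd z powr ((\<gamma> - 1) * (real k + 1)))" for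
      z
  define v where "v \<xi> = indicator {0<..} \<xi> * (\<xi> ^ (k + 1) * exp (- (\<xi> * \<beta> powr \<gamma>)))" for \<xi> :: real
  define e where "e z \<xi> = exp (- (\<xi> * ((\<gamma> - 1) * snd z powr \<gamma>)))" for z :: "real \<times> real" and \<xi> :: real
  \<comment> \<open>The integrand of the triple integral: integrating over \<open>\<xi>\<close> first gives the kernel, integrating over \<open>z\<close> first gives \<open>h\<close>.\<close>
  define W where "W t z \<xi> = u z * of_real (v \<xi> * e z \<xi>) * cis (- (\<xi> * (fst z - t)))" for t z \<xi>
  have h: "h \<xi> = of_real (v \<xi>) * leray_profile \<gamma> k g \<xi>" for \<xi> by (simp add: h_def v_def)
  have iu': "integrable plane u" using iu by (simp add: u_def[abs_def])
  have [measurable]: "u \<in> borel_measurable (borel \<Otimes>\<^sub>M borel)" unfolding u_def by measurable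
  have [measurable]: "v \<in> borel_measurable borel" unfolding v_def by measurable
  have em[measurable]: "case_prod e \<in> borel_measurable ((borel \<Otimes>\<^sub>M borel) \<Otimes>\<^sub>M borel)"
      unfolding e_def case_prod_beta' by measurable
  have e1: "\<bar>e z \<xi>\<bar> \<le> 1" if "\<xi> > 0" for z \<xi> using that \<gamma> by (simp add: e_def)
  have v0: "v \<xi> = 0" if "\<not> \<xi> > 0" for \<xi> using that by (simp add: v_def)
  have iv: "integrable lborel (\<lambda>\<xi>. complex_of_real (v \<xi>))"
  proof -
    have "integrable lborel (\<lambda>\<xi>. indicator {0<..} \<xi> *\<^sub>R
        (of_real \<xi> ^ (k + 1) * exp (- (of_real \<xi> * complex_of_real (\<beta> powr \<gamma>)))))"
      by (rule laplace_power_integrable) (use \<beta> in simp)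
    then show ?thesis
      by (simp add: v_def scaleR_conv_of_real exp_of_real[symmetric] del: exp_of_real)
  qed
  interpret P: pair_sigma_finite "plane" "lborel :: real measure"
    using sigma_finite_plane lborel.sigma_finite_measure_axioms by (simp add: pair_sigma_finite_def)
  have i1: "integrable (plane \<Otimes>\<^sub>M lborel) (\<lambda>p. u (fst p) * of_real (v (snd p)))"
    by (rule integrable_product[OF sigma_finite_plane lborel.sigma_finite_measure_axioms iu' iv])
  have iW: "integrable (plane \<Otimes>\<^sub>M lborel) (case_prod (W t))" for t
  proof (rule Bochner_Integration.integrable_bound[OF i1])
    show "case_prod (W t) \<in> borel_measurable (plane \<Otimes>\<^sub>M lborel)"
      unfolding W_def e_def by measurable
    have "norm (W t z \<xi>) \<le> norm (u z * of_real (v \<xi>))" for z \<xi>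
    proof (cases "\<xi> > 0")
      case True
      then show ?thesis using e1[OF True, of z]
        by (simp add: W_def norm_mult abs_mult mult_left_le mult.assoc[symmetric])
    qed (simp add: W_def v0)
    then show "AE p in plane \<Otimes>\<^sub>M lborel. norm (case_prod (W t) p) \<le> norm (u (fst p) * of_real (v (snd p)))"
      by (auto simp: case_prod_beta')
  qed
  have Wz: "(\<integral>z. W t z \<xi> \<partial>plane) = h \<xi> * cis (\<xi> * t)" for t \<xi>
  proof (cases "\<xi> > 0")
    case True
    have ie: "integrable plane (\<lambda>(s, \<alpha>). u (s, \<alpha>) * of_real (e (s, \<alpha>) \<xi>) * cis (- (\<xi> * s)))"
    proof (rule Bochner_Integration.integrable_bound[OF iu'])
      show "(\<lambda>(s, \<alpha>). u (s, \<alpha>) * of_real (e (s, \<alpha>) \<xi>) * cis (- (\<xi> * s))) \<in> borel_measurable plane"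
        unfolding e_def by measurable
    qed (use e1[OF True] in \<open>auto simp: norm_mult mult_left_le\<close>)
    have "(\<integral>z. W t z \<xi> \<partial>plane) = (\<integral>z. of_real (v \<xi>) * cis (\<xi> * t)
        * (u z * of_real (e z \<xi>) * cis (- (\<xi> * fst z))) \<partial>plane)"
    proof (rule Bochner_Integration.integral_cong[OF refl])
      fix z :: "real \<times> real"
      have "cis (- (\<xi> * (fst z - t))) = cis (\<xi> * t) * cis (- (\<xi> * fst z))"
        by (simp add: cis_mult algebra_simps)
      then show "W t z \<xi> = of_real (v \<xi>) * cis (\<xi> * t) * (u z * of_real (e z \<xi>) * cis (- (\<xi> * fst z)))"
        by (simp add: W_def)
    qed
    also have "\<dots> = of_real (v \<xi>) * cis (\<xi> * t) * (\<integral>z. (u z * of_real (e z \<xi>) * cis (- (\<xi> * fst z))) \<partial>plane)"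
      by (rule integral_mult_right_zero)
    also have "(\<integral>z. (u z * of_real (e z \<xi>) * cis (- (\<xi> * fst z))) \<partial>plane)
        = (\<integral>(s, \<alpha>). u (s, \<alpha>) * of_real (e (s, \<alpha>) \<xi>) * cis (- (\<xi> * s)) \<partial>plane)"
      by (simp add: case_prod_beta')
    also have "\<dots> = (LBINT \<alpha>. LBINT s. u (s, \<alpha>) * of_real (e (s, \<alpha>) \<xi>) * cis (- (\<xi> * s)))"
      by (rule lborel_pair.integral_snd[OF ie, symmetric])
    also have "\<dots> = leray_profile \<gamma> k g \<xi>"
      unfolding leray_profile_def integral_mult_right_zero[symmetric]
      by (simp add: u_def e_def mult_ac)
    finally show ?thesis by (simp add: h)
  qed (simp add: W_def v0 h)
  have W\<xi>: "(LBINT \<xi>. W t z \<xi>) = u z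
      * (fact (k + 1) / Complex ((\<gamma> - 1) * snd z powr \<gamma> + \<beta> powr \<gamma>) (fst z - t) ^ (k + 2))"
    if "snd z > 0" for t z
  proof -
    let ?w = "Complex ((\<gamma> - 1) * snd z powr \<gamma> + \<beta> powr \<gamma>) (fst z - t)"
    have w: "Re ?w > 0" using \<gamma> \<beta> by (simp add: add_nonneg_pos)
    have Weq: "W t z \<xi> = u z * (indicator {0<..} \<xi> *\<^sub>R (of_real \<xi> ^ (k + 1) * exp (- (of_real \<xi> * ?w))))"
        for \<xi>
    proof -
      have "exp (- (of_real \<xi> * ?w)) = of_real (exp (- (\<xi> * \<beta> powr \<gamma>)) * e z \<xi>) * cis (- (\<xi> * (fst z - t)))"
        by (simp add: e_def complex_eq_iff Re_exp Im_exp exp_add[symmetric] algebra_simps)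
      then show ?thesis by (simp add: W_def v_def scaleR_conv_of_real)
    qed
    show ?thesis
      unfolding Weq integral_mult_right_zero laplace_power_integral[OF w]
      by (simp only: add.assoc one_add_one)
  qed
  have ih: "integrable lborel (\<lambda>\<xi>. h \<xi> * cis (\<xi> * 0))"
    using P.integrable_snd[OF iW[of 0]] unfolding Wz .
  then show "integrable lborel h" by simp
  have "(LBINT \<xi>. h \<xi> * cis (\<xi> * t)) = (LBINT \<xi>. \<integral>z. W t z \<xi> \<partial>plane)"
    by (simp only: Wz)
  also have "\<dots> = (\<integral>z. (LBINT \<xi>. W t z \<xi>) \<partial>plane)"
    by (rule P.Fubini_integral[OF iW])
  also have "\<dots> = (\<integral>(s, \<alpha>). (LBINT \<xi>. W t (s, \<alpha>) \<xi>) \<partial>plane)"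
    by (simp add: case_prod_beta')
  also have "\<dots> = (LBINT \<alpha>. LBINT s. LBINT \<xi>. W t (s, \<alpha>) \<xi>)"
    using P.integrable_fst[OF iW[of t]]
    by (intro lborel_pair.integral_snd[symmetric]) (simp add: case_prod_beta')
  finally have main: "(LBINT \<xi>. h \<xi> * cis (\<xi> * t)) = (LBINT \<alpha>. LBINT s. LBINT \<xi>. W t (s, \<alpha>) \<xi>)" .
  have ptw: "indicator {0<..} \<alpha> *\<^sub>R (leray_kernel \<gamma> k (t, \<beta>) (s, \<alpha>) * g (s, \<alpha>))
      = of_real (\<gamma> ^ k / fact (k + 1) * \<beta> ^ k) * (LBINT \<xi>. W t (s, \<alpha>) \<xi>)" for s \<alpha>
  proof (cases "\<alpha> > 0")
    case True
    show ?thesis using True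
      by (simp add: W\<xi> leray_kernel_eq[OF \<gamma> True \<beta>] u_def del: fact_Suc)
  next
    case False
    then show ?thesis by (simp add: W_def u_def)
  qed
  have "reduced_leray \<gamma> k g (t, \<beta>)
      = of_real (leray_const \<gamma> k) * (LBINT \<alpha>. LBINT s. indicator {0<..} \<alpha> *\<^sub>R
      (leray_kernel \<gamma> k (t, \<beta>) (s, \<alpha>) * g (s, \<alpha>)))"
    by (simp add: reduced_leray_def set_lebesgue_integral_def)
  also have "\<dots> = of_real (leray_const \<gamma> k)
      * (of_real (\<gamma> ^ k / fact (k + 1) * \<beta> ^ k) * (LBINT \<xi>. h \<xi> * cis (\<xi> * t)))"
    unfolding ptw main integral_mult_right_zero ..
  finally show "reduced_leray \<gamma> k g (t, \<beta>)
      = of_real (leray_const \<gamma> k * \<gamma> ^ k / fact (k + 1) * \<beta> ^ k) * (LBINT \<xi>. h \<xi> * cis (\<xi> * t))"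
    by simp
qed

lemma fourier_L2_le_neg:
  fixes h :: "real \<Rightarrow> complex"
  assumes int: "integrable lborel h"
  shows "(\<integral>\<^sup>+\<xi>. ennreal ((cmod (LBINT x. h x * cis (- (\<xi> * x))))\<^sup>2) \<partial>lborel)
           \<le> ennreal (2 * pi) * (\<integral>\<^sup>+x. ennreal ((cmod (h x))\<^sup>2) \<partial>lborel)"
proof -
  have "(LBINT x. h x * cis (- (\<xi> * x))) = cnj (LBINT x. cnj (h x) * cis (\<xi> * x))" for \<xi>
    by (subst Bochner_Integration.integral_cnj[symmetric]) (simp add: cis_cnj)
  then show ?thesis using fourier_L2_le[of "\<lambda>x. cnj (h x)"] int by simp
qed

text \<open>The Cauchy-Schwarz inequality, with \<open>\<alpha> powr (r / 2)\<close> attached to the slice of \<open>g\<close> and its inverse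
  to the analysing function.\<close>

lemma leray_profile_bound:
  fixes g :: "real \<times> real \<Rightarrow> complex"
  assumes [measurable]: "g \<in> borel_measurable (borel \<Otimes>\<^sub>M borel)"
  shows "ennreal ((cmod (leray_profile \<gamma> k g \<xi>))\<^sup>2) \<le> analysis_weight \<gamma> k r \<xi> *
     (\<integral>\<^sup>+\<alpha>. ennreal (indicator {0<..} \<alpha> * \<alpha> powr r * (cmod (LBINT s. g (s, \<alpha>) * cis (- (\<xi> * s))))\<^sup>2)
         \<partial>lborel)"
proof -
  define G where "G \<alpha> = (LBINT s. g (s, \<alpha>) * cis (- (\<xi> * s)))" for \<alpha>
  have [measurable]: "G \<in> borel_measurable borel" unfolding G_def by measurable
  define F where "F \<alpha> = complex_of_real
      (indicator {0<..} \<alpha> * \<alpha> powr ((\<gamma> - 1) * (real k + 1)) * exp (- (\<xi> * ((\<gamma> - 1) * \<alpha> powr \<gamma>))))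
      * G \<alpha>" for \<alpha>
  define f1 where "f1 \<alpha> = indicator {0<..} \<alpha>
      * (\<alpha> powr ((\<gamma> - 1) * (real k + 1) - r / 2) * exp (- (\<xi> * ((\<gamma> - 1) * \<alpha> powr \<gamma>))))" for \<alpha> :: real
  define f2 where "f2 \<alpha> = indicator {0<..} \<alpha> * (\<alpha> powr (r / 2) * cmod (G \<alpha>))" for \<alpha> :: real
  have [measurable]: "f1 \<in> borel_measurable borel" "f2 \<in> borel_measurable borel"
    unfolding f1_def f2_def by measurable
  have f12: "norm (F \<alpha>) = f1 \<alpha> * f2 \<alpha>" for \<alpha>
  proof (cases "\<alpha> > 0")
    case True
    have "\<alpha> powr ((\<gamma> - 1) * (real k + 1)) = \<alpha> powr ((\<gamma> - 1) * (real k + 1) - r / 2) * \<alpha> powr (r / 2)"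
      by (simp add: powr_add[symmetric])
    then show ?thesis using True by (simp add: F_def f1_def f2_def norm_mult abs_mult)
  qed (simp add: F_def f1_def f2_def)
  have nonneg: "f1 \<alpha> \<ge> 0" "f2 \<alpha> \<ge> 0" for \<alpha> by (auto simp: f1_def f2_def)
  have LP: "leray_profile \<gamma> k g \<xi> = integral\<^sup>L lborel F"
    by (simp only: leray_profile_def F_def[abs_def] G_def)
  have "ennreal (cmod (leray_profile \<gamma> k g \<xi>)) \<le> (\<integral>\<^sup>+\<alpha>. ennreal (norm (F \<alpha>)) \<partial>lborel)"
  proof (cases "integrable lborel F")
    case True
    then show ?thesis unfolding LP by (rule integral_norm_bound_ennreal)
  next
    case False
    then show ?thesis unfolding LP by (simp add: not_integrable_integral_eq)
  qed
  also have "\<dots> = (\<integral>\<^sup>+\<alpha>. ennreal (f1 \<alpha>) * ennreal (f2 \<alpha>) \<partial>lborel)"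
    by (simp add: f12 ennreal_mult' nonneg)
  finally have "(ennreal (cmod (leray_profile \<gamma> k g \<xi>)))\<^sup>2
      \<le> (\<integral>\<^sup>+\<alpha>. ennreal (f1 \<alpha>) * ennreal (f2 \<alpha>) \<partial>lborel)\<^sup>2"
    by (intro power_mono) auto
  also have "\<dots> \<le> (\<integral>\<^sup>+\<alpha>. (ennreal (f1 \<alpha>))\<^sup>2 \<partial>lborel) * (\<integral>\<^sup>+\<alpha>. (ennreal (f2 \<alpha>))\<^sup>2 \<partial>lborel)"
    by (rule Cauchy_Schwarz_nn_integral) auto
  also have "(\<integral>\<^sup>+\<alpha>. (ennreal (f1 \<alpha>))\<^sup>2 \<partial>lborel) = analysis_weight \<gamma> k r \<xi>"
    unfolding analysis_weight_def
  proof (intro nn_integral_cong)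
    fix \<alpha> :: real
    have "(f1 \<alpha>)\<^sup>2 = indicator {0<..} \<alpha>
        * (\<alpha> powr (2 * (\<gamma> - 1) * (real k + 1) - r) * exp (- (2 * \<xi> * (\<gamma> - 1) * \<alpha> powr \<gamma>)))"
      by (cases "\<alpha> > 0") (simp_all add: f1_def power_mult_distrib power2_eq_square powr_add[symmetric]
          exp_add[symmetric] algebra_simps)
    then show "(ennreal (f1 \<alpha>))\<^sup>2 = ennreal
        (indicator {0<..} \<alpha> * (\<alpha> powr (2 * (\<gamma> - 1) * (real k + 1) - r)
        * exp (- (2 * \<xi> * (\<gamma> - 1) * \<alpha> powr \<gamma>))))"
      by (simp only: ennreal_power[OF nonneg(1)])
  qed
  also have "(\<integral>\<^sup>+\<alpha>. (ennreal (f2 \<alpha>))\<^sup>2 \<partial>lborel)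
      = (\<integral>\<^sup>+\<alpha>. ennreal (indicator {0<..} \<alpha> * \<alpha> powr r * (cmod (G \<alpha>))\<^sup>2) \<partial>lborel)"
  proof (intro nn_integral_cong)
    fix \<alpha> :: real
    have "(f2 \<alpha>)\<^sup>2 = indicator {0<..} \<alpha> * \<alpha> powr r * (cmod (G \<alpha>))\<^sup>2"
    proof (cases "\<alpha> > 0")
      case True
      have "\<alpha> powr r = \<alpha> powr (r / 2) * \<alpha> powr (r / 2)" by (simp add: powr_add[symmetric])
      then show ?thesis using True by (simp add: f2_def power_mult_distrib power2_eq_square)
    qed (simp add: f2_def)
    then show "(ennreal (f2 \<alpha>))\<^sup>2 = ennreal (indicator {0<..} \<alpha> * \<alpha> powr r * (cmod (G \<alpha>))\<^sup>2)"
      by (simp only: ennreal_power[OF nonneg(2)])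
  qed
  finally show ?thesis by (simp add: G_def ennreal_power)
qed

lemma ennreal_product_eq:
  fixes a b c d e f :: real
  assumes "a * b * c = d * (e * f)" "0 \<le> a" "0 \<le> b" "0 \<le> c" "0 \<le> d" "0 \<le> e" "0 \<le> f"
  shows "ennreal a * ennreal b * ennreal c = ennreal d * (ennreal e * ennreal f)"
  using assms by (simp add: ennreal_mult[symmetric])

text \<open>Plancherel's inequality in \<open>t\<close> reduces the left-hand side to an integral over \<open>\<xi>\<close> and \<open>\<beta>\<close> in which
  the integral over \<open>\<beta>\<close> is the synthesis weight.  Then \<open>leray_profile_bound\<close> brings in the analysis
  weight, the product of the two weights no longer depends on \<open>\<xi>\<close>, and Plancherel's inequality in \<open>s\<close>
  returns to \<open>g\<close>.\<close>

lemma half_norm2_reduced_leray_le: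
  fixes g :: "real \<times> real \<Rightarrow> complex"
  assumes \<gamma>: "\<gamma> > 1" and r: "r \<in> r_interval \<gamma> k"
    and iu: "integrable plane (\<lambda>z. g z
        * of_real (indicator {0<..} (snd z) * snd z powr ((\<gamma> - 1) * (real k + 1))))"
    and ig: "\<And>\<alpha>. \<alpha> > 0 \<Longrightarrow> integrable lborel (\<lambda>s. g (s, \<alpha>))"
    and gm[measurable]: "g \<in> borel_measurable (borel \<Otimes>\<^sub>M borel)"
  shows "half_norm2 r (reduced_leray \<gamma> k g) \<le> ennreal (C_const \<gamma> r k) * half_norm2 r g"
proof -
  define \<kappa> where "\<kappa> = leray_const \<gamma> k * \<gamma> ^ k / fact (k + 1)"
  let ?k = "ennreal (2 * pi * \<kappa>\<^sup>2)"
  let ?W = "synthesis_weight \<gamma> k r 1 * analysis_weight \<gamma> k r 1"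
  let ?d = "\<lambda>\<alpha>. indicator {0<..} \<alpha> * \<alpha> powr r"
  let ?L = "\<lambda>t \<beta>. reduced_leray \<gamma> k g (t, \<beta>)"
  define P where "P = leray_profile \<gamma> k g"
  define G where "G \<xi> \<alpha> = (LBINT s. g (s, \<alpha>) * cis (- (\<xi> * s)))" for \<xi> \<alpha>
  define Q where "Q \<xi> \<alpha> = ennreal (?d \<alpha> * (cmod (G \<xi> \<alpha>))\<^sup>2)" for \<xi> \<alpha>
  define h where "h \<beta> \<xi> = of_real (indicator {0<..} \<xi> * (\<xi> ^ (k + 1) * exp (- (\<xi> * \<beta> powr \<gamma>))))
      * P \<xi>" for \<beta> \<xi>
  define S where "S \<beta> \<xi> = ennreal
      (indicator {0<..} \<beta> * (\<beta> powr (2 * real k + r) * exp (- (2 * \<xi> * \<beta> powr \<gamma>))))" for \<beta> \<xi>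
  define V where "V \<xi> = ennreal (indicator {0<..} \<xi> * \<xi> ^ (2 * k + 2) * (cmod (P \<xi>))\<^sup>2)" for \<xi>
  have Gm[measurable]: "case_prod G \<in> borel_measurable (borel \<Otimes>\<^sub>M borel)" unfolding G_def by measurable
  have Pm[measurable]: "P \<in> borel_measurable borel"
    unfolding P_def leray_profile_def by measurable
  have [measurable]: "case_prod Q \<in> borel_measurable (borel \<Otimes>\<^sub>M borel)" unfolding Q_def by measurable
  have [measurable]: "case_prod h \<in> borel_measurable (borel \<Otimes>\<^sub>M borel)" unfolding h_def by measurable
  have [measurable]: "case_prod S \<in> borel_measurable (borel \<Otimes>\<^sub>M borel)" unfolding S_def by measurable
  have [measurable]: "V \<in> borel_measurable borel" unfolding V_def by measurable
  have k0: "0 \<le> \<kappa>" unfolding \<kappa>_def using leray_const_pos[OF \<gamma>, of k] \<gamma> by (simp add: less_imp_le)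
  have rf1: "integrable lborel (h \<beta>)" if "\<beta> > 0" for \<beta>
    using reduced_leray_fourier(1)[OF \<gamma> that iu gm] by (simp only: h_def[abs_def] P_def)
  have rf2: "?L t \<beta> = of_real (\<kappa> * \<beta> ^ k) * (LBINT \<xi>. h \<beta> \<xi> * cis (t * \<xi>))" if "\<beta> > 0" for t \<beta>
    using reduced_leray_fourier(2)[OF \<gamma> that iu gm, of t]
    by (simp only: h_def P_def \<kappa>_def mult.commute[of t])
  have step1: "(\<integral>\<^sup>+t. ennreal (?d \<beta> * (cmod (?L t \<beta>))\<^sup>2) \<partial>lborel)
       \<le> (\<integral>\<^sup>+\<xi>. ?k * (V \<xi> * S \<beta> \<xi>) \<partial>lborel)" for \<beta>
  proof (cases "\<beta> > 0")
    case True
    have "(\<integral>\<^sup>+t. ennreal (?d \<beta> * (cmod (?L t \<beta>))\<^sup>2) \<partial>lborel)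
      = (\<integral>\<^sup>+t. ennreal (\<beta> powr r * (\<kappa> * \<beta> ^ k)\<^sup>2) * ennreal ((cmod (LBINT \<xi>. h \<beta> \<xi> * cis (t * \<xi>)))\<^sup>2)
          \<partial>lborel)"
      using True k0
      by (intro nn_integral_cong) (simp add: rf2[OF True] norm_mult norm_power power_mult_distrib
          ennreal_mult'[symmetric] mult_ac)
    also have "\<dots> = ennreal (\<beta> powr r * (\<kappa> * \<beta> ^ k)\<^sup>2)
        * (\<integral>\<^sup>+t. ennreal ((cmod (LBINT \<xi>. h \<beta> \<xi> * cis (t * \<xi>)))\<^sup>2) \<partial>lborel)"
      by (rule nn_integral_cmult) measurable
    also have "\<dots> \<le> ennreal (\<beta> powr r * (\<kappa> * \<beta> ^ k)\<^sup>2)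
        * (ennreal (2 * pi) * (\<integral>\<^sup>+\<xi>. ennreal ((cmod (h \<beta> \<xi>))\<^sup>2) \<partial>lborel))"
      by (intro mult_left_mono fourier_L2_le rf1[OF True]) auto
    also have "\<dots> = (\<integral>\<^sup>+\<xi>. (ennreal (\<beta> powr r * (\<kappa> * \<beta> ^ k)\<^sup>2) * ennreal (2 * pi))
        * ennreal ((cmod (h \<beta> \<xi>))\<^sup>2) \<partial>lborel)"
      by (subst nn_integral_cmult) (auto simp: mult.assoc)
    also have "\<dots> = (\<integral>\<^sup>+\<xi>. ?k * (V \<xi> * S \<beta> \<xi>) \<partial>lborel)"
    proof (intro nn_integral_cong)
      fix \<xi> :: real
      have a: "\<beta> powr r * (\<beta> ^ k)\<^sup>2 = \<beta> powr (2 * real k + r)"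
      proof -
        have "\<beta> powr (2 * real k + r) = \<beta> powr real k * \<beta> powr real k * \<beta> powr r"
          by (simp add: powr_add[symmetric])
        then show ?thesis using True by (simp add: powr_realpow power2_eq_square)
      qed
      have b: "(exp (- (\<xi> * \<beta> powr \<gamma>)))\<^sup>2 = exp (- (2 * \<xi> * \<beta> powr \<gamma>))"
        by (simp add: power2_eq_square exp_add[symmetric])
      have c: "(\<xi> ^ (k + 1))\<^sup>2 = \<xi> ^ (2 * k + 2)"
        using power_mult[of \<xi> "k + 1" 2] by (simp only: add_mult_distrib mult.commute[of k] mult_1)
      have "(cmod (h \<beta> \<xi>))\<^sup>2 = indicator {0<..} \<xi> * ((\<xi> ^ (k + 1))\<^sup>2 * (exp (- (\<xi> * \<beta> powr \<gamma>)))\<^sup>2)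
          * (cmod (P \<xi>))\<^sup>2"
        by (simp add: h_def norm_mult norm_power power_mult_distrib indicator_def del: power_Suc)
      then have eq: "(\<beta> powr r * (\<kappa> * \<beta> ^ k)\<^sup>2) * (2 * pi) * (cmod (h \<beta> \<xi>))\<^sup>2
          = 2 * pi * \<kappa>\<^sup>2 * ((indicator {0<..} \<xi> * \<xi> ^ (2 * k + 2) * (cmod (P \<xi>))\<^sup>2)
              * (indicator {0<..} \<beta> * (\<beta> powr (2 * real k + r) * exp (- (2 * \<xi> * \<beta> powr \<gamma>)))))"
        unfolding a[symmetric] b[symmetric] c[symmetric] using True
        by (simp add: power_mult_distrib mult_ac del: power_Suc)
      have ev: "0 \<le> \<xi> ^ (2 * k + 2)" unfolding c[symmetric] by simp
      show "ennreal (\<beta> powr r * (\<kappa> * \<beta> ^ k)\<^sup>2) * ennreal (2 * pi) * ennreal ((cmod (h \<beta> \<xi>))\<^sup>2)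
          = ?k * (V \<xi> * S \<beta> \<xi>)"
        unfolding V_def S_def
        by (rule ennreal_product_eq[OF eq])
           (intro mult_nonneg_nonneg ev zero_le_power2 powr_ge_zero exp_ge_zero indicator_pos_le pi_ge_zero
               zero_le_numeral)+
    qed
    finally show ?thesis .
  qed simp
  have step2: "?k * (V \<xi> * synthesis_weight \<gamma> k r \<xi>)
       \<le> ?k * ?W * (\<integral>\<^sup>+\<alpha>. Q \<xi> \<alpha> \<partial>lborel)" for \<xi>
  proof (cases "\<xi> > 0")
    case True
    have "V \<xi> * synthesis_weight \<gamma> k r \<xi>
        = ennreal (\<xi> ^ (2 * k + 2)) * ennreal ((cmod (P \<xi>))\<^sup>2) * synthesis_weight \<gamma> k r \<xi>"
      using True by (simp add: V_def ennreal_mult'[symmetric])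
    also have "\<dots> \<le> ennreal (\<xi> ^ (2 * k + 2)) * (analysis_weight \<gamma> k r \<xi> * (\<integral>\<^sup>+\<alpha>. Q \<xi> \<alpha> \<partial>lborel))
        * synthesis_weight \<gamma> k r \<xi>"
      unfolding P_def Q_def G_def by (intro mult_left_mono mult_right_mono leray_profile_bound gm) auto
    also have "\<dots> = (ennreal (\<xi> ^ (2 * k + 2)) * (synthesis_weight \<gamma> k r \<xi> * analysis_weight \<gamma> k r \<xi>))
        * (\<integral>\<^sup>+\<alpha>. Q \<xi> \<alpha> \<partial>lborel)"
      by (simp only: mult_ac)
    finally show ?thesis unfolding weights_scaling[OF \<gamma> r True]
      by (simp add: mult.assoc mult_left_mono)
  qed (simp add: V_def)
  have step3: "(\<integral>\<^sup>+\<xi>. Q \<xi> \<alpha> \<partial>lborel)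
      \<le> ennreal (2 * pi) * (\<integral>\<^sup>+s. ennreal (?d \<alpha> * (cmod (g (s, \<alpha>)))\<^sup>2) \<partial>lborel)" for \<alpha>
  proof (cases "\<alpha> > 0")
    case True
    have "(\<integral>\<^sup>+\<xi>. Q \<xi> \<alpha> \<partial>lborel) = (\<integral>\<^sup>+\<xi>. ennreal (\<alpha> powr r) * ennreal ((cmod (G \<xi> \<alpha>))\<^sup>2) \<partial>lborel)"
      using True by (simp add: Q_def ennreal_mult'[symmetric])
    also have "\<dots> = ennreal (\<alpha> powr r) * (\<integral>\<^sup>+\<xi>. ennreal ((cmod (G \<xi> \<alpha>))\<^sup>2) \<partial>lborel)"
      by (rule nn_integral_cmult) measurable
    also have "\<dots> \<le> ennreal (\<alpha> powr r) * (ennreal (2 * pi) * (\<integral>\<^sup>+s. ennreal ((cmod (g (s, \<alpha>)))\<^sup>2) \<partial>lborel))"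
      unfolding G_def by (intro mult_left_mono fourier_L2_le_neg ig True) auto
    also have "\<dots> = ennreal (2 * pi) * (\<integral>\<^sup>+s. ennreal (\<alpha> powr r) * ennreal ((cmod (g (s, \<alpha>)))\<^sup>2) \<partial>lborel)"
      by (subst nn_integral_cmult) (auto simp: mult_ac)
    also have "\<dots> = ennreal (2 * pi) * (\<integral>\<^sup>+s. ennreal (?d \<alpha> * (cmod (g (s, \<alpha>)))\<^sup>2) \<partial>lborel)"
      using True by (simp add: ennreal_mult'[symmetric])
    finally show ?thesis .
  qed (simp add: Q_def)
  have "half_norm2 r (reduced_leray \<gamma> k g) \<le> (\<integral>\<^sup>+\<beta>. \<integral>\<^sup>+\<xi>. ?k * (V \<xi> * S \<beta> \<xi>) \<partial>lborel \<partial>lborel)"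
    unfolding half_norm2_def by (intro nn_integral_mono step1)
  also have "\<dots> = (\<integral>\<^sup>+\<xi>. \<integral>\<^sup>+\<beta>. ?k * (V \<xi> * S \<beta> \<xi>) \<partial>lborel \<partial>lborel)"
    by (rule lborel_pair.Fubini'[symmetric]) measurable
  also have "\<dots> = (\<integral>\<^sup>+\<xi>. ?k * (V \<xi> * synthesis_weight \<gamma> k r \<xi>) \<partial>lborel)"
    unfolding synthesis_weight_def S_def[symmetric] by (simp add: nn_integral_cmult)
  also have "\<dots> \<le> (\<integral>\<^sup>+\<xi>. ?k * ?W * (\<integral>\<^sup>+\<alpha>. Q \<xi> \<alpha> \<partial>lborel) \<partial>lborel)"
    by (intro nn_integral_mono step2)
  also have "\<dots> = ?k * ?W * (\<integral>\<^sup>+\<xi>. \<integral>\<^sup>+\<alpha>. Q \<xi> \<alpha> \<partial>lborel \<partial>lborel)"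
    by (rule nn_integral_cmult) measurable
  also have "(\<integral>\<^sup>+\<xi>. \<integral>\<^sup>+\<alpha>. Q \<xi> \<alpha> \<partial>lborel \<partial>lborel) = (\<integral>\<^sup>+\<alpha>. \<integral>\<^sup>+\<xi>. Q \<xi> \<alpha> \<partial>lborel \<partial>lborel)"
    by (rule lborel_pair.Fubini'[symmetric]) measurable
  also have "?k * ?W * (\<integral>\<^sup>+\<alpha>. \<integral>\<^sup>+\<xi>. Q \<xi> \<alpha> \<partial>lborel \<partial>lborel)
     \<le> ?k * ?W * (\<integral>\<^sup>+\<alpha>. ennreal (2 * pi) * (\<integral>\<^sup>+s. ennreal (?d \<alpha> * (cmod (g (s, \<alpha>)))\<^sup>2) \<partial>lborel) \<partial>lborel)"
    by (intro mult_left_mono nn_integral_mono step3) auto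
  also have "(\<integral>\<^sup>+\<alpha>. ennreal (2 * pi) * (\<integral>\<^sup>+s. ennreal (?d \<alpha> * (cmod (g (s, \<alpha>)))\<^sup>2) \<partial>lborel) \<partial>lborel)
      = ennreal (2 * pi) * half_norm2 r g"
    unfolding half_norm2_def by (rule nn_integral_cmult) measurable
  also have "?k * ?W * (ennreal (2 * pi) * half_norm2 r g)
      = (?k * ennreal (2 * pi)) * ?W * half_norm2 r g"
    by (simp only: mult_ac)
  also have "?k * ennreal (2 * pi) = ennreal ((\<gamma> ^ (k + 2) / fact k)\<^sup>2)"
  proof -
    have e: "2 * pi * \<kappa> = \<gamma> ^ (k + 2) / fact k"
      using two_pi_leray_const[of \<gamma> k] by (simp add: \<kappa>_def del: fact_Suc)
    have "2 * pi * \<kappa>\<^sup>2 * (2 * pi) = (\<gamma> ^ (k + 2) / fact k)\<^sup>2"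
      unfolding e[symmetric] by (simp add: power2_eq_square)
    then show ?thesis by (subst ennreal_mult''[symmetric]) auto
  qed
  finally show ?thesis by (simp only: C_const_eq_weights(1)[OF \<gamma> r])
qed

section \<open>Wave packets and the lower bound\<close>

lemma leray_kernel_measurable [measurable]:
  "case_prod (leray_kernel \<gamma> k) \<in> borel_measurable ((borel \<Otimes>\<^sub>M borel) \<Otimes>\<^sub>M (borel \<Otimes>\<^sub>M borel))"
  unfolding leray_kernel_def kernel_A_def kernel_B_def by measurable

lemma reduced_leray_measurable [measurable]:
  assumes [measurable]: "g \<in> borel_measurable (borel \<Otimes>\<^sub>M borel)"
  shows "reduced_leray \<gamma> k g \<in> borel_measurable (borel \<Otimes>\<^sub>M borel)"
  unfolding reduced_leray_def set_lebesgue_integral_def by measurable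

text \<open>For the weight \<open>\<alpha> powr r\<close> this is the direction of equality in \<open>leray_profile_bound\<close> at the
  frequency 1, cut off so that the packets stay away from the axis \<open>\<alpha> = 0\<close>.  Its pairing with the
  analysing function and its squared norm are the same number, the truncated analysis weight
  (\<open>packet_analysis_density\<close>, \<open>packet_norm_density\<close>).\<close>

definition packet_profile :: "real \<Rightarrow> nat \<Rightarrow> real \<Rightarrow> nat \<Rightarrow> real \<Rightarrow> real" where
  "packet_profile \<gamma> k r N \<alpha> = indicator {1 / real (Suc N)..real (Suc N)} \<alpha> *
     (\<alpha> powr ((\<gamma> - 1) * (real k + 1) - r) * exp (- ((\<gamma> - 1) * \<alpha> powr \<gamma>)))"

definition wave_packet :: "real \<Rightarrow> nat \<Rightarrow> real \<Rightarrow> nat \<Rightarrow> nat \<Rightarrow> real \<times> real \<Rightarrow> complex" where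
  "wave_packet \<gamma> k r N n = (\<lambda>(s, \<alpha>). cis s
      * of_real (indicator {- real n..real n} s * packet_profile \<gamma> k r N \<alpha>))"

definition truncated_analysis_weight :: "real \<Rightarrow> nat \<Rightarrow> real \<Rightarrow> nat \<Rightarrow> ennreal" where
  "truncated_analysis_weight \<gamma> k r N = (\<integral>\<^sup>+\<alpha>. ennreal (indicator {1 / real (Suc N)..real (Suc N)} \<alpha> *
     (\<alpha> powr (2 * (\<gamma> - 1) * (real k + 1) - r) * exp (- (2 * (\<gamma> - 1) * \<alpha> powr \<gamma>)))) \<partial>lborel)"

lemma packet_profile_measurable [measurable]: "packet_profile \<gamma> k r N \<in> borel_measurable borel"
  unfolding packet_profile_def by measurable

lemma wave_packet_measurable [measurable]: "wave_packet \<gamma> k r N n \<in> borel_measurable (borel \<Otimes>\<^sub>M borel)"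
  unfolding wave_packet_def by measurable

lemma packet_support: "packet_profile \<gamma> k r N \<alpha> \<noteq> 0 \<Longrightarrow> \<alpha> > 0"
  by (auto simp: packet_profile_def indicator_def intro: less_le_trans[of 0 "1 / real (Suc N)"] split:
      if_splits)

lemma packet_profile_nonneg: "packet_profile \<gamma> k r N \<alpha> \<ge> 0"
  by (simp add: packet_profile_def)

lemma packet_analysis_density:
  "\<alpha> powr ((\<gamma> - 1) * (real k + 1)) * exp (- ((\<gamma> - 1) * \<alpha> powr \<gamma>)) * packet_profile \<gamma> k r N \<alpha>
     = indicator {1 / real (Suc N)..real (Suc N)} \<alpha> *
       (\<alpha> powr (2 * (\<gamma> - 1) * (real k + 1) - r) * exp (- (2 * (\<gamma> - 1) * \<alpha> powr \<gamma>)))"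
  by (simp add: packet_profile_def exp_add[symmetric] algebra_simps powr_add[symmetric] del: of_nat_Suc)

lemma packet_norm_density:
  "indicator {0<..} \<alpha> * \<alpha> powr r * (packet_profile \<gamma> k r N \<alpha>)\<^sup>2
     = indicator {1 / real (Suc N)..real (Suc N)} \<alpha> *
       (\<alpha> powr (2 * (\<gamma> - 1) * (real k + 1) - r) * exp (- (2 * (\<gamma> - 1) * \<alpha> powr \<gamma>)))"
proof (cases "\<alpha> \<in> {1 / real (Suc N)..real (Suc N)}")
  case True
  then have "\<alpha> > 0" by (auto intro: less_le_trans[of 0 "1 / real (Suc N)"])
  have "\<alpha> powr r * (\<alpha> powr ((\<gamma> - 1) * (real k + 1) - r))\<^sup>2 = \<alpha> powr (2 * (\<gamma> - 1) * (real k + 1) - r)"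
    by (simp add: power2_eq_square powr_add[symmetric] algebra_simps)
  moreover have "(exp (- ((\<gamma> - 1) * \<alpha> powr \<gamma>)))\<^sup>2 = exp (- (2 * (\<gamma> - 1) * \<alpha> powr \<gamma>))"
    by (simp add: power2_eq_square exp_add[symmetric])
  ultimately show ?thesis using True \<open>\<alpha> > 0\<close>
    by (simp add: packet_profile_def power_mult_distrib del: of_nat_Suc)
qed (simp add: packet_profile_def)

lemma continuous_on_powr_exp:
  "continuous_on {1 / real (Suc N)..real (Suc N)} (\<lambda>\<alpha>. \<alpha> powr a * exp (- (c * \<alpha> powr \<gamma>)))"
  by (intro continuous_intros) (auto dest: less_le_trans[of 0 "1 / real (Suc N)", rotated] simp del:
      of_nat_Suc)

lemma truncated_analysis_weight_finite: "truncated_analysis_weight \<gamma> k r N < \<infinity>"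
proof -
  let ?I = "{1 / real (Suc N)..real (Suc N)}"
  have "continuous_on ?I (\<lambda>\<alpha>. \<alpha> powr (2 * (\<gamma> - 1) * (real k + 1) - r) * exp (- (2 * (\<gamma> - 1) * \<alpha> powr \<gamma>)))"
    by (rule continuous_on_powr_exp)
  then have "set_integrable lborel ?I
      (\<lambda>\<alpha>. \<alpha> powr (2 * (\<gamma> - 1) * (real k + 1) - r) * exp (- (2 * (\<gamma> - 1) * \<alpha> powr \<gamma>)))"
    by (rule borel_integrable_atLeastAtMost')
  then show ?thesis unfolding truncated_analysis_weight_def set_integrable_def
    by (subst nn_integral_eq_integral) auto
qed

lemma packet_profile_integrable: "integrable lborel (\<lambda>\<alpha>. \<alpha> powr q * packet_profile \<gamma> k r N \<alpha>)"
proof -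
  let ?I = "{1 / real (Suc N)..real (Suc N)}"
  have "continuous_on ?I (\<lambda>\<alpha>. \<alpha> powr q
      * (\<alpha> powr ((\<gamma> - 1) * (real k + 1) - r) * exp (- ((\<gamma> - 1) * \<alpha> powr \<gamma>))))"
    by (intro continuous_on_mult continuous_on_powr_exp continuous_on_powr continuous_on_id
        continuous_on_const)
       (auto dest: less_le_trans[of 0 "1 / real (Suc N)", rotated] simp del: of_nat_Suc)
  then have "set_integrable lborel ?I
      (\<lambda>\<alpha>. \<alpha> powr q * (\<alpha> powr ((\<gamma> - 1) * (real k + 1) - r) * exp (- ((\<gamma> - 1) * \<alpha> powr \<gamma>))))"
    by (intro borel_integrable_atLeastAtMost')
  then show ?thesis by (simp add: set_integrable_def packet_profile_def mult.left_commute del: of_nat_Suc)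
qed

lemma half_norm2_wave_packet:
  "half_norm2 r (wave_packet \<gamma> k r N n) = ennreal (2 * real n) * truncated_analysis_weight \<gamma> k r N"
proof -
  have "half_norm2 r (wave_packet \<gamma> k r N n)
      = (\<integral>\<^sup>+\<alpha>. \<integral>\<^sup>+s. ennreal (indicator {0<..} \<alpha> * \<alpha> powr r * (packet_profile \<gamma> k r N \<alpha>)\<^sup>2)
      * indicator {- real n..real n} s \<partial>lborel \<partial>lborel)"
    unfolding half_norm2_def
    by (intro nn_integral_cong) (auto simp: wave_packet_def norm_mult indicator_def power_mult_distrib)
  also have "\<dots> = (\<integral>\<^sup>+\<alpha>. ennreal (2 * real n)
      * ennreal (indicator {0<..} \<alpha> * \<alpha> powr r * (packet_profile \<gamma> k r N \<alpha>)\<^sup>2) \<partial>lborel)"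
  proof -
    have em: "emeasure lborel {- real n..real n} = ennreal (2 * real n)" by simp
    show ?thesis
      by (subst nn_integral_cmult_indicator) (simp_all only: em mult.commute, simp)
  qed
  also have "\<dots> = ennreal (2 * real n) * truncated_analysis_weight \<gamma> k r N"
    unfolding truncated_analysis_weight_def packet_norm_density by (rule nn_integral_cmult) measurable
  finally show ?thesis .
qed

lemma reduced_leray_wave_packet:
  fixes t \<beta> :: real
  assumes \<gamma>: "\<gamma> > 1" and \<beta>: "\<beta> > 0"
  shows "reduced_leray \<gamma> k (wave_packet \<gamma> k r N n) (t, \<beta>)
      = of_real (leray_const \<gamma> k * \<gamma> ^ k * \<beta> ^ k) * cis t *
     (LBINT \<alpha>. of_real (\<alpha> powr ((\<gamma> - 1) * (real k + 1)) * packet_profile \<gamma> k r N \<alpha>) *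
        (LBINT s. indicator {- real n..real n} (t + s) *\<^sub>R
            (cis s / Complex ((\<gamma> - 1) * \<alpha> powr \<gamma> + \<beta> powr \<gamma>) s ^ (k + 2))))"
proof -
  let ?K = "\<lambda>\<alpha> s. cis s / Complex ((\<gamma> - 1) * \<alpha> powr \<gamma> + \<beta> powr \<gamma>) s ^ (k + 2)"
  let ?p = "\<lambda>\<alpha>. \<alpha> powr ((\<gamma> - 1) * (real k + 1)) * packet_profile \<gamma> k r N \<alpha>"
  have "indicator {0<..} \<alpha> *\<^sub>R (LBINT s. leray_kernel \<gamma> k (t, \<beta>) (s, \<alpha>) * wave_packet \<gamma> k r N n (s, \<alpha>))
      = of_real (\<gamma> ^ k * \<beta> ^ k) * cis t
          * (of_real (?p \<alpha>) * (LBINT s. indicator {- real n..real n} (t + s) *\<^sub>R ?K \<alpha> s))" for \<alpha>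
  proof (cases "packet_profile \<gamma> k r N \<alpha> = 0")
    case True
    then show ?thesis by (simp add: wave_packet_def)
  next
    case False
    then have \<alpha>: "\<alpha> > 0" by (rule packet_support)
    have "(LBINT s. leray_kernel \<gamma> k (t, \<beta>) (s, \<alpha>) * wave_packet \<gamma> k r N n (s, \<alpha>))
      = \<bar>1\<bar> *\<^sub>R (LBINT s. leray_kernel \<gamma> k (t, \<beta>) (t + 1 * s, \<alpha>) * wave_packet \<gamma> k r N n (t + 1 * s, \<alpha>))"
      by (rule lborel_integral_real_affine) simp
    also have "\<dots> = (LBINT s. (of_real (\<gamma> ^ k * \<beta> ^ k) * cis t * of_real (?p \<alpha>))
        * (indicator {- real n..real n} (t + s) *\<^sub>R ?K \<alpha> s))"
      unfolding abs_one scaleR_one mult_1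
      by (intro Bochner_Integration.integral_cong refl)
         (simp add: leray_kernel_eq[OF \<gamma> \<alpha> \<beta>] wave_packet_def cis_mult[symmetric] scaleR_conv_of_real)
    also have "\<dots> = (of_real (\<gamma> ^ k * \<beta> ^ k) * cis t * of_real (?p \<alpha>))
        * (LBINT s. (indicator {- real n..real n} (t + s) *\<^sub>R ?K \<alpha> s))"
      by (rule integral_mult_right_zero)
    finally show ?thesis using \<alpha> by (simp add: mult.assoc)
  qed
  then have "reduced_leray \<gamma> k (wave_packet \<gamma> k r N n) (t, \<beta>) = of_real (leray_const \<gamma> k) *
     (LBINT \<alpha>. of_real (\<gamma> ^ k * \<beta> ^ k) * cis t
         * (of_real (?p \<alpha>) * (LBINT s. indicator {- real n..real n} (t + s) *\<^sub>R ?K \<alpha> s)))"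
    by (simp only: reduced_leray_def set_lebesgue_integral_def)
  then show ?thesis unfolding integral_mult_right_zero by (simp add: mult.assoc)
qed

text \<open>In the scaled variable \<open>x\<close>, for \<open>\<bar>x\<bar> < 1\<close>, the cut-off at \<open>\<bar>s\<bar> \<le> n\<close> recedes to infinity as seen
  from \<open>t = n * x\<close>.  The integral over \<open>s\<close> therefore tends to the Fourier
  integral of \<open>fourier_inverse_power\<close>.\<close>

lemma reduced_leray_wave_packet_limit:
  fixes x \<beta> :: real
  assumes \<gamma>: "\<gamma> > 1" and \<beta>: "\<beta> > 0" and x: "\<bar>x\<bar> < 1"
  shows "(\<lambda>n. cmod (reduced_leray \<gamma> k (wave_packet \<gamma> k r N n) (real n * x, \<beta>))) \<longlonglongrightarrow>
     \<gamma> ^ (k + 2) / fact k * \<beta> ^ k * exp (- (\<beta> powr \<gamma>)) * enn2real (truncated_analysis_weight \<gamma> k r N)"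
proof -
  let ?a = "\<lambda>\<alpha>. (\<gamma> - 1) * \<alpha> powr \<gamma> + \<beta> powr \<gamma>"
  let ?K = "\<lambda>\<alpha> s. cis s / Complex (?a \<alpha>) s ^ (k + 2)"
  let ?J = "\<lambda>n \<alpha> s. indicator {- real n..real n} (real n * x + s) *\<^sub>R ?K \<alpha> s"
  let ?\<Psi> = "enn2real (truncated_analysis_weight \<gamma> k r N)"
  let ?c = "leray_const \<gamma> k * \<gamma> ^ k * \<beta> ^ k"
  let ?p = "\<lambda>\<alpha>. \<alpha> powr ((\<gamma> - 1) * (real k + 1)) * packet_profile \<gamma> k r N \<alpha>"
  define b where "b = \<beta> powr \<gamma>"
  have b: "b > 0" using \<beta> by (simp add: b_def)
  have ab: "b \<le> ?a \<alpha>" for \<alpha> using \<gamma> by (simp add: b_def)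
  then have a0: "?a \<alpha> > 0" for \<alpha> using b less_le_trans by blast
  define w where "w s = 1 / b ^ k * (1 / (b\<^sup>2 + s\<^sup>2))" for s
  have iw: "integrable lborel w" unfolding w_def[abs_def]
    by (intro integrable_mult_right integrable_inverse_square_plus b)
  have Kw: "cmod (?K \<alpha> s) \<le> w s" for \<alpha> s
  proof -
    have p: "0 < b ^ k * (b\<^sup>2 + s\<^sup>2)" using b by (intro mult_pos_pos add_pos_nonneg) auto
    have "b ^ k * (b\<^sup>2 + s\<^sup>2) \<le> (?a \<alpha>) ^ k * (b\<^sup>2 + s\<^sup>2)"
      using ab b by (intro mult_right_mono power_mono) auto
    also have "\<dots> \<le> cmod (Complex (?a \<alpha>) s) ^ (k + 2)"
      by (rule norm_power_Complex_ge[OF b ab])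
    finally have "1 / cmod (Complex (?a \<alpha>) s) ^ (k + 2) \<le> 1 / (b ^ k * (b\<^sup>2 + s\<^sup>2))"
      using p by (intro divide_left_mono) auto
    then show ?thesis by (simp add: w_def norm_divide norm_mult norm_power)
  qed
  define J where "J n \<alpha> = (LBINT s. ?J n \<alpha> s)" for n \<alpha>
  have Jlim: "(\<lambda>n. J n \<alpha>) \<longlonglongrightarrow> of_real (2 * pi * exp (- ?a \<alpha>) / fact (k + 1))" for \<alpha>
    unfolding fourier_inverse_power_integral[OF a0, symmetric] J_def
  proof (rule integral_dominated_convergence[where w=w])
    show "AE s in lborel. (\<lambda>n. ?J n \<alpha> s) \<longlonglongrightarrow> ?K \<alpha> s"
    proof (rule AE_I2)
      fix s :: real
      obtain n0 :: nat where n0: "\<bar>s\<bar> / (1 - \<bar>x\<bar>) < real n0" using reals_Archimedean2 by blast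
      have "indicator {- real n..real n} (real n * x + s) = (1 :: real)" if "n \<ge> n0" for n
      proof -
        have "\<bar>s\<bar> / (1 - \<bar>x\<bar>) \<le> real n" using n0 that by linarith
        then have "\<bar>s\<bar> \<le> real n * (1 - \<bar>x\<bar>)" using x by (simp add: divide_le_eq)
        moreover have "\<bar>real n * x + s\<bar> \<le> real n * \<bar>x\<bar> + \<bar>s\<bar>"
          using abs_triangle_ineq[of "real n * x" s] by (simp add: abs_mult)
        ultimately have "\<bar>real n * x + s\<bar> \<le> real n" by (simp add: algebra_simps)
        then show ?thesis by (auto simp: indicator_def)
      qed
      then have "\<forall>\<^sub>F n in sequentially. ?K \<alpha> s = ?J n \<alpha> s"
        by (auto simp: eventually_sequentially intro!: exI[of _ n0])
      then show "(\<lambda>n. ?J n \<alpha> s) \<longlonglongrightarrow> ?K \<alpha> s"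
        by (rule Lim_transform_eventually[OF tendsto_const])
    qed
    show "AE s in lborel. norm (?J n \<alpha> s) \<le> w s" for n
      using Kw order_trans[OF norm_ge_zero Kw] by (auto simp: indicator_def)
  qed (use iw in measurable)
  have Jb: "cmod (J n \<alpha>) \<le> integral\<^sup>L lborel w" for n \<alpha>
  proof -
    have b: "norm (?J n \<alpha> s) \<le> w s" for s
      using Kw[of s \<alpha>] order_trans[OF norm_ge_zero Kw[of s \<alpha>]] by (simp add: indicator_def)
    have "integrable lborel (\<lambda>s. ?J n \<alpha> s)"
    proof (rule Bochner_Integration.integrable_bound[OF iw])
      show "AE s in lborel. norm (?J n \<alpha> s) \<le> norm (w s)"
        by (rule AE_I2, rule order_trans[OF b]) simp
    qed measurable
    then show ?thesis unfolding J_def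
      by (rule Bochner_Integration.integral_norm_bound_integral[OF _ iw]) (rule b)
  qed
  have Jm[measurable]: "J n \<in> borel_measurable borel" for n
    unfolding J_def by measurable
  have ip: "integrable lborel ?p"
    by (rule packet_profile_integrable)
  have p0: "0 \<le> ?p \<alpha>" for \<alpha> by (simp add: packet_profile_nonneg)
  have lim: "(\<lambda>n. LBINT \<alpha>. of_real (?p \<alpha>) * J n \<alpha>)
      \<longlonglongrightarrow> (LBINT \<alpha>. of_real (?p \<alpha>) * of_real (2 * pi * exp (- ?a \<alpha>) / fact (k + 1)))"
  proof (rule integral_dominated_convergence[where w="\<lambda>\<alpha>. ?p \<alpha> * integral\<^sup>L lborel w"])
    show "AE \<alpha> in lborel. (\<lambda>n. of_real (?p \<alpha>) * J n \<alpha>)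
        \<longlonglongrightarrow> of_real (?p \<alpha>) * of_real (2 * pi * exp (- ?a \<alpha>) / fact (k + 1))"
      by (intro AE_I2 tendsto_mult tendsto_const Jlim)
    show "AE \<alpha> in lborel. norm (of_real (?p \<alpha>) * J n \<alpha>) \<le> ?p \<alpha> * integral\<^sup>L lborel w" for n
    proof (rule AE_I2)
      fix \<alpha> :: real
      have "norm (of_real (?p \<alpha>) * J n \<alpha>) = ?p \<alpha> * cmod (J n \<alpha>)"
        using p0[of \<alpha>] by (simp only: norm_mult norm_of_real abs_of_nonneg)
      also have "\<dots> \<le> ?p \<alpha> * integral\<^sup>L lborel w" by (intro mult_left_mono Jb p0)
      finally show "norm (of_real (?p \<alpha>) * J n \<alpha>) \<le> ?p \<alpha> * integral\<^sup>L lborel w" .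
    qed
  qed (use ip in \<open>auto intro!: integrable_mult_left simp del: of_real_mult\<close>)
  have "(LBINT \<alpha>. of_real (?p \<alpha>) * of_real (2 * pi * exp (- ?a \<alpha>) / fact (k + 1)))
      = (LBINT \<alpha>. complex_of_real (2 * pi * exp (- b) / fact (k + 1)
          * (\<alpha> powr ((\<gamma> - 1) * (real k + 1)) * exp (- ((\<gamma> - 1) * \<alpha> powr \<gamma>)) * packet_profile \<gamma> k r N \<alpha>)))"
    by (intro Bochner_Integration.integral_cong refl)
       (simp add: b_def exp_diff exp_minus divide_inverse del: fact_Suc)
  also have "\<dots> = of_real (2 * pi * exp (- b) / fact (k + 1)
      * (LBINT \<alpha>. \<alpha> powr ((\<gamma> - 1) * (real k + 1)) * exp (- ((\<gamma> - 1) * \<alpha> powr \<gamma>))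
      * packet_profile \<gamma> k r N \<alpha>))"
    unfolding integral_complex_of_real integral_mult_right_zero ..
  also have "(LBINT \<alpha>. \<alpha> powr ((\<gamma> - 1) * (real k + 1)) * exp (- ((\<gamma> - 1) * \<alpha> powr \<gamma>))
      * packet_profile \<gamma> k r N \<alpha>) = ?\<Psi>"
    unfolding packet_analysis_density truncated_analysis_weight_def
    by (rule integral_eq_nn_integral) auto
  finally have val: "(LBINT \<alpha>. of_real (?p \<alpha>) * of_real (2 * pi * exp (- ?a \<alpha>) / fact (k + 1))) =
     complex_of_real (2 * pi * exp (- b) / fact (k + 1) * ?\<Psi>)" .
  have c0: "0 \<le> ?c"
    using leray_const_pos[OF \<gamma>, of k] \<gamma> \<beta> by (simp add: less_imp_le)
  have "(\<lambda>n. ?c * cmod (LBINT \<alpha>. of_real (?p \<alpha>) * J n \<alpha>)) \<longlonglongrightarrow>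
      ?c * cmod (complex_of_real (2 * pi * exp (- b) / fact (k + 1) * ?\<Psi>))"
    using lim unfolding val by (intro tendsto_mult tendsto_const tendsto_norm)
  also have "(\<lambda>n. ?c * cmod (LBINT \<alpha>. of_real (?p \<alpha>) * J n \<alpha>))
      = (\<lambda>n. cmod (reduced_leray \<gamma> k (wave_packet \<gamma> k r N n) (real n * x, \<beta>)))"
    unfolding reduced_leray_wave_packet[OF \<gamma> \<beta>] J_def norm_mult norm_cis norm_of_real using c0
    by (simp only: abs_of_nonneg mult_1_right)
  also have "cmod (complex_of_real (2 * pi * exp (- b) / fact (k + 1) * ?\<Psi>))
      = 2 * pi * exp (- b) / fact (k + 1) * ?\<Psi>"
    unfolding norm_of_real by (rule abs_of_nonneg) simp
  also have "?c * (2 * pi * exp (- b) / fact (k + 1) * ?\<Psi>)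
      = (2 * pi * leray_const \<gamma> k * \<gamma> ^ k / fact (k + 1)) * \<beta> ^ k * exp (- b) * ?\<Psi>"
    by (simp only: mult_ac times_divide_eq_left times_divide_eq_right)
  finally show ?thesis unfolding two_pi_leray_const b_def .
qed

text \<open>The squared norm of the packet grows linearly in \<open>n\<close>.  After the hypothesis is divided by \<open>n\<close>,
  Fatou's lemma over \<open>\<bar>x\<bar> < 1\<close> and \<open>\<beta> > 0\<close> bounds the integral of the squared limit from
  \<open>reduced_leray_wave_packet_limit\<close>; the integral over \<open>\<beta>\<close> is the full synthesis weight,
  whether finite or not.\<close>

lemma reduced_leray_lower_bound:
  fixes D :: real
  assumes \<gamma>: "\<gamma> > 1"
    and D: "\<And>N n. half_norm2 r (reduced_leray \<gamma> k (wave_packet \<gamma> k r N n))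
        \<le> ennreal (D\<^sup>2) * half_norm2 r (wave_packet \<gamma> k r N n)"
  shows "ennreal ((\<gamma> ^ (k + 2) / fact k)\<^sup>2)
      * (synthesis_weight \<gamma> k r 1 * truncated_analysis_weight \<gamma> k r N) \<le> ennreal (D\<^sup>2)"
\<comment> \<open>The truncated weight vanishes for \<open>N = 0\<close>, where the interval is a point; it cannot be cancelled then.\<close>
proof (cases "truncated_analysis_weight \<gamma> k r N = 0")
  case False
  define \<Psi> where "\<Psi> = enn2real (truncated_analysis_weight \<gamma> k r N)"
  have T: "truncated_analysis_weight \<gamma> k r N = ennreal \<Psi>"
    using truncated_analysis_weight_finite[of \<gamma> k r N] by (simp add: \<Psi>_def)
  have \<Psi>: "\<Psi> > 0" using False T by (metis ennreal_0 ennreal_eq_0_iff not_le)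
  define c where "c = \<gamma> ^ (k + 2) / fact k"
  let ?c = "ennreal ((c * \<Psi>)\<^sup>2)"
  let ?L = "\<lambda>n. reduced_leray \<gamma> k (wave_packet \<gamma> k r N n)"
  let ?d = "\<lambda>\<beta>. indicator {0<..} \<beta> * \<beta> powr r"
  let ?f = "\<lambda>n \<beta> x. ennreal (?d \<beta> * (cmod (?L n (real n * x, \<beta>)))\<^sup>2) * indicator {-1<..<1} x"
  let ?g = "\<lambda>\<beta>. ennreal (indicator {0<..} \<beta> * (\<beta> powr (2 * real k + r) * exp (- (2 * 1 * \<beta> powr \<gamma>))))"
  have lim: "?c * ?g \<beta> * indicator {-1<..<1} x = liminf (\<lambda>n. ?f n \<beta> x)" for \<beta> x
  proof (cases "\<beta> > 0 \<and> \<bar>x\<bar> < 1")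
    case True
    then have \<beta>: "\<beta> > 0" and x: "\<bar>x\<bar> < 1" by auto
    have "(\<lambda>n. \<beta> powr r * (cmod (?L n (real n * x, \<beta>)))\<^sup>2)
        \<longlonglongrightarrow> \<beta> powr r * (c * \<beta> ^ k * exp (- (\<beta> powr \<gamma>)) * \<Psi>)\<^sup>2"
      unfolding c_def \<Psi>_def by (intro tendsto_mult tendsto_const tendsto_power
          reduced_leray_wave_packet_limit \<gamma> \<beta> x)
    also have "\<beta> powr r * (c * \<beta> ^ k * exp (- (\<beta> powr \<gamma>)) * \<Psi>)\<^sup>2
        = (c * \<Psi>)\<^sup>2 * ((\<beta> powr real k * \<beta> powr real k * \<beta> powr r) * (exp (- (\<beta> powr \<gamma>)))\<^sup>2)"
      using \<beta> by (simp add: powr_realpow power2_eq_square)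
    also have "\<dots> = (c * \<Psi>)\<^sup>2 * (\<beta> powr (2 * real k + r) * exp (- (2 * 1 * \<beta> powr \<gamma>)))"
      by (simp add: powr_add[symmetric] power2_eq_square exp_add[symmetric])
    finally have "(\<lambda>n. ennreal (\<beta> powr r * (cmod (?L n (real n * x, \<beta>)))\<^sup>2))
        \<longlonglongrightarrow> ennreal ((c * \<Psi>)\<^sup>2 * (\<beta> powr (2 * real k + r) * exp (- (2 * 1 * \<beta> powr \<gamma>))))"
      by (rule tendsto_ennrealI)
    then have "(\<lambda>n. ?f n \<beta> x) \<longlonglongrightarrow> ?c * ?g \<beta> * indicator {-1<..<1} x"
      using \<beta> x by (simp add: ennreal_mult' abs_less_iff indicator_def)
    then show ?thesis by (intro lim_imp_Liminf[symmetric]) auto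
  qed (auto simp: indicator_def Liminf_const)
  have scal: "ennreal (real n) * (\<integral>\<^sup>+x. ?f n \<beta> x \<partial>lborel)
      \<le> (\<integral>\<^sup>+t. ennreal (?d \<beta> * (cmod (?L n (t, \<beta>)))\<^sup>2) \<partial>lborel)" for n \<beta>
  proof (cases "n = 0")
    case False
    have "(\<integral>\<^sup>+t. ennreal (?d \<beta> * (cmod (?L n (t, \<beta>)))\<^sup>2) \<partial>lborel)
        = ennreal \<bar>real n\<bar> * (\<integral>\<^sup>+x. ennreal (?d \<beta> * (cmod (?L n (0 + real n * x, \<beta>)))\<^sup>2) \<partial>lborel)"
      by (rule nn_integral_real_affine) (measurable, use False in simp)
    then have eq: "(\<integral>\<^sup>+t. ennreal (?d \<beta> * (cmod (?L n (t, \<beta>)))\<^sup>2) \<partial>lborel)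
        = ennreal (real n) * (\<integral>\<^sup>+x. ennreal (?d \<beta> * (cmod (?L n (real n * x, \<beta>)))\<^sup>2) \<partial>lborel)"
      by simp
    have "(\<integral>\<^sup>+x. ?f n \<beta> x \<partial>lborel) \<le> (\<integral>\<^sup>+x. ennreal (?d \<beta> * (cmod (?L n (real n * x, \<beta>)))\<^sup>2) \<partial>lborel)"
      by (intro nn_integral_mono mult_left_le) (simp_all add: indicator_def)
    then show ?thesis unfolding eq by (rule mult_left_mono) simp
  qed simp
  have bound: "(\<integral>\<^sup>+\<beta>. \<integral>\<^sup>+x. ?f n \<beta> x \<partial>lborel \<partial>lborel) \<le> ennreal (2 * D\<^sup>2 * \<Psi>)" if n: "n > 0" for n
  proof -
    have "ennreal (real n) * (\<integral>\<^sup>+\<beta>. \<integral>\<^sup>+x. ?f n \<beta> x \<partial>lborel \<partial>lborel)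
        = (\<integral>\<^sup>+\<beta>. ennreal (real n) * (\<integral>\<^sup>+x. ?f n \<beta> x \<partial>lborel) \<partial>lborel)"
      by (rule nn_integral_cmult[symmetric]) measurable
    also have "\<dots> \<le> half_norm2 r (?L n)"
      unfolding half_norm2_def by (intro nn_integral_mono scal)
    also have "\<dots> \<le> ennreal (D\<^sup>2) * (ennreal (2 * real n) * ennreal \<Psi>)"
      using D[of N n] by (simp only: half_norm2_wave_packet T)
    also have "\<dots> = ennreal (real n) * ennreal (2 * D\<^sup>2 * \<Psi>)"
      using \<Psi> by (simp add: ennreal_mult'[symmetric] ennreal_mult''[symmetric] mult_ac)
    finally show ?thesis using n
      by (subst (asm) ennreal_mult_le_mult_iff) auto
  qed
  have "?c * synthesis_weight \<gamma> k r 1 * 2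
      = (\<integral>\<^sup>+\<beta>. \<integral>\<^sup>+x. ?c * ?g \<beta> * indicator {-1<..<1::real} x \<partial>lborel \<partial>lborel)"
  proof -
    have e: "(\<integral>\<^sup>+x. ?c * ?g \<beta> * indicator {-1<..<1::real} x \<partial>lborel) = ?c * ?g \<beta> * 2" for \<beta>
      by (subst nn_integral_cmult_indicator) simp_all
    have o1: "(\<integral>\<^sup>+\<beta>. ?c * ?g \<beta> * 2 \<partial>lborel) = (\<integral>\<^sup>+\<beta>. ?c * ?g \<beta> \<partial>lborel) * 2"
      by (rule nn_integral_multc) measurable
    have o2: "(\<integral>\<^sup>+\<beta>. ?c * ?g \<beta> \<partial>lborel) = ?c * (\<integral>\<^sup>+\<beta>. ?g \<beta> \<partial>lborel)"
      by (rule nn_integral_cmult) measurable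
    show ?thesis unfolding e o1 o2 synthesis_weight_def ..
  qed
  also have "\<dots> = (\<integral>\<^sup>+\<beta>. \<integral>\<^sup>+x. liminf (\<lambda>n. ?f n \<beta> x) \<partial>lborel \<partial>lborel)"
    by (simp only: lim)
  also have "\<dots> \<le> (\<integral>\<^sup>+\<beta>. liminf (\<lambda>n. \<integral>\<^sup>+x. ?f n \<beta> x \<partial>lborel) \<partial>lborel)"
    by (intro nn_integral_mono nn_integral_liminf) measurable
  also have "\<dots> \<le> liminf (\<lambda>n. \<integral>\<^sup>+\<beta>. \<integral>\<^sup>+x. ?f n \<beta> x \<partial>lborel \<partial>lborel)"
    by (intro nn_integral_liminf) measurable
  also have "\<dots> \<le> liminf (\<lambda>n::nat. ennreal (2 * D\<^sup>2 * \<Psi>))"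
    by (intro Liminf_mono eventually_mono[OF eventually_gt_at_top[of 0]] bound)
  also have "\<dots> = ennreal (2 * D\<^sup>2 * \<Psi>)" by (simp add: Liminf_const)
  finally have "?c * synthesis_weight \<gamma> k r 1 * 2 \<le> ennreal (2 * D\<^sup>2 * \<Psi>)" .
  moreover have "?c * synthesis_weight \<gamma> k r 1 * 2
      = ennreal (2 * \<Psi>) * (ennreal (c\<^sup>2) * (synthesis_weight \<gamma> k r 1 * ennreal \<Psi>))"
  proof -
    have eq: "?c * 2 = ennreal (2 * \<Psi>) * ennreal (c\<^sup>2) * ennreal \<Psi>"
      using \<Psi> by (subst ennreal_numeral[symmetric])
          (simp add: ennreal_mult'[symmetric] ennreal_mult''[symmetric] power2_eq_square mult_ac del:
          ennreal_numeral)
    have "?c * synthesis_weight \<gamma> k r 1 * 2 = (?c * 2) * synthesis_weight \<gamma> k r 1"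
      by (simp only: mult_ac)
    then show ?thesis unfolding eq by (simp only: mult_ac)
  qed
  moreover have "ennreal (2 * D\<^sup>2 * \<Psi>) = ennreal (2 * \<Psi>) * ennreal (D\<^sup>2)"
    using \<Psi> by (simp add: ennreal_mult'[symmetric] mult_ac)
  ultimately have "ennreal (2 * \<Psi>) * (ennreal (c\<^sup>2) * (synthesis_weight \<gamma> k r 1 * ennreal \<Psi>))
      \<le> ennreal (2 * \<Psi>) * ennreal (D\<^sup>2)"
    by simp
  then show ?thesis unfolding T c_def[symmetric]
    using \<Psi> by (subst (asm) ennreal_mult_le_mult_iff) auto
qed simp

lemma analysis_weight_eq_SUP: "analysis_weight \<gamma> k r 1 = (SUP N. truncated_analysis_weight \<gamma> k r N)"
proof -
  let ?F = "\<lambda>\<alpha>. \<alpha> powr (2 * (\<gamma> - 1) * (real k + 1) - r) * exp (- (2 * (\<gamma> - 1) * \<alpha> powr \<gamma>))"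
  let ?I = "\<lambda>N. {1 / real (Suc N)..real (Suc N)}"
  have mono: "?I M \<subseteq> ?I N" if "M \<le> N" for M N
    using that frac_le[of 1 1 "real (Suc M)" "real (Suc N)"] by auto
  have un: "(\<Union>N. ?I N) = {0<..}"
  proof (intro equalityI subsetI)
    fix \<alpha> :: real assume "\<alpha> \<in> {0<..}"
    then have \<alpha>: "\<alpha> > 0" by simp
    obtain N :: nat where N: "max \<alpha> (1 / \<alpha>) < real N" using reals_Archimedean2 by blast
    then have "1 / \<alpha> \<le> real (Suc N)" "\<alpha> \<le> real (Suc N)" by auto
    then have "\<alpha> \<in> ?I N" using \<alpha> by (simp add: divide_le_eq mult.commute)
    then show "\<alpha> \<in> (\<Union>N. ?I N)" by blast
  qed (auto intro: less_le_trans[of 0 "1 / real (Suc _)"])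
  have "analysis_weight \<gamma> k r 1 = (\<integral>\<^sup>+\<alpha>. (SUP N. ennreal (?F \<alpha>) * indicator (?I N) \<alpha>) \<partial>lborel)"
    unfolding analysis_weight_def
  proof (intro nn_integral_cong)
    fix \<alpha> :: real
    show "ennreal (indicator {0<..} \<alpha>
        * (\<alpha> powr (2 * (\<gamma> - 1) * (real k + 1) - r) * exp (- (2 * 1 * (\<gamma> - 1) * \<alpha> powr \<gamma>))))
        = (SUP N. ennreal (?F \<alpha>) * indicator (?I N) \<alpha>)"
    proof (cases "\<alpha> > 0")
      case True
      then obtain N where "\<alpha> \<in> ?I N" using un by blast
      then have "(SUP N. ennreal (?F \<alpha>) * indicator (?I N) \<alpha>) = ennreal (?F \<alpha>)"
        by (intro antisym SUP_least SUP_upper2[of N]) (auto simp: indicator_def)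
      then show ?thesis using True by simp
    next
      case False
      then have "\<alpha> \<notin> ?I N" for N using un by blast
      then show ?thesis using False by (simp del: of_nat_Suc atLeastAtMost_iff)
    qed
  qed
  also have "\<dots> = (SUP N. \<integral>\<^sup>+\<alpha>. ennreal (?F \<alpha>) * indicator (?I N) \<alpha> \<partial>lborel)"
  proof (rule nn_integral_monotone_convergence_SUP)
    show "incseq (\<lambda>N \<alpha>. ennreal (?F \<alpha>) * indicator (?I N) \<alpha>)"
    proof (intro incseq_SucI le_funI mult_left_mono)
      show "indicator (?I n) x \<le> (indicator (?I (Suc n)) x :: ennreal)" for n x
        using mono[of n "Suc n"] by (auto simp: indicator_def simp del: of_nat_Suc)
    qed simp
  qed measurable
  also have "(\<lambda>N. \<integral>\<^sup>+\<alpha>. ennreal (?F \<alpha>) * indicator (?I N) \<alpha> \<partial>lborel) = truncated_analysis_weight \<gamma> k r"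
    unfolding truncated_analysis_weight_def by (intro ext nn_integral_cong) (simp add: indicator_def)
  finally show ?thesis .
qed

lemma synthesis_weight_pos: "synthesis_weight \<gamma> k r 1 > 0"
  and analysis_weight_pos: "analysis_weight \<gamma> k r 1 > 0"
proof -
  have pos: "(\<integral>\<^sup>+\<alpha>. ennreal (indicator {0<..} \<alpha> * f \<alpha>) \<partial>lborel) > 0"
    if f: "\<And>\<alpha>. \<alpha> > 0 \<Longrightarrow> f \<alpha> > 0" and [measurable]: "f \<in> borel_measurable borel" for f :: "real \<Rightarrow> real"
  proof (rule ccontr)
    assume "\<not> ?thesis"
    then have "(\<integral>\<^sup>+\<alpha>. ennreal (indicator {0<..} \<alpha> * f \<alpha>) \<partial>lborel) = 0" by simp
    then have "emeasure lborel {\<alpha> \<in> space lborel. ennreal (indicator {0<..} \<alpha> * f \<alpha>) \<noteq> 0} = 0"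
      by (subst (asm) nn_integral_0_iff) auto
    moreover have "emeasure lborel {0<..<1::real}
        \<le> emeasure lborel {\<alpha> \<in> space lborel. ennreal (indicator {0<..} \<alpha> * f \<alpha>) \<noteq> 0}"
    proof (rule emeasure_mono)
      show "{0<..<1} \<subseteq> {\<alpha> \<in> space lborel. ennreal (indicator {0<..} \<alpha> * f \<alpha>) \<noteq> 0}"
      proof
        fix \<alpha> :: real assume "\<alpha> \<in> {0<..<1}"
        then show "\<alpha> \<in> {\<alpha> \<in> space lborel. ennreal (indicator {0<..} \<alpha> * f \<alpha>) \<noteq> 0}"
          using f[of \<alpha>] by (simp add: ennreal_eq_0_iff)
      qed
    qed measurable
    ultimately have "emeasure lborel {0<..<1::real} = 0" by simp
    then show False by simp
  qed
  show "synthesis_weight \<gamma> k r 1 > 0" "analysis_weight \<gamma> k r 1 > 0"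
    unfolding synthesis_weight_def analysis_weight_def by (auto intro!: pos)
qed

text \<open>Both conclusions come from the same inequality between the product of the weights and \<open>D\<^sup>2\<close>: off
  the interval the product is infinite, since neither weight vanishes, and on it the product is the
  constant.\<close>

lemma leray_lower_bound:
  fixes D :: real
  assumes \<gamma>: "\<gamma> > 1"
    and D: "\<And>N n. half_norm2 r (reduced_leray \<gamma> k (wave_packet \<gamma> k r N n))
        \<le> ennreal (D\<^sup>2) * half_norm2 r (wave_packet \<gamma> k r N n)"
  shows "r \<in> r_interval \<gamma> k" and "C_const \<gamma> r k \<le> D\<^sup>2"
proof -
  let ?c = "ennreal ((\<gamma> ^ (k + 2) / fact k)\<^sup>2)"
  have "?c * (synthesis_weight \<gamma> k r 1 * analysis_weight \<gamma> k r 1)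
     = (SUP N. ?c * (synthesis_weight \<gamma> k r 1 * truncated_analysis_weight \<gamma> k r N))"
    unfolding analysis_weight_eq_SUP by (simp only: SUP_mult_left_ennreal)
  also have "\<dots> \<le> ennreal (D\<^sup>2)"
    by (intro SUP_least reduced_leray_lower_bound \<gamma> D)
  finally have le: "?c * (synthesis_weight \<gamma> k r 1 * analysis_weight \<gamma> k r 1) \<le> ennreal (D\<^sup>2)" .
  show r: "r \<in> r_interval \<gamma> k"
  proof (rule ccontr)
    assume "r \<notin> r_interval \<gamma> k"
    from weights_infinite[OF \<gamma> this] have "synthesis_weight \<gamma> k r 1 * analysis_weight \<gamma> k r 1 = \<infinity>"
      using synthesis_weight_pos[of \<gamma> k r] analysis_weight_pos[of \<gamma> k r]
      by (auto simp: ennreal_mult_eq_top_iff)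
    moreover have "?c \<noteq> 0" using \<gamma> by simp
    ultimately have "?c * (synthesis_weight \<gamma> k r 1 * analysis_weight \<gamma> k r 1) = \<infinity>"
      by (simp add: ennreal_mult_eq_top_iff)
    with le show False by (simp add: top_unique)
  qed
  show "C_const \<gamma> r k \<le> D\<^sup>2"
    using le unfolding C_const_eq_weights(1)[OF \<gamma> r, symmetric] by (simp add: ennreal_le_iff)
qed

section \<open>The upper bound on the whole space\<close>

text \<open>Writing the inverse power as a Laplace integral over \<open>\<xi>\<close> turns the integral over \<open>\<alpha>\<close> into the
  analysis weight at \<open>\<xi> / 2\<close>, a multiple of a power of \<open>\<xi>\<close>.  What remains is a Gamma integral, convergent because
  \<open>r\<close> lies above the lower end of the interval.\<close>

lemma nn_integral_powr_over_power_finite: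
  assumes \<gamma>: "\<gamma> > 1" and r: "r \<in> r_interval \<gamma> k" and b: "b > 0"
  shows "(\<integral>\<^sup>+\<alpha>. ennreal (indicator {0<..} \<alpha>
      * (\<alpha> powr (2 * (\<gamma> - 1) * (real k + 1) - r) / ((\<gamma> - 1) * \<alpha> powr \<gamma> + b) ^ (2 * k + 2))) \<partial>lborel) < \<infinity>"
    (is "?I < _")
proof -
  define x where "x = (2 * real k + 1 + r) / \<gamma>"
  define y where "y = 2 * real k + 2 - x"
  note W = weights_eq[OF \<gamma> r, folded x_def, folded y_def]
  have pos: "x > 0" "y > 0" "Gamma y > 0" using W(1,2)[OF zero_less_one] by (auto intro: Gamma_real_pos)
  let ?q = "2 * (\<gamma> - 1) * (real k + 1) - r"
  let ?a = "\<lambda>\<alpha>. (\<gamma> - 1) * \<alpha> powr \<gamma> + b"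
  let ?u = "\<lambda>\<alpha> \<xi>. ennreal (indicator {0<..} \<alpha> * (\<alpha> powr ?q * exp (- (2 * (\<xi> / 2) * (\<gamma> - 1) * \<alpha> powr \<gamma>))))"
  let ?v = "\<lambda>\<xi>. ennreal (indicator {0<..} \<xi> * (\<xi> powr real (2 * k + 1) * exp (- (\<xi> * b))))"
  have a0: "?a \<alpha> > 0" for \<alpha> using \<gamma> b by (simp add: add_nonneg_pos)
  have lap: "ennreal (Gamma (real (2 * k + 1) + 1))
      * ennreal (indicator {0<..} \<alpha> * (\<alpha> powr ?q / ?a \<alpha> ^ (2 * k + 2)))
      = (\<integral>\<^sup>+\<xi>. ?u \<alpha> \<xi> * ?v \<xi> \<partial>lborel)" for \<alpha>
  proof (cases "\<alpha> > 0")
    case True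
    have "(\<integral>\<^sup>+\<xi>. ?u \<alpha> \<xi> * ?v \<xi> \<partial>lborel)
        = (\<integral>\<^sup>+\<xi>. ennreal (\<alpha> powr ?q) * ennreal
        (indicator {0<..} \<xi> * (\<xi> powr real (2 * k + 1) * exp (- (?a \<alpha> * \<xi> powr 1)))) \<partial>lborel)"
      using True by (intro nn_integral_cong)
          (simp add: indicator_def ennreal_mult'[symmetric] exp_add[symmetric] algebra_simps)
    also have "\<dots> = ennreal (\<alpha> powr ?q)
        * (\<integral>\<^sup>+\<xi>. ennreal (indicator {0<..} \<xi> * (\<xi> powr real (2 * k + 1) * exp (- (?a \<alpha> * \<xi> powr 1))))
        \<partial>lborel)"
      by (rule nn_integral_cmult) measurable
    also have "\<dots> = ennreal (\<alpha> powr ?q)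
        * ennreal (Gamma ((real (2 * k + 1) + 1) / 1) / 1 * ?a \<alpha> powr (- ((real (2 * k + 1) + 1) / 1)))"
      by (subst nn_integral_powr_exp) (use a0 in auto)
    also have "?a \<alpha> powr (- ((real (2 * k + 1) + 1) / 1)) = 1 / ?a \<alpha> ^ (2 * k + 2)"
    proof -
      have "?a \<alpha> powr real (2 * k + 2) = ?a \<alpha> ^ (2 * k + 2)" using a0 by (rule powr_realpow)
      moreover have "(real (2 * k + 1) + 1) / 1 = real (2 * k + 2)" by simp
      ultimately show ?thesis by (simp only: powr_minus_divide)
    qed
    finally show ?thesis using True a0[of \<alpha>]
      by (simp add: ennreal_mult'[symmetric] ennreal_mult''[symmetric] Gamma_real_pos less_imp_le mult_ac)
  qed simp
  have meas: "(\<lambda>(\<alpha>, \<xi>). ?u \<alpha> \<xi> * ?v \<xi>) \<in> borel_measurable plane" by measurable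
  have "ennreal (Gamma (real (2 * k + 1) + 1)) * ?I = (\<integral>\<^sup>+\<alpha>. \<integral>\<^sup>+\<xi>. ?u \<alpha> \<xi> * ?v \<xi> \<partial>lborel \<partial>lborel)"
    unfolding lap[symmetric] by (rule nn_integral_cmult[symmetric]) measurable
  also have "\<dots> = (\<integral>\<^sup>+\<xi>. \<integral>\<^sup>+\<alpha>. ?u \<alpha> \<xi> * ?v \<xi> \<partial>lborel \<partial>lborel)"
    using lborel_pair.Fubini'[OF meas] by simp
  also have "\<dots> = (\<integral>\<^sup>+\<xi>. analysis_weight \<gamma> k r (\<xi> / 2) * ?v \<xi> \<partial>lborel)"
    unfolding analysis_weight_def by (intro nn_integral_cong nn_integral_multc) measurable
  also have "\<dots> = (\<integral>\<^sup>+\<xi>. ennreal (Gamma y / \<gamma> * (\<gamma> - 1) powr (- y))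
      * ennreal (indicator {0<..} \<xi> * (\<xi> powr (x - 1) * exp (- (b * \<xi> powr 1)))) \<partial>lborel)"
  proof (intro nn_integral_cong)
    fix \<xi> :: real
    show "analysis_weight \<gamma> k r (\<xi> / 2) * ?v \<xi>
        = ennreal (Gamma y / \<gamma> * (\<gamma> - 1) powr (- y))
        * ennreal (indicator {0<..} \<xi> * (\<xi> powr (x - 1) * exp (- (b * \<xi> powr 1))))"
    proof (cases "\<xi> > 0")
      case True
      have e: "x - 1 = - y + real (2 * k + 1)" by (simp add: y_def)
      have "analysis_weight \<gamma> k r (\<xi> / 2) = ennreal (Gamma y / \<gamma> * (\<xi> powr (- y) * (\<gamma> - 1) powr (- y)))"
        using W(4)[of "\<xi> / 2"] powr_mult[of \<xi> "\<gamma> - 1" "- y"] True \<gamma> by simp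
      then show ?thesis using True \<gamma> pos unfolding e powr_add
        by (simp add: ennreal_mult'[symmetric] less_imp_le mult_ac)
    qed simp
  qed
  also have "\<dots> = ennreal (Gamma y / \<gamma> * (\<gamma> - 1) powr (- y))
      * (\<integral>\<^sup>+\<xi>. ennreal (indicator {0<..} \<xi> * (\<xi> powr (x - 1) * exp (- (b * \<xi> powr 1)))) \<partial>lborel)"
    by (rule nn_integral_cmult) measurable
  also have "\<dots> < \<infinity>"
    by (subst nn_integral_powr_exp) (use b pos in \<open>auto simp: ennreal_mult_less_top\<close>)
  finally have "ennreal (Gamma (real (2 * k + 1) + 1)) * ?I < \<infinity>" .
  moreover have "0 < Gamma (real (2 * k + 1) + 1)" by (rule Gamma_real_pos) simp
  then have "ennreal (Gamma (real (2 * k + 1) + 1)) \<noteq> 0" by (simp only: ennreal_eq_0_iff not_le)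
  ultimately show ?thesis by (auto simp: ennreal_mult_less_top)
qed

text \<open>Square integrability of the kernel against the dual weight makes the integral formula converge
  absolutely, by the Cauchy-Schwarz inequality, at every point off the axis and for every square
  integrable function.\<close>

lemma leray_kernel_L2:
  assumes \<gamma>: "\<gamma> > 1" and r: "r \<in> r_interval \<gamma> k" and \<beta>: "\<beta> > 0"
  shows "(\<integral>\<^sup>+\<alpha>. \<integral>\<^sup>+s. ennreal (indicator {0<..} \<alpha> * \<alpha> powr (- r)
      * (cmod (leray_kernel \<gamma> k (t, \<beta>) (s, \<alpha>)))\<^sup>2) \<partial>lborel \<partial>lborel) < \<infinity>"
proof -
  define b where "b = \<beta> powr \<gamma>"
  have b: "b > 0" using \<beta> by (simp add: b_def)
  let ?a = "\<lambda>\<alpha>. (\<gamma> - 1) * \<alpha> powr \<gamma> + b"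
  let ?q = "2 * (\<gamma> - 1) * (real k + 1) - r"
  have ab: "b \<le> ?a \<alpha>" for \<alpha> using \<gamma> by simp
  let ?X = "(\<gamma> ^ k * \<beta> ^ k)\<^sup>2"
  let ?Y = "\<lambda>\<alpha>. ennreal (indicator {0<..} \<alpha> * (\<alpha> powr ?q / ?a \<alpha> ^ (2 * k + 2)))"
  let ?Z = "\<lambda>s. ennreal (1 / (b\<^sup>2 + (s - t)\<^sup>2))"
  have Zfin: "(\<integral>\<^sup>+s. ?Z s \<partial>lborel) < \<infinity>"
  proof -
    have "(\<integral>\<^sup>+s. ?Z s \<partial>lborel) = ennreal \<bar>1\<bar> * (\<integral>\<^sup>+s. ?Z (t + 1 * s) \<partial>lborel)"
      by (rule nn_integral_real_affine) auto
    also have "\<dots> = (\<integral>\<^sup>+s. ennreal (1 / (b\<^sup>2 + s\<^sup>2)) \<partial>lborel)" by simp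
    also have "\<dots> < \<infinity>"
      using integrable_inverse_square_plus[OF b] by (subst nn_integral_eq_integral) auto
    finally show ?thesis .
  qed
  have le: "ennreal (indicator {0<..} \<alpha> * \<alpha> powr (- r) * (cmod (leray_kernel \<gamma> k (t, \<beta>) (s, \<alpha>)))\<^sup>2)
     \<le> ennreal ?X * ?Y \<alpha> * ?Z s" for s \<alpha>
  proof (cases "\<alpha> > 0")
    case True
    let ?C = "cmod (Complex (?a \<alpha>) (s - t))"
    have p: "0 < ?a \<alpha> ^ (2 * k + 2) * (b\<^sup>2 + (s - t)\<^sup>2)"
    proof (intro mult_pos_pos)
      show "0 < ?a \<alpha> ^ (2 * k + 2)" using b ab[of \<alpha>] by (intro zero_less_power) linarith
    qed (use b in \<open>auto simp: add_pos_nonneg\<close>)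
    have "1 / ?C ^ (2 * k + 2 + 2) \<le> 1 / (?a \<alpha> ^ (2 * k + 2) * (b\<^sup>2 + (s - t)\<^sup>2))"
      by (rule frac_le[OF zero_le_one order_refl p norm_power_Complex_ge[OF b ab]])
    note le1 = this
    have c2: "(?C ^ (k + 2))\<^sup>2 = ?C ^ (2 * k + 2 + 2)"
      using power_mult[of ?C "k + 2" 2] by (simp add: mult.commute)
    have Q: "\<alpha> powr (- r) * (\<alpha> powr ((\<gamma> - 1) * (real k + 1)))\<^sup>2 = \<alpha> powr ?q"
      by (simp add: power2_eq_square powr_add[symmetric] algebra_simps)
    have nrm: "cmod (leray_kernel \<gamma> k (t, \<beta>) (s, \<alpha>))
        = \<gamma> ^ k * \<beta> ^ k * \<alpha> powr ((\<gamma> - 1) * (real k + 1)) / ?C ^ (k + 2)"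
      unfolding leray_kernel_eq[OF \<gamma> True \<beta>] norm_divide norm_power norm_of_real b_def
      using \<gamma> \<beta> by (subst abs_of_nonneg) auto
    have "R * (X * A / D)\<^sup>2 = X\<^sup>2 * (R * A\<^sup>2) * (1 / D\<^sup>2)" for R X A D :: real
      by (simp add: power_divide power_mult_distrib)
    then have "\<alpha> powr (- r) * (cmod (leray_kernel \<gamma> k (t, \<beta>) (s, \<alpha>)))\<^sup>2
        = ?X * \<alpha> powr ?q * (1 / ?C ^ (2 * k + 2 + 2))"
      unfolding nrm c2[symmetric] Q[symmetric] .
    then have "\<alpha> powr (- r) * (cmod (leray_kernel \<gamma> k (t, \<beta>) (s, \<alpha>)))\<^sup>2
        \<le> ?X * \<alpha> powr ?q * (1 / (?a \<alpha> ^ (2 * k + 2) * (b\<^sup>2 + (s - t)\<^sup>2)))"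
      using mult_left_mono[OF le1, of "?X * \<alpha> powr ?q"] by simp
    also have "\<dots> = ?X * (\<alpha> powr ?q / ?a \<alpha> ^ (2 * k + 2)) * (1 / (b\<^sup>2 + (s - t)\<^sup>2))"
      by simp
    finally have fin: "\<alpha> powr (- r) * (cmod (leray_kernel \<gamma> k (t, \<beta>) (s, \<alpha>)))\<^sup>2
        \<le> ?X * (\<alpha> powr ?q / ?a \<alpha> ^ (2 * k + 2)) * (1 / (b\<^sup>2 + (s - t)\<^sup>2))" .
    have "0 \<le> \<alpha> powr ?q / ?a \<alpha> ^ (2 * k + 2)" using b ab[of \<alpha>] by simp
    moreover have "0 \<le> 1 / (b\<^sup>2 + (s - t)\<^sup>2)" by simp
    moreover have "ennreal x * ennreal (1 * y) * ennreal z = ennreal (x * y * z)"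
        if "0 \<le> x" "0 \<le> y" "0 \<le> z" for x y z :: real
      using that by (simp add: ennreal_mult)
    moreover have "indicator {0<..} \<alpha> = (1::real)" using True by simp
    ultimately have "ennreal ?X * ?Y \<alpha> * ?Z s
        = ennreal (?X * (\<alpha> powr ?q / ?a \<alpha> ^ (2 * k + 2)) * (1 / (b\<^sup>2 + (s - t)\<^sup>2)))"
      by (simp only: zero_le_power2)
    then show ?thesis using fin True by (simp add: ennreal_leI)
  qed simp
  have "(\<integral>\<^sup>+\<alpha>. \<integral>\<^sup>+s. ennreal (indicator {0<..} \<alpha> * \<alpha> powr (- r)
      * (cmod (leray_kernel \<gamma> k (t, \<beta>) (s, \<alpha>)))\<^sup>2) \<partial>lborel \<partial>lborel)
     \<le> (\<integral>\<^sup>+\<alpha>. \<integral>\<^sup>+s. ennreal ?X * ?Y \<alpha> * ?Z s \<partial>lborel \<partial>lborel)"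
    by (intro nn_integral_mono le)
  also have "\<dots> = (\<integral>\<^sup>+\<alpha>. ennreal ?X * ?Y \<alpha> * (\<integral>\<^sup>+s. ?Z s \<partial>lborel) \<partial>lborel)"
    by (intro nn_integral_cong nn_integral_cmult) measurable
  also have "\<dots> = (\<integral>\<^sup>+\<alpha>. ennreal ?X * ?Y \<alpha> \<partial>lborel) * (\<integral>\<^sup>+s. ?Z s \<partial>lborel)"
    by (rule nn_integral_multc) measurable
  also have "(\<integral>\<^sup>+\<alpha>. ennreal ?X * ?Y \<alpha> \<partial>lborel) = ennreal ?X * (\<integral>\<^sup>+\<alpha>. ?Y \<alpha> \<partial>lborel)"
    by (rule nn_integral_cmult) measurable
  also have "ennreal ?X * (\<integral>\<^sup>+\<alpha>. ?Y \<alpha> \<partial>lborel) * (\<integral>\<^sup>+s. ?Z s \<partial>lborel) < \<infinity>"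
    using Zfin nn_integral_powr_over_power_finite[OF \<gamma> r b] by (auto simp: ennreal_mult_less_top)
  finally show ?thesis .
qed

abbreviation leray_integrand :: "real \<Rightarrow> nat \<Rightarrow> (real \<times> real \<Rightarrow> complex) \<Rightarrow> real \<times> real \<Rightarrow> real \<times> real \<Rightarrow>
    complex" where
  "leray_integrand \<gamma> k g z \<equiv> \<lambda>(s, \<alpha>). indicator {0<..} \<alpha> *\<^sub>R (leray_kernel \<gamma> k z (s, \<alpha>) * g (s, \<alpha>))"

lemma leray_integrand_integrable:
  assumes \<gamma>: "\<gamma> > 1" and r: "r \<in> r_interval \<gamma> k" and \<beta>: "\<beta> > 0"
    and gm[measurable]: "g \<in> borel_measurable (borel \<Otimes>\<^sub>M borel)" and fin: "half_norm2 r g < \<infinity>"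
  shows "integrable plane (leray_integrand \<gamma> k g (t, \<beta>))"
proof (rule integrableI_bounded)
  let ?P = plane
  define f1 where "f1 z = indicator {0<..} (snd z)
      * (snd z powr (- (r / 2)) * cmod (leray_kernel \<gamma> k (t, \<beta>) z))" for z
  define f2 where "f2 z = indicator {0<..} (snd z) * (snd z powr (r / 2) * cmod (g z))" for z :: "real \<times>
      real"
  have [measurable]: "f1 \<in> borel_measurable (borel \<Otimes>\<^sub>M borel)" "f2 \<in> borel_measurable (borel \<Otimes>\<^sub>M borel)"
    unfolding f1_def f2_def by measurable
  have nonneg: "f1 z \<ge> 0" "f2 z \<ge> 0" for z by (auto simp: f1_def f2_def)
  have sq: "f1 (s, \<alpha>) ^ 2 = indicator {0<..} \<alpha> * \<alpha> powr (- r) * (cmod (leray_kernel \<gamma> k (t, \<beta>) (s, \<alpha>)))\<^sup>2"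
    "f2 (s, \<alpha>) ^ 2 = indicator {0<..} \<alpha> * \<alpha> powr r * (cmod (g (s, \<alpha>)))\<^sup>2" for s \<alpha>
  proof -
    have "(\<alpha> powr c)\<^sup>2 = \<alpha> powr (2 * c)" for c by (simp add: power2_eq_square powr_add[symmetric])
    then show "f1 (s, \<alpha>) ^ 2 = indicator {0<..} \<alpha> * \<alpha> powr (- r)
        * (cmod (leray_kernel \<gamma> k (t, \<beta>) (s, \<alpha>)))\<^sup>2"
      "f2 (s, \<alpha>) ^ 2 = indicator {0<..} \<alpha> * \<alpha> powr r * (cmod (g (s, \<alpha>)))\<^sup>2"
      by (auto simp: f1_def f2_def power_mult_distrib indicator_def)
  qed
  have eq: "norm (leray_integrand \<gamma> k g (t, \<beta>) z) = f1 z * f2 z" for z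
    by (cases z) (auto simp: f1_def f2_def norm_mult indicator_def powr_minus field_simps)
  have "(\<integral>\<^sup>+z. ennreal (norm (leray_integrand \<gamma> k g (t, \<beta>) z)) \<partial>?P)\<^sup>2
     = (\<integral>\<^sup>+z. ennreal (f1 z) * ennreal (f2 z) \<partial>?P)\<^sup>2"
    unfolding eq by (simp add: ennreal_mult' nonneg)
  also have "\<dots> \<le> (\<integral>\<^sup>+z. (ennreal (f1 z))\<^sup>2 \<partial>?P) * (\<integral>\<^sup>+z. (ennreal (f2 z))\<^sup>2 \<partial>?P)"
    by (rule Cauchy_Schwarz_nn_integral) measurable
  also have "(\<integral>\<^sup>+z. (ennreal (f1 z))\<^sup>2 \<partial>?P)
      = (\<integral>\<^sup>+\<alpha>. \<integral>\<^sup>+s. ennreal (indicator {0<..} \<alpha> * \<alpha> powr (- r)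
      * (cmod (leray_kernel \<gamma> k (t, \<beta>) (s, \<alpha>)))\<^sup>2) \<partial>lborel \<partial>lborel)"
    by (subst lborel_pair.nn_integral_snd[symmetric]) (auto simp: ennreal_power nonneg sq)
  also have "(\<integral>\<^sup>+z. (ennreal (f2 z))\<^sup>2 \<partial>?P) = half_norm2 r g"
    unfolding half_norm2_def by (subst lborel_pair.nn_integral_snd[symmetric])
        (auto simp: ennreal_power nonneg sq)
  also have "(\<integral>\<^sup>+\<alpha>. \<integral>\<^sup>+s. ennreal
      (indicator {0<..} \<alpha> * \<alpha> powr (- r) * (cmod (leray_kernel \<gamma> k (t, \<beta>) (s, \<alpha>)))\<^sup>2) \<partial>lborel \<partial>lborel)
      * half_norm2 r g < \<infinity>"
    using leray_kernel_L2[OF \<gamma> r \<beta>] fin by (auto simp: ennreal_mult_less_top)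
  finally show "(\<integral>\<^sup>+z. ennreal (norm (leray_integrand \<gamma> k g (t, \<beta>) z)) \<partial>?P) < \<infinity>"
    by (auto simp: power2_eq_square ennreal_mult_less_top)
qed measurable

lemma reduced_leray_eq_product_integral:
  assumes "integrable plane (leray_integrand \<gamma> k g z)"
  shows "reduced_leray \<gamma> k g z = of_real (leray_const \<gamma> k) *
     integral\<^sup>L plane (leray_integrand \<gamma> k g z)"
  unfolding lborel_pair.integral_snd[OF assms, symmetric]
  by (simp add: reduced_leray_def set_lebesgue_integral_def)

definition half_box :: "nat \<Rightarrow> (real \<times> real) set" where
  "half_box n = {- real n..real n} \<times> {1 / real (Suc n)..real (Suc n)}"

definition half_truncate :: "nat \<Rightarrow> (real \<times> real \<Rightarrow> complex) \<Rightarrow> real \<times> real \<Rightarrow> complex" where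
  "half_truncate n g z = (if z \<in> half_box n \<and> cmod (g z) \<le> real n then g z else 0)"

lemma half_box_measurable [measurable]: "half_box n \<in> sets (borel \<Otimes>\<^sub>M borel)"
  unfolding half_box_def by measurable

lemma half_truncate_measurable [measurable]:
  assumes [measurable]: "g \<in> borel_measurable (borel \<Otimes>\<^sub>M borel)"
  shows "half_truncate n g \<in> borel_measurable (borel \<Otimes>\<^sub>M borel)"
  unfolding half_truncate_def by measurable

lemma half_truncate_tendsto:
  assumes "\<alpha> > 0"
  shows "\<forall>\<^sub>F n in sequentially. half_truncate n g (s, \<alpha>) = g (s, \<alpha>)"
proof -
  obtain N :: nat where N: "Max {\<bar>s\<bar>, \<alpha>, 1 / \<alpha>, cmod (g (s, \<alpha>))} < real N" using reals_Archimedean2 by blast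
  have "half_truncate n g (s, \<alpha>) = g (s, \<alpha>)" if "n \<ge> N" for n
  proof -
    have n: "\<bar>s\<bar> \<le> real n" "\<alpha> \<le> real n" "1 / \<alpha> \<le> real n" "cmod (g (s, \<alpha>)) \<le> real n"
      using N that by auto
    have "1 / \<alpha> \<le> real (Suc n)" "\<alpha> \<le> real (Suc n)" using n by auto
    then have "1 / real (Suc n) \<le> \<alpha>" using assms by (simp add: divide_le_eq mult.commute)
    then show ?thesis using n by (auto simp: half_truncate_def half_box_def)
  qed
  then show ?thesis by (auto simp: eventually_sequentially)
qed

lemma integrable_on_half_box:
  fixes f :: "real \<times> real \<Rightarrow> complex"
  assumes [measurable]: "f \<in> borel_measurable (borel \<Otimes>\<^sub>M borel)"
      and "\<And>z. z \<in> half_box n \<Longrightarrow> cmod (f z) \<le> B" "\<And>z. z \<notin> half_box n \<Longrightarrow> f z = 0"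
  shows "integrable plane f" and "integrable lborel (\<lambda>s. f (s, \<alpha>))"
proof -
  have "emeasure plane (half_box n) < \<infinity>"
    unfolding half_box_def by (subst lborel.emeasure_pair_measure_Times)
        (auto simp: ennreal_mult_less_top emeasure_lborel_Icc_eq)
  then have i1: "integrable plane (\<lambda>z. B * indicator (half_box n) z)"
    by (intro integrable_mult_right integrable_real_indicator) auto
  show "integrable plane f"
  proof (rule Bochner_Integration.integrable_bound[OF i1])
    have "norm (f z) \<le> norm (B * indicator (half_box n) z)" for z
      using order_trans[OF assms(2) abs_ge_self] assms(3) by (cases "z \<in> half_box n") auto
    then show "AE z in plane. norm (f z) \<le> norm (B * indicator (half_box n) z)" by simp
  qed measurable
  have i2: "integrable lborel (\<lambda>s. B * indicator {- real n..real n} s)"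
    by (intro integrable_mult_right integrable_real_indicator) auto
  have "norm (f (s, \<alpha>)) \<le> norm (B * indicator {- real n..real n} s)" for s
    using assms(2)[of "(s, \<alpha>)"] assms(3)[of "(s, \<alpha>)"]
    by (cases "(s, \<alpha>) \<in> half_box n") (auto simp: half_box_def indicator_def)
  then show "integrable lborel (\<lambda>s. f (s, \<alpha>))"
    by (intro Bochner_Integration.integrable_bound[OF i2]) auto
qed

text \<open>Truncations of \<open>g\<close> satisfy the integrability conditions of \<open>half_norm2_reduced_leray_le\<close> and have
  smaller norm; their images converge pointwise by dominated convergence, so Fatou's lemma applies.\<close>

lemma half_norm2_reduced_leray_le_L2:
  assumes \<gamma>: "\<gamma> > 1" and r: "r \<in> r_interval \<gamma> k"
    and gm[measurable]: "g \<in> borel_measurable (borel \<Otimes>\<^sub>M borel)" and fin: "half_norm2 r g < \<infinity>"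
  shows "half_norm2 r (reduced_leray \<gamma> k g) \<le> ennreal (C_const \<gamma> r k) * half_norm2 r g"
proof -
  let ?g = "\<lambda>n. half_truncate n g"
  have trunc: "cmod (?g n z) \<le> cmod (g z)" for n z by (simp add: half_truncate_def)
  have norm_le: "half_norm2 r (?g n) \<le> half_norm2 r g" for n
    unfolding half_norm2_def
    by (intro nn_integral_mono ennreal_leI mult_left_mono power_mono trunc) auto
  have bound: "half_norm2 r (reduced_leray \<gamma> k (?g n))
      \<le> ennreal (C_const \<gamma> r k) * half_norm2 r (?g n)" for n
  proof (rule half_norm2_reduced_leray_le[OF \<gamma> r])
    have B: "\<alpha> powr ((\<gamma> - 1) * (real k + 1)) \<le> real (Suc n) powr ((\<gamma> - 1) * (real k + 1))"
      if "\<alpha> \<in> {1 / real (Suc n)..real (Suc n)}" for \<alpha>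
      using that \<gamma> by (intro powr_mono2) (auto intro: order_trans[of 0 "1 / real (Suc n)"])
    show "integrable plane (\<lambda>z. ?g n z
        * of_real (indicator {0<..} (snd z) * snd z powr ((\<gamma> - 1) * (real k + 1))))"
    proof (rule integrable_on_half_box(1))
      fix z assume z: "z \<in> half_box n"
      have "cmod (?g n z) \<le> real n" by (simp add: half_truncate_def)
      moreover have "\<bar>indicator {0<..} (snd z) * snd z powr ((\<gamma> - 1) * (real k + 1))\<bar>
          \<le> real (Suc n) powr ((\<gamma> - 1) * (real k + 1))"
        using B[of "snd z"] z by (auto simp: half_box_def indicator_def)
      ultimately show "cmod (?g n z * of_real
          (indicator {0<..} (snd z) * snd z powr ((\<gamma> - 1) * (real k + 1))))
          \<le> real n * real (Suc n) powr ((\<gamma> - 1) * (real k + 1))"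
        unfolding norm_mult norm_of_real by (intro mult_mono) auto
    qed (measurable, simp add: half_truncate_def)
    show "integrable lborel (\<lambda>s. ?g n (s, \<alpha>))" for \<alpha>
      by (rule integrable_on_half_box(2)[where n=n and B="real n"])
          (measurable, auto simp: half_truncate_def)
  qed measurable
  let ?K = "leray_integrand \<gamma> k g"
  have lim: "(\<lambda>n. reduced_leray \<gamma> k (?g n) (t, \<beta>)) \<longlonglongrightarrow> reduced_leray \<gamma> k g (t, \<beta>)" if \<beta>: "\<beta> > 0" for t \<beta>
  proof -
    have fin_n: "half_norm2 r (?g n) < \<infinity>" for n using norm_le fin le_less_trans by blast
    note int = leray_integrand_integrable[OF \<gamma> r \<beta>]
    note eq = reduced_leray_eq_product_integral[OF int[OF gm fin]]
        reduced_leray_eq_product_integral[OF int[OF half_truncate_measurable[OF gm] fin_n]]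
    show ?thesis unfolding eq
    proof (intro tendsto_mult tendsto_const integral_dominated_convergence)
      show "integrable plane (\<lambda>z. norm (?K (t, \<beta>) z))"
        by (rule integrable_norm[OF int[OF gm fin]])
      have "(\<lambda>n. indicator {0<..} \<alpha> *\<^sub>R (leray_kernel \<gamma> k (t, \<beta>) (s, \<alpha>) * ?g n (s, \<alpha>)))
          \<longlonglongrightarrow> ?K (t, \<beta>) (s, \<alpha>)" for s \<alpha>
      proof (cases "\<alpha> > 0")
        case True
        from half_truncate_tendsto[OF True, of g s]
        have "\<forall>\<^sub>F n in sequentially. ?K (t, \<beta>) (s, \<alpha>)
            = indicator {0<..} \<alpha> *\<^sub>R (leray_kernel \<gamma> k (t, \<beta>) (s, \<alpha>) * ?g n (s, \<alpha>))"
          by eventually_elim simp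
        then show ?thesis by (rule Lim_transform_eventually[OF tendsto_const])
      qed simp
      then have "(\<lambda>n. leray_integrand \<gamma> k (?g n) (t, \<beta>) z) \<longlonglongrightarrow> ?K (t, \<beta>) z" for z
        by (cases z) (simp only: prod.case)
      then show "AE z in plane. (\<lambda>n. leray_integrand \<gamma> k (?g n) (t, \<beta>) z) \<longlonglongrightarrow> ?K (t, \<beta>) z"
        by (intro AE_I2)
      show "AE z in plane. norm (leray_integrand \<gamma> k (?g n) (t, \<beta>) z) \<le> norm (?K (t, \<beta>) z)" for n
        by (intro AE_I2) (simp add: split_beta norm_mult mult_left_mono trunc)
    qed measurable
  qed
  have "ennreal (indicator {0<..} \<beta> * \<beta> powr r * (cmod (reduced_leray \<gamma> k g (t, \<beta>)))\<^sup>2)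
     = liminf (\<lambda>n. ennreal (indicator {0<..} \<beta> * \<beta> powr r * (cmod (reduced_leray \<gamma> k (?g n) (t, \<beta>)))\<^sup>2))"
         for t \<beta>
  proof (cases "\<beta> > 0")
    case True
    have "(\<lambda>n. ennreal (indicator {0<..} \<beta> * \<beta> powr r * (cmod (reduced_leray \<gamma> k (?g n) (t, \<beta>)))\<^sup>2))
        \<longlonglongrightarrow> ennreal (indicator {0<..} \<beta> * \<beta> powr r * (cmod (reduced_leray \<gamma> k g (t, \<beta>)))\<^sup>2)"
      by (intro tendsto_ennrealI tendsto_mult tendsto_const tendsto_power tendsto_norm lim True)
    then show ?thesis by (intro lim_imp_Liminf[symmetric]) simp_all
  qed (simp add: Liminf_const)
  then have "half_norm2 r (reduced_leray \<gamma> k g)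
      = (\<integral>\<^sup>+\<beta>. \<integral>\<^sup>+t. liminf (\<lambda>n. ennreal
      (indicator {0<..} \<beta> * \<beta> powr r * (cmod (reduced_leray \<gamma> k (?g n) (t, \<beta>)))\<^sup>2)) \<partial>lborel \<partial>lborel)"
    unfolding half_norm2_def by (simp only:)
  also have "\<dots> \<le> (\<integral>\<^sup>+\<beta>. liminf (\<lambda>n. \<integral>\<^sup>+t. ennreal
      (indicator {0<..} \<beta> * \<beta> powr r * (cmod (reduced_leray \<gamma> k (?g n) (t, \<beta>)))\<^sup>2) \<partial>lborel) \<partial>lborel)"
    by (intro nn_integral_mono nn_integral_liminf) measurable
  also have "\<dots> \<le> liminf (\<lambda>n. half_norm2 r (reduced_leray \<gamma> k (?g n)))"
    unfolding half_norm2_def by (intro nn_integral_liminf) measurable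
  also have "\<dots> \<le> liminf (\<lambda>n::nat. ennreal (C_const \<gamma> r k) * half_norm2 r g)"
    by (intro Liminf_mono always_eventually allI order_trans[OF bound] mult_left_mono norm_le) simp
  finally show ?thesis by (simp add: Liminf_const)
qed

section \<open>Passage to the hypersurface\<close>

abbreviation param_map :: "real \<Rightarrow> real \<times> real \<times> real \<Rightarrow> complex \<times> complex" where
  "param_map \<gamma> \<equiv> \<lambda>(s, \<alpha>, \<theta>). M_param \<gamma> s \<alpha> \<theta>"

abbreviation param_density :: "real \<Rightarrow> real \<times> real \<times> real \<Rightarrow> ennreal" where
  "param_density r \<equiv> \<lambda>(s, \<alpha>, \<theta>). ennreal (\<alpha> powr r)"

definition angular_lift :: "nat \<Rightarrow> (real \<times> real \<Rightarrow> complex) \<Rightarrow> complex \<times> complex \<Rightarrow> complex" where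
  "angular_lift k g \<zeta> = g (Re (snd \<zeta>), cmod (fst \<zeta>)) * cis (of_nat k * Arg2pi (fst \<zeta>))"

definition param_domain :: "(real \<times> real \<times> real) set" where
  "param_domain = UNIV \<times> {0<..} \<times> {0..<2*pi}"

lemma borel_measurable_Arg2pi [measurable]: "Arg2pi \<in> borel_measurable borel"
  unfolding borel_measurable_iff_le using closed_Arg2pi2pi_le by auto

lemma angular_lift_measurable:
  assumes [measurable]: "g \<in> borel_measurable (borel \<Otimes>\<^sub>M borel)"
  shows "angular_lift k g \<in> borel_measurable (restrict_space borel (M_hyp \<gamma>))"
proof (rule measurable_restrict_space1)
  have "angular_lift k g \<in> borel_measurable (borel \<Otimes>\<^sub>M borel)"
    unfolding angular_lift_def by measurable
  then show "angular_lift k g \<in> borel_measurable borel" by (simp only: borel_prod)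
qed

lemma M_param_coords:
  assumes "\<alpha> > 0" "\<theta> \<in> {0..<2*pi}"
  shows "cmod (fst (M_param \<gamma> s \<alpha> \<theta>)) = \<alpha>" "Re (snd (M_param \<gamma> s \<alpha> \<theta>)) = s" "Arg2pi (fst (M_param \<gamma> s \<alpha> \<theta>))
      = \<theta>"
    "M_param \<gamma> s \<alpha> \<theta> \<in> M_hyp \<gamma>"
  using assms by (auto simp: M_param_def M_hyp_def norm_mult cis_conv_exp intro!: Arg2pi_unique[of 1])

lemma angular_lift_M_param:
  assumes "\<alpha> > 0" "\<theta> \<in> {0..<2*pi}"
  shows "angular_lift k g (M_param \<gamma> s \<alpha> \<theta>) = g (s, \<alpha>) * cis (of_nat k * \<theta>)"
  using M_param_coords[OF assms] by (simp add: angular_lift_def)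

lemma M_param_measurable:
  "(param_map \<gamma>) \<in> restrict_space lborel param_domain \<rightarrow>\<^sub>M restrict_space borel (M_hyp \<gamma>)"
proof (rule measurable_restrict_space2)
  show "(param_map \<gamma>) \<in> space (restrict_space lborel param_domain) \<rightarrow> M_hyp \<gamma>"
    by (auto simp: space_restrict_space param_domain_def M_param_coords)
  have "(param_map \<gamma>) \<in> borel \<Otimes>\<^sub>M (borel \<Otimes>\<^sub>M borel) \<rightarrow>\<^sub>M borel \<Otimes>\<^sub>M borel"
    unfolding M_param_def by measurable
  then show "(param_map \<gamma>) \<in> restrict_space lborel param_domain \<rightarrow>\<^sub>M borel"
    by (intro measurable_restrict_space1) (simp add: borel_prod)
qed

lemma param_domain_sets [measurable]: "param_domain \<in> sets (borel \<Otimes>\<^sub>M (borel \<Otimes>\<^sub>M borel))"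
  unfolding param_domain_def by measurable

lemma param_domain_lborel: "param_domain \<inter> space lborel \<in> sets lborel"
  using param_domain_sets unfolding borel_prod by simp

lemma density_measurable:
  "(param_density r) \<in> borel_measurable (restrict_space lborel param_domain)"
proof (rule measurable_restrict_space1)
  have "(param_density r) \<in> borel_measurable
      ((borel :: real measure) \<Otimes>\<^sub>M ((borel :: real measure) \<Otimes>\<^sub>M (borel :: real measure)))" by measurable
  then show "(param_density r) \<in> borel_measurable lborel" unfolding borel_prod by simp
qed

lemma sets_\<mu>_meas: "sets (\<mu>_meas \<gamma> r) = sets (restrict_space borel (M_hyp \<gamma>))"
  by (simp add: \<mu>_meas_def)

lemma measurable_\<mu>_meas: "borel_measurable (\<mu>_meas \<gamma> r) = borel_measurable (restrict_space borel (M_hyp \<gamma>))"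
  by (rule measurable_cong_sets) (simp_all add: sets_\<mu>_meas)

lemma nn_integral_\<mu>_meas:
  assumes F: "F \<in> borel_measurable (restrict_space borel (M_hyp \<gamma>))"
  shows "(\<integral>\<^sup>+\<zeta>. F \<zeta> \<partial>\<mu>_meas \<gamma> r) =
     (\<integral>\<^sup>+(s, \<alpha>, \<theta>). ennreal (\<alpha> powr r) * F (M_param \<gamma> s \<alpha> \<theta>) * indicator param_domain (s, \<alpha>, \<theta>) \<partial>lborel)"
proof -
  have Fm: "(\<lambda>p. F (param_map \<gamma> p)) \<in> borel_measurable (restrict_space lborel param_domain)"
    by (rule measurable_compose[OF M_param_measurable F])
  have "(\<integral>\<^sup>+\<zeta>. F \<zeta> \<partial>\<mu>_meas \<gamma> r) = (\<integral>\<^sup>+p. F (param_map \<gamma> p)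
       \<partial>density (restrict_space lborel param_domain) (param_density r))"
    unfolding \<mu>_meas_def param_domain_def[symmetric]
    by (rule nn_integral_distr) (simp_all add: M_param_measurable F)
  also have "\<dots> = (\<integral>\<^sup>+p. param_density r p * F (param_map \<gamma> p) \<partial>restrict_space lborel param_domain)"
    by (rule nn_integral_density[OF density_measurable Fm])
  also have "\<dots> = (\<integral>\<^sup>+p. param_density r p * F (param_map \<gamma> p) * indicator param_domain p \<partial>lborel)"
    by (rule nn_integral_restrict_space[OF param_domain_lborel])
  finally show ?thesis by (simp add: case_prod_beta')
qed

lemma nn_integral_\<mu>_meas_radial:
  fixes u :: "real \<times> real \<Rightarrow> ennreal"
  assumes um[measurable]: "u \<in> borel_measurable (borel \<Otimes>\<^sub>M borel)"
  shows "(\<integral>\<^sup>+\<zeta>. u (Re (snd \<zeta>), cmod (fst \<zeta>)) \<partial>\<mu>_meas \<gamma> r) =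
     ennreal (2 * pi) * (\<integral>\<^sup>+\<alpha>. \<integral>\<^sup>+s. ennreal (indicator {0<..} \<alpha> * \<alpha> powr r) * u (s, \<alpha>) \<partial>lborel \<partial>lborel)"
proof -
  have "(\<lambda>\<zeta>. u (Re (snd \<zeta>), cmod (fst \<zeta>))) \<in> borel_measurable (borel \<Otimes>\<^sub>M borel)" by measurable
  then have m: "(\<lambda>\<zeta>. u (Re (snd \<zeta>), cmod (fst \<zeta>))) \<in> borel_measurable (restrict_space borel (M_hyp \<gamma>))"
    by (intro measurable_restrict_space1) (simp add: borel_prod)
  have "(\<integral>\<^sup>+\<zeta>. u (Re (snd \<zeta>), cmod (fst \<zeta>)) \<partial>\<mu>_meas \<gamma> r) =
     (\<integral>\<^sup>+(s, \<alpha>, \<theta>). (ennreal (indicator {0<..} \<alpha> * \<alpha> powr r) * u (s, \<alpha>))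
         * indicator {0..<2*pi} \<theta> \<partial>(lborel \<Otimes>\<^sub>M plane))"
    unfolding nn_integral_\<mu>_meas[OF m] lborel_prod
    by (intro nn_integral_cong) (auto simp: param_domain_def indicator_def M_param_coords split: if_splits)
  also have "\<dots> = (\<integral>\<^sup>+s. \<integral>\<^sup>+\<alpha>. \<integral>\<^sup>+\<theta>. (ennreal (indicator {0<..} \<alpha> * \<alpha> powr r) * u (s, \<alpha>))
      * indicator {0..<2*pi} \<theta> \<partial>lborel \<partial>lborel \<partial>lborel)"
  proof -
    show ?thesis
      by (subst sigma_finite_measure.nn_integral_fst[OF sigma_finite_plane, symmetric], measurable)
         (auto intro!: nn_integral_cong simp: lborel.nn_integral_fst[symmetric])
  qed
  also have "\<dots> = (\<integral>\<^sup>+s. \<integral>\<^sup>+\<alpha>. ennreal (2 * pi) * (ennreal (indicator {0<..} \<alpha> * \<alpha> powr r) * u (s, \<alpha>))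
      \<partial>lborel \<partial>lborel)"
    by (intro nn_integral_cong, subst nn_integral_cmult_indicator) (simp_all add: mult.commute)
  also have "\<dots> = (\<integral>\<^sup>+\<alpha>. \<integral>\<^sup>+s. ennreal (2 * pi) * (ennreal (indicator {0<..} \<alpha> * \<alpha> powr r) * u (s, \<alpha>))
      \<partial>lborel \<partial>lborel)"
    by (rule lborel_pair.Fubini') measurable
  also have "\<dots> = (\<integral>\<^sup>+\<alpha>. ennreal (2 * pi)
      * (\<integral>\<^sup>+s. ennreal (indicator {0<..} \<alpha> * \<alpha> powr r) * u (s, \<alpha>) \<partial>lborel) \<partial>lborel)"
    by (intro nn_integral_cong nn_integral_cmult) measurable
  also have "\<dots> = ennreal (2 * pi)
      * (\<integral>\<^sup>+\<alpha>. \<integral>\<^sup>+s. ennreal (indicator {0<..} \<alpha> * \<alpha> powr r) * u (s, \<alpha>) \<partial>lborel \<partial>lborel)"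
    by (rule nn_integral_cmult) measurable
  finally show ?thesis .
qed

lemma nn_integral_angular_lift:
  assumes [measurable]: "g \<in> borel_measurable (borel \<Otimes>\<^sub>M borel)"
  shows "(\<integral>\<^sup>+\<zeta>. ennreal ((cmod (angular_lift k g \<zeta>))\<^sup>2) \<partial>\<mu>_meas \<gamma> r) = ennreal (2 * pi) * half_norm2 r g"
proof -
  have "(\<integral>\<^sup>+\<zeta>. ennreal ((cmod (angular_lift k g \<zeta>))\<^sup>2) \<partial>\<mu>_meas \<gamma> r)
      = (\<integral>\<^sup>+\<zeta>. (\<lambda>p. ennreal ((cmod (g p))\<^sup>2)) (Re (snd \<zeta>), cmod (fst \<zeta>)) \<partial>\<mu>_meas \<gamma> r)"
    by (simp add: angular_lift_def norm_mult)
  also have "\<dots> = ennreal (2 * pi) * half_norm2 r g"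
    by (subst nn_integral_\<mu>_meas_radial) (auto simp: half_norm2_def ennreal_mult'[symmetric])
  finally show ?thesis .
qed

text \<open>The slices are taken with \<open>\<theta>\<close> innermost because Fourier coefficients integrate over \<open>\<theta>\<close> for
  fixed \<open>(s, \<alpha>)\<close>.\<close>

lemma AE_\<mu>_meas_param:
  assumes "AE \<zeta> in \<mu>_meas \<gamma> r. P \<zeta>"
  shows "AE s in lborel. AE \<alpha> in lborel. AE \<theta> in lborel. \<alpha> > 0 \<longrightarrow> \<theta> \<in> {0..<2*pi} \<longrightarrow> P (M_param \<gamma> s \<alpha> \<theta>)"
proof -
  have "AE p in density (restrict_space lborel param_domain) (param_density r). P (param_map \<gamma> p)"
    using assms unfolding \<mu>_meas_def param_domain_def[symmetric]
    by (rule AE_distrD[rotated]) (simp add: M_param_measurable)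
  then have "AE p in restrict_space lborel param_domain. 0 < param_density r p \<longrightarrow> P (param_map \<gamma> p)"
    by (simp only: AE_density[OF density_measurable])
  then have "AE p in lborel. p \<in> param_domain \<longrightarrow> 0 < param_density r p \<longrightarrow> P (param_map \<gamma> p)"
    by (simp only: AE_restrict_space_iff[OF param_domain_lborel])
  then have ae: "AE p in lborel \<Otimes>\<^sub>M plane. case p of (s, \<alpha>, \<theta>) \<Rightarrow> \<alpha> > 0 \<longrightarrow> \<theta>
      \<in> {0..<2*pi} \<longrightarrow> P (M_param \<gamma> s \<alpha> \<theta>)"
    unfolding lborel_prod by eventually_elim (auto simp: param_domain_def)
  interpret P: pair_sigma_finite "lborel :: real measure" "plane"
    using sigma_finite_plane lborel.sigma_finite_measure_axioms by (simp add: pair_sigma_finite_def)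
  from P.AE_pair[OF ae] have "AE s in lborel. AE q in plane. case q of (\<alpha>, \<theta>) \<Rightarrow> \<alpha> > 0 \<longrightarrow> \<theta>
      \<in> {0..<2*pi} \<longrightarrow> P (M_param \<gamma> s \<alpha> \<theta>)"
    by simp
  then show ?thesis
    by eventually_elim (use lborel_pair.AE_pair in fastforce)
qed

lemma AE_\<mu>_meas_off_axis: "AE \<zeta> in \<mu>_meas \<gamma> r. cmod (fst \<zeta>) > 0"
proof -
  have "{\<zeta> \<in> space (borel \<Otimes>\<^sub>M borel). cmod (fst \<zeta>) > 0}
      \<in> sets (borel \<Otimes>\<^sub>M borel :: (complex \<times> complex) measure)" by measurable
  then have "{\<zeta> :: complex \<times> complex. cmod (fst \<zeta>) > 0} \<in> sets borel" unfolding borel_prod by simp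
  then have s: "{\<zeta> \<in> space (restrict_space borel (M_hyp \<gamma>)). cmod (fst \<zeta>) > 0}
      \<in> sets (restrict_space borel (M_hyp \<gamma>))"
    by (auto simp: sets_restrict_space space_restrict_space intro!:
        image_eqI[of _ _ "{\<zeta>. cmod (fst \<zeta>) > 0}"])
  have m: "(param_map \<gamma>) \<in> density (restrict_space lborel param_domain) (param_density r) \<rightarrow>\<^sub>M
      restrict_space borel (M_hyp \<gamma>)"
    by (simp add: M_param_measurable)
  show ?thesis unfolding \<mu>_meas_def param_domain_def[symmetric] AE_distr_iff[OF m s]
    by (rule AE_I2) (auto simp: space_restrict_space param_domain_def M_param_def)
qed

lemma fourier_comp_measurable:
  assumes f: "f \<in> borel_measurable (restrict_space borel (M_hyp \<gamma>))"
  shows "(\<lambda>(s, \<alpha>). indicator {0<..} \<alpha> *\<^sub>R fourier_comp \<gamma> j f s \<alpha>) \<in> borel_measurable (borel \<Otimes>\<^sub>M borel)"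
proof -
  have "(\<lambda>p. f (param_map \<gamma> p)) \<in> borel_measurable (restrict_space lborel param_domain)"
    by (rule measurable_compose[OF M_param_measurable f])
  then have "(\<lambda>p. indicator param_domain p *\<^sub>R f (param_map \<gamma> p)) \<in> borel_measurable lborel"
    by (subst (asm) borel_measurable_restrict_space_iff[OF param_domain_lborel])
  then have "(\<lambda>p. indicator param_domain p *\<^sub>R f (param_map \<gamma> p))
      \<in> borel_measurable (borel \<Otimes>\<^sub>M (borel \<Otimes>\<^sub>M borel))"
    unfolding borel_prod by simp
  moreover define \<Phi> where "\<Phi> p = indicator param_domain p *\<^sub>R f (param_map \<gamma> p)" for p
  ultimately have [measurable]: "\<Phi> \<in> borel_measurable (borel \<Otimes>\<^sub>M (borel \<Otimes>\<^sub>M borel))"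
    by (simp only: \<Phi>_def[abs_def])
  have eq: "indicator {0<..} \<alpha> *\<^sub>R fourier_comp \<gamma> j f s \<alpha>
      = (1 / (2 * pi)) * (LBINT \<theta>. \<Phi> (s, \<alpha>, \<theta>) * cis (- (of_int j * \<theta>)))" for s \<alpha>
  proof (cases "\<alpha> > 0")
    case True
    then show ?thesis
      by (auto simp: \<Phi>_def fourier_comp_def set_lebesgue_integral_def param_domain_def indicator_def
          intro!: Bochner_Integration.integral_cong)
  qed (simp add: \<Phi>_def param_domain_def)
  show ?thesis unfolding eq by measurable
qed

lemma fourier_comp_angular_lift:
  assumes f: "f \<in> borel_measurable (restrict_space borel (M_hyp \<gamma>))"
    and g[measurable]: "g \<in> borel_measurable (borel \<Otimes>\<^sub>M borel)"
    and ae: "AE \<zeta> in \<mu>_meas \<gamma> r. f \<zeta> = angular_lift k g \<zeta>"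
  shows "AE \<alpha> in lborel. AE s in lborel. indicator {0<..} \<alpha> *\<^sub>R fourier_comp \<gamma> (int k) f s \<alpha>
      = indicator {0<..} \<alpha> *\<^sub>R g (s, \<alpha>)"
proof -
  have 1: "indicator {0<..} \<alpha> *\<^sub>R fourier_comp \<gamma> (int k) f s \<alpha> = indicator {0<..} \<alpha> *\<^sub>R g (s, \<alpha>)"
    if ae': "AE \<theta> in lborel. \<alpha> > 0 \<longrightarrow> \<theta> \<in> {0..<2*pi} \<longrightarrow> f (M_param \<gamma> s \<alpha> \<theta>)
        = angular_lift k g (M_param \<gamma> s \<alpha> \<theta>)" for s \<alpha>
  proof (cases "\<alpha> > 0")
    case True
    have "(\<lambda>\<theta>. M_param \<gamma> s \<alpha> \<theta>) \<in> restrict_space lborel {0..<2*pi} \<rightarrow>\<^sub>M restrict_space borel (M_hyp \<gamma>)"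
    proof (rule measurable_restrict_space2)
      have "(\<lambda>\<theta>. M_param \<gamma> s \<alpha> \<theta>) \<in> borel \<rightarrow>\<^sub>M borel \<Otimes>\<^sub>M borel" unfolding M_param_def by measurable
      then show "(\<lambda>\<theta>. M_param \<gamma> s \<alpha> \<theta>) \<in> restrict_space lborel {0..<2*pi} \<rightarrow>\<^sub>M borel"
        by (intro measurable_restrict_space1) (simp add: borel_prod)
    qed (use True in \<open>auto simp: space_restrict_space M_param_coords\<close>)
    from measurable_compose[OF this f]
    have fm[measurable]: "(\<lambda>\<theta>. indicator {0..<2*pi} \<theta> *\<^sub>R f (M_param \<gamma> s \<alpha> \<theta>)) \<in> borel_measurable lborel"
      by (subst (asm) borel_measurable_restrict_space_iff) auto
    have "fourier_comp \<gamma> (int k) f s \<alpha>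
        = (1 / (2 * pi)) * (LBINT \<theta>. indicator {0..<2*pi} \<theta> *\<^sub>R f (M_param \<gamma> s \<alpha> \<theta>)
        * cis (- (of_nat k * \<theta>)))"
      by (simp add: fourier_comp_def set_lebesgue_integral_def)
    also have "(LBINT \<theta>. indicator {0..<2*pi} \<theta> *\<^sub>R f (M_param \<gamma> s \<alpha> \<theta>) * cis (- (of_nat k * \<theta>)))
        = (LBINT \<theta>. indicator {0..<2*pi} \<theta> *\<^sub>R g (s, \<alpha>))"
    proof (rule integral_cong_AE)
      show "AE \<theta> in lborel. indicator {0..<2*pi} \<theta> *\<^sub>R f (M_param \<gamma> s \<alpha> \<theta>) * cis (- (of_nat k * \<theta>))
          = indicator {0..<2*pi} \<theta> *\<^sub>R g (s, \<alpha>)"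
        using ae' by eventually_elim (auto simp: True angular_lift_M_param cis_mult mult.assoc
            indicator_def)
    qed measurable
    also have "\<dots> = (2 * pi) *\<^sub>R g (s, \<alpha>)"
      by (subst integral_scaleR_left) auto
    finally show ?thesis using True by (simp add: scaleR_conv_of_real)
  qed simp
  have "AE s in lborel. AE \<alpha> in lborel. indicator {0<..} \<alpha> *\<^sub>R fourier_comp \<gamma> (int k) f s \<alpha>
      = indicator {0<..} \<alpha> *\<^sub>R g (s, \<alpha>)"
    using AE_\<mu>_meas_param[OF ae]
  proof eventually_elim
    case (elim s)
    then show ?case by eventually_elim (rule 1)
  qed
  moreover have "{z \<in> space plane. indicator {0<..} (snd z) *\<^sub>R fourier_comp \<gamma> (int k) f (fst z) (snd z)
      = indicator {0<..} (snd z) *\<^sub>R g (fst z, snd z)} \<in> sets plane"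
    using fourier_comp_measurable[OF f, of "int k"] unfolding case_prod_beta' by measurable
  ultimately show ?thesis
    by (subst (asm) lborel_pair.AE_commute) auto
qed

lemma leray_kernel_measurable_snd [measurable]: "leray_kernel \<gamma> k z \<in> borel_measurable (borel \<Otimes>\<^sub>M borel)"
  by (rule measurable_Pair2[OF leray_kernel_measurable, unfolded prod.case]) (simp add: space_pair_measure)

text \<open>The measurability conditions matter: the Bochner integral of a function that is not
  Borel measurable is 0 by convention, even if the function agrees almost everywhere with an
  integrable one.\<close>

lemma reduced_leray_cong_AE:
  assumes [measurable]: "g \<in> borel_measurable (borel \<Otimes>\<^sub>M borel)" "h \<in> borel_measurable (borel \<Otimes>\<^sub>M borel)"
    and ae: "AE \<alpha> in lborel. AE s in lborel. indicator {0<..} \<alpha> *\<^sub>R g (s, \<alpha>)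
        = indicator {0<..} \<alpha> *\<^sub>R h (s, \<alpha>)"
  shows "reduced_leray \<gamma> k g z = reduced_leray \<gamma> k h z"
proof -
  have "(LBINT \<alpha>. indicator {0<..} \<alpha> *\<^sub>R (LBINT s. leray_kernel \<gamma> k z (s, \<alpha>) * g (s, \<alpha>)))
      = (LBINT \<alpha>. indicator {0<..} \<alpha> *\<^sub>R (LBINT s. leray_kernel \<gamma> k z (s, \<alpha>) * h (s, \<alpha>)))"
  proof (rule integral_cong_AE)
    show "AE \<alpha> in lborel. indicator {0<..} \<alpha> *\<^sub>R (LBINT s. leray_kernel \<gamma> k z (s, \<alpha>) * g (s, \<alpha>))
        = indicator {0<..} \<alpha> *\<^sub>R (LBINT s. leray_kernel \<gamma> k z (s, \<alpha>) * h (s, \<alpha>))"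
      using ae
    proof eventually_elim
      case (elim \<alpha>)
      show ?case
      proof (cases "\<alpha> > 0")
        case True
        have "(LBINT s. leray_kernel \<gamma> k z (s, \<alpha>) * g (s, \<alpha>))
            = (LBINT s. leray_kernel \<gamma> k z (s, \<alpha>) * h (s, \<alpha>))"
        proof (rule integral_cong_AE)
          show "AE s in lborel. leray_kernel \<gamma> k z (s, \<alpha>) * g (s, \<alpha>) = leray_kernel \<gamma> k z (s, \<alpha>) * h (s, \<alpha>)"
            using elim by eventually_elim (use True in simp)
        qed measurable
        then show ?thesis by simp
      qed simp
    qed
  qed measurable
  then show ?thesis by (simp add: reduced_leray_def set_lebesgue_integral_def)
qed

text \<open>The Fourier coefficient of \<open>f\<close> equals \<open>g\<close> only almost everywhere, but the operator integrates it,
  so the two sides agree at every point.\<close>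

lemma sub_leray_eq_angular_lift:
  assumes f: "f \<in> borel_measurable (restrict_space borel (M_hyp \<gamma>))"
    and g[measurable]: "g \<in> borel_measurable (borel \<Otimes>\<^sub>M borel)"
    and ae: "AE \<zeta> in \<mu>_meas \<gamma> r. f \<zeta> = angular_lift k g \<zeta>"
  shows "sub_leray \<gamma> k f = angular_lift k (reduced_leray \<gamma> k g)"
proof
  fix z
  let ?\<phi> = "\<lambda>(s, \<alpha>). indicator {0<..} \<alpha> *\<^sub>R fourier_comp \<gamma> (int k) f s \<alpha>"
  have "sub_leray \<gamma> k f z = angular_lift k (reduced_leray \<gamma> k ?\<phi>) z"
  proof -
    have "(LBINT \<alpha>:{0<..}. LBINT s. complex_of_real (kernel_B \<gamma> \<alpha> b) ^ k / kernel_A \<gamma> s \<alpha> t b ^ (k + 2) *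
            fourier_comp \<gamma> (int k) f s \<alpha> * complex_of_real (\<alpha> powr (\<gamma> - 1)))
        = (LBINT \<alpha>:{0<..}. LBINT s. leray_kernel \<gamma> k (t, b) (s, \<alpha>) * ?\<phi> (s, \<alpha>))" for t b
      unfolding set_lebesgue_integral_def
      by (intro Bochner_Integration.integral_cong refl) (simp add: leray_kernel_def indicator_def mult_ac)
    then show ?thesis
      by (simp add: sub_leray_def Let_def angular_lift_def reduced_leray_def leray_const_def mult_ac)
  qed
  also have "reduced_leray \<gamma> k ?\<phi> w = reduced_leray \<gamma> k g w" for w
  proof (intro reduced_leray_cong_AE fourier_comp_measurable[OF f] g)
    show "AE \<alpha> in lborel. AE s in lborel. indicator {0<..} \<alpha> *\<^sub>R ?\<phi> (s, \<alpha>)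
        = indicator {0<..} \<alpha> *\<^sub>R g (s, \<alpha>)"
      using fourier_comp_angular_lift[OF f g ae]
    proof eventually_elim
      case (elim \<alpha>)
      then show ?case by eventually_elim (auto simp: indicator_def)
    qed
  qed
  then have "reduced_leray \<gamma> k ?\<phi> = reduced_leray \<gamma> k g" ..
  finally show "sub_leray \<gamma> k f z = angular_lift k (reduced_leray \<gamma> k g) z" .
qed

section \<open>Boundedness and the operator norm\<close>

abbreviation L2_sq :: "'a measure \<Rightarrow> ('a \<Rightarrow> complex) \<Rightarrow> ennreal" where
  "L2_sq M f \<equiv> \<integral>\<^sup>+x. ennreal ((cmod (f x))\<^sup>2) \<partial>M"

lemma L2_space_iff:
  "f \<in> L2_space M \<longleftrightarrow> f \<in> borel_measurable M \<and> L2_sq M f < \<infinity>"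
  by (auto simp: L2_space_def integrable_iff_bounded)

lemma L2_norm_nonneg: "0 \<le> L2_norm M f"
  by (simp add: L2_norm_def)

lemma ennreal_L2_norm:
  assumes "f \<in> L2_space M"
  shows "ennreal ((L2_norm M f)\<^sup>2) = L2_sq M f"
proof -
  have "integrable M (\<lambda>x. (cmod (f x))\<^sup>2)" using assms by (simp add: L2_space_def)
  then have "L2_sq M f = ennreal (\<integral>x. (cmod (f x))\<^sup>2 \<partial>M)"
    by (rule nn_integral_eq_integral) simp
  then show ?thesis by (simp add: L2_norm_def)
qed

lemma L2_norm_le_iff:
  assumes "f \<in> L2_space M" "h \<in> L2_space M" "0 \<le> c"
  shows "L2_norm M f \<le> c * L2_norm M h \<longleftrightarrow>
    L2_sq M f \<le> ennreal (c\<^sup>2) * L2_sq M h"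
proof -
  have "L2_norm M f \<le> c * L2_norm M h \<longleftrightarrow> (L2_norm M f)\<^sup>2 \<le> c\<^sup>2 * (L2_norm M h)\<^sup>2"
    using assms(3) L2_norm_nonneg[of M f] L2_norm_nonneg[of M h]
    by (subst power_mult_distrib[symmetric], subst abs_le_square_iff[symmetric]) simp
  also have "\<dots> \<longleftrightarrow> ennreal ((L2_norm M f)\<^sup>2) \<le> ennreal (c\<^sup>2) * ennreal ((L2_norm M h)\<^sup>2)"
    by (simp add: ennreal_mult'[symmetric] ennreal_le_iff)
  finally show ?thesis by (simp only: ennreal_L2_norm assms)
qed

lemma L2_norm_cong_AE:
  assumes "f \<in> borel_measurable M" "h \<in> borel_measurable M" "AE x in M. f x = h x"
  shows "L2_norm M f = L2_norm M h"
proof -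
  have "(\<integral>x. (cmod (f x))\<^sup>2 \<partial>M) = (\<integral>x. (cmod (h x))\<^sup>2 \<partial>M)"
  proof (rule integral_cong_AE)
    show "AE x in M. (cmod (f x))\<^sup>2 = (cmod (h x))\<^sup>2" using assms(3) by eventually_elim simp
  qed (use assms(1,2) in measurable)
  then show ?thesis by (simp add: L2_norm_def)
qed

text \<open>A quadratic substitute for the triangle inequality: \<open>v\<close> will be made small first and then \<open>\<epsilon>\<close>.\<close>

lemma L2_norm_add_le:
  assumes u: "u \<in> L2_space M" and v: "v \<in> L2_space M" and w: "w \<in> L2_space M"
    and ae: "AE x in M. w x = u x + v x" and \<epsilon>: "\<epsilon> > 0"
  shows "(L2_norm M w)\<^sup>2 \<le> (1 + \<epsilon>) * (L2_norm M u)\<^sup>2 + (1 + 1 / \<epsilon>) * (L2_norm M v)\<^sup>2"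
proof -
  have iu: "integrable M (\<lambda>x. (cmod (u x))\<^sup>2)" and iv: "integrable M (\<lambda>x. (cmod (v x))\<^sup>2)"
      and iw: "integrable M (\<lambda>x. (cmod (w x))\<^sup>2)"
    using u v w by (auto simp: L2_space_def)
  have sq: "(cmod (a + b))\<^sup>2 \<le> (1 + \<epsilon>) * (cmod a)\<^sup>2 + (1 + 1 / \<epsilon>) * (cmod b)\<^sup>2" for a b :: complex
  proof -
    have "(cmod (a + b))\<^sup>2 \<le> (cmod a + cmod b)\<^sup>2" by (intro power_mono norm_triangle_ineq) auto
    also have "\<dots> = (cmod a)\<^sup>2 + 2 * cmod a * cmod b + (cmod b)\<^sup>2" by (simp add: power2_sum)
    also have "2 * cmod a * cmod b \<le> \<epsilon> * (cmod a)\<^sup>2 + 1 / \<epsilon> * (cmod b)\<^sup>2"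
    proof -
      have "0 \<le> (\<epsilon> * cmod a - cmod b)\<^sup>2 / \<epsilon>" using \<epsilon> by simp
      also have "\<dots> = \<epsilon> * (cmod a)\<^sup>2 + 1 / \<epsilon> * (cmod b)\<^sup>2 - 2 * cmod a * cmod b"
        using \<epsilon> by (simp add: power2_eq_square field_simps)
      finally show ?thesis by simp
    qed
    finally show ?thesis by (simp add: algebra_simps)
  qed
  have "(L2_norm M w)\<^sup>2 = (\<integral>x. (cmod (w x))\<^sup>2 \<partial>M)" by (simp add: L2_norm_def)
  also have "\<dots> \<le> (\<integral>x. (1 + \<epsilon>) * (cmod (u x))\<^sup>2 + (1 + 1 / \<epsilon>) * (cmod (v x))\<^sup>2 \<partial>M)"
  proof (rule integral_mono_AE)
    show "AE x in M. (cmod (w x))\<^sup>2 \<le> (1 + \<epsilon>) * (cmod (u x))\<^sup>2 + (1 + 1 / \<epsilon>) * (cmod (v x))\<^sup>2"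
      using ae by eventually_elim (simp only: sq)
  qed (use iu iv iw in auto)
  also have "\<dots> = (1 + \<epsilon>) * (\<integral>x. (cmod (u x))\<^sup>2 \<partial>M) + (1 + 1 / \<epsilon>) * (\<integral>x. (cmod (v x))\<^sup>2 \<partial>M)"
    using iu iv by simp
  finally show ?thesis by (simp add: L2_norm_def)
qed

lemma L2_comp_iff:
  "f \<in> L2_comp \<gamma> r (int k) \<longleftrightarrow> f \<in> L2_space (\<mu>_meas \<gamma> r) \<and>
     (\<exists>g \<in> borel_measurable (borel \<Otimes>\<^sub>M borel). AE \<zeta> in \<mu>_meas \<gamma> r. f \<zeta> = angular_lift k g \<zeta>)"
  unfolding L2_comp_def angular_lift_def borel_prod of_int_of_nat_eq Bex_def mem_Collect_eq ..

lemma angular_lift_L2_comp: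
  assumes g: "g \<in> borel_measurable (borel \<Otimes>\<^sub>M borel)" and fin: "half_norm2 r g < \<infinity>"
  shows "angular_lift k g \<in> L2_comp \<gamma> r (int k)"
  unfolding L2_comp_iff L2_space_iff measurable_\<mu>_meas nn_integral_angular_lift[OF g]
proof (intro conjI bexI[of _ g] angular_lift_measurable g)
  show "ennreal (2 * pi) * half_norm2 r g < \<infinity>"
    using fin by (auto simp: ennreal_mult_less_top)
qed simp

lemma L2_compE:
  assumes f: "f \<in> L2_comp \<gamma> r (int k)"
  obtains g where "g \<in> borel_measurable (borel \<Otimes>\<^sub>M borel)" "AE \<zeta> in \<mu>_meas \<gamma> r. f \<zeta> = angular_lift k g \<zeta>"
    "L2_sq (\<mu>_meas \<gamma> r) f = ennreal (2 * pi) * half_norm2 r g"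
    "half_norm2 r g < \<infinity>" "sub_leray \<gamma> k f = angular_lift k (reduced_leray \<gamma> k g)"
proof -
  from f obtain g where g: "g \<in> borel_measurable (borel \<Otimes>\<^sub>M borel)"
      and ae: "AE \<zeta> in \<mu>_meas \<gamma> r. f \<zeta> = angular_lift k g \<zeta>"
    by (auto simp: L2_comp_iff)
  have fm: "f \<in> borel_measurable (restrict_space borel (M_hyp \<gamma>))" and fin: "L2_sq (\<mu>_meas \<gamma> r) f < \<infinity>"
    using f by (auto simp: L2_comp_iff L2_space_iff measurable_\<mu>_meas)
  have eq: "L2_sq (\<mu>_meas \<gamma> r) f = ennreal (2 * pi) * half_norm2 r g"
    unfolding nn_integral_angular_lift[OF g, of \<gamma> r k, symmetric]
    by (rule nn_integral_cong_AE) (use ae in \<open>eventually_elim, simp\<close>)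
  have fin': "half_norm2 r g < \<infinity>" using fin unfolding eq by (auto simp: ennreal_mult_less_top)
  show thesis by (rule that[OF g ae eq fin' sub_leray_eq_angular_lift[OF fm g ae]])
qed

lemma sub_leray_L2_bound:
  assumes \<gamma>: "\<gamma> > 1" and r: "r \<in> r_interval \<gamma> k" and f: "f \<in> L2_comp \<gamma> r (int k)"
  shows "sub_leray \<gamma> k f \<in> L2_comp \<gamma> r (int k)"
    and "L2_norm (\<mu>_meas \<gamma> r) (sub_leray \<gamma> k f) \<le> sqrt (C_const \<gamma> r k) * L2_norm (\<mu>_meas \<gamma> r) f"
proof -
  from f obtain g where g[measurable]: "g \<in> borel_measurable (borel \<Otimes>\<^sub>M borel)"
    and n: "L2_sq (\<mu>_meas \<gamma> r) f = ennreal (2 * pi) * half_norm2 r g"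
    and fin: "half_norm2 r g < \<infinity>" and sl: "sub_leray \<gamma> k f = angular_lift k (reduced_leray \<gamma> k g)"
    by (rule L2_compE)
  note le = half_norm2_reduced_leray_le_L2[OF \<gamma> r g fin]
  also have "ennreal (C_const \<gamma> r k) * half_norm2 r g < \<infinity>" using fin by (auto simp: ennreal_mult_less_top)
  finally have fin': "half_norm2 r (reduced_leray \<gamma> k g) < \<infinity>" .
  show c: "sub_leray \<gamma> k f \<in> L2_comp \<gamma> r (int k)"
    unfolding sl by (rule angular_lift_L2_comp[OF _ fin']) measurable
  have "ennreal (2 * pi) * half_norm2 r (reduced_leray \<gamma> k g)
      \<le> ennreal (2 * pi) * (ennreal (C_const \<gamma> r k) * half_norm2 r g)"
    by (intro mult_left_mono le) simp
  then have "L2_sq (\<mu>_meas \<gamma> r) (sub_leray \<gamma> k f) \<le> ennreal (C_const \<gamma> r k) * L2_sq (\<mu>_meas \<gamma> r) f"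
    unfolding n sl by (subst nn_integral_angular_lift) (auto simp: mult_ac)
  then show "L2_norm (\<mu>_meas \<gamma> r) (sub_leray \<gamma> k f) \<le> sqrt (C_const \<gamma> r k) * L2_norm (\<mu>_meas \<gamma> r) f"
    using c f C_const_eq_weights(2)[OF \<gamma> r] by (subst L2_norm_le_iff) (auto simp: L2_comp_iff)
qed

definition hyp_box :: "real \<Rightarrow> nat \<Rightarrow> (complex \<times> complex) set" where
  "hyp_box \<gamma> n = {\<zeta> \<in> M_hyp \<gamma>. (Re (snd \<zeta>), cmod (fst \<zeta>)) \<in> half_box n}"

lemma compact_hyp_box:
  assumes "\<gamma> > 1"
  shows "compact (hyp_box \<gamma> n)"
  unfolding compact_eq_bounded_closed
proof
  have "norm \<zeta> \<le> real (Suc n) + (real n + real (Suc n) powr \<gamma>)" if "\<zeta> \<in> hyp_box \<gamma> n" for \<zeta>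
  proof -
    have z: "cmod (fst \<zeta>) \<le> real (Suc n)" "\<bar>Re (snd \<zeta>)\<bar> \<le> real n" "Im (snd \<zeta>) = cmod (fst \<zeta>) powr \<gamma>"
      using that by (auto simp: hyp_box_def half_box_def M_hyp_def)
    then have "\<bar>Im (snd \<zeta>)\<bar> \<le> real (Suc n) powr \<gamma>" using assms by (auto intro!: powr_mono2)
    then have "cmod (snd \<zeta>) \<le> real n + real (Suc n) powr \<gamma>" using cmod_le[of "snd \<zeta>"] z by linarith
    then show ?thesis using norm_Pair_le[of "fst \<zeta>" "snd \<zeta>"] z by simp
  qed
  then show "bounded (hyp_box \<gamma> n)" by (rule boundedI)
  have 1: "closed {\<zeta> :: complex \<times> complex. Im (snd \<zeta>) = cmod (fst \<zeta>) powr \<gamma>}"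
    using assms by (intro closed_Collect_eq continuous_on_powr' continuous_intros) auto
  have 2: "closed {\<zeta> :: complex \<times> complex. - real n
      \<le> Re (snd \<zeta>)}" "closed {\<zeta> :: complex \<times> complex. Re (snd \<zeta>) \<le> real n}"
    "closed {\<zeta> :: complex \<times> complex. 1 / real (Suc n)
        \<le> cmod (fst \<zeta>)}" "closed {\<zeta> :: complex \<times> complex. cmod (fst \<zeta>) \<le> real (Suc n)}"
    by (intro closed_Collect_le continuous_intros)+
  have "hyp_box \<gamma> n = {\<zeta>. Im (snd \<zeta>)
      = cmod (fst \<zeta>) powr \<gamma>} \<inter> ({\<zeta>. - real n \<le> Re (snd \<zeta>)} \<inter> ({\<zeta>. Re (snd \<zeta>) \<le> real n} \<inter>
     ({\<zeta>. 1 / real (Suc n) \<le> cmod (fst \<zeta>)} \<inter> {\<zeta>. cmod (fst \<zeta>) \<le> real (Suc n)})))"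
    by (auto simp: hyp_box_def half_box_def M_hyp_def)
  then show "closed (hyp_box \<gamma> n)" by (auto intro!: closed_Int 1 2 simp del: of_nat_Suc)
qed

lemma L2_comp_coreI:
  assumes "\<gamma> > 1" "f \<in> L2_comp \<gamma> r k" "\<And>\<zeta>. \<zeta> \<in> M_hyp \<gamma> \<Longrightarrow> cmod (f \<zeta>) \<le> B" "\<And>\<zeta>. \<zeta> \<in> M_hyp \<gamma> - hyp_box \<gamma> n
      \<Longrightarrow> f \<zeta> = 0"
  shows "f \<in> L2_comp_core \<gamma> r k"
proof -
  have "fst \<zeta> \<noteq> 0" if "\<zeta> \<in> hyp_box \<gamma> n" for \<zeta>
  proof
    assume "fst \<zeta> = 0"
    with that have "1 / real (Suc n) \<le> 0" by (simp add: hyp_box_def half_box_def del: of_nat_Suc)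
    then show False by simp
  qed
  then have "hyp_box \<gamma> n \<subseteq> M_hyp \<gamma> - {\<zeta>. fst \<zeta> = 0}" by (auto simp: hyp_box_def)
  moreover have "bounded (f ` M_hyp \<gamma>)" using assms(3) by (auto intro!: boundedI)
  ultimately show ?thesis using assms compact_hyp_box[of \<gamma> n] by (auto simp: L2_comp_core_def)
qed

lemma wave_packet_core:
  assumes \<gamma>: "\<gamma> > 1"
  shows "angular_lift k (wave_packet \<gamma> k r N n) \<in> L2_comp_core \<gamma> r (int k)"
proof -
  let ?I = "{1 / real (Suc N)..real (Suc N)}"
  let ?F = "\<lambda>\<alpha>. \<alpha> powr ((\<gamma> - 1) * (real k + 1) - r) * exp (- ((\<gamma> - 1) * \<alpha> powr \<gamma>))"
  have "continuous_on ?I ?F"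
    by (rule continuous_on_powr_exp)
  then have "bounded (?F ` ?I)" by (intro compact_imp_bounded compact_continuous_image) auto
  then obtain B where "\<forall>x \<in> ?F ` ?I. norm x \<le> B" unfolding bounded_iff by blast
  then have B: "\<bar>?F \<alpha>\<bar> \<le> B" if "\<alpha> \<in> ?I" for \<alpha>
    using that unfolding real_norm_def by blast
  have B': "\<bar>packet_profile \<gamma> k r N \<alpha>\<bar> \<le> \<bar>B\<bar>" for \<alpha>
    using B[of \<alpha>] by (auto simp: packet_profile_def indicator_def simp del: of_nat_Suc)
  have wb: "cmod (wave_packet \<gamma> k r N n z) \<le> \<bar>B\<bar>" for z
    using B'[of "snd z"] by (cases z) (auto simp: wave_packet_def norm_mult indicator_def)
  show ?thesis
  proof (rule L2_comp_coreI[OF \<gamma>, where n = "max N n" and B = "\<bar>B\<bar>"])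
    show "angular_lift k (wave_packet \<gamma> k r N n) \<in> L2_comp \<gamma> r (int k)"
      by (rule angular_lift_L2_comp)
         (measurable, use truncated_analysis_weight_finite[of \<gamma> k r N] in \<open>auto simp:
             half_norm2_wave_packet ennreal_mult_less_top\<close>)
    show "cmod (angular_lift k (wave_packet \<gamma> k r N n) \<zeta>) \<le> \<bar>B\<bar>" for \<zeta>
      using wb by (simp add: angular_lift_def norm_mult)
    fix \<zeta> assume "\<zeta> \<in> M_hyp \<gamma> - hyp_box \<gamma> (max N n)"
    then have out: "(Re (snd \<zeta>), cmod (fst \<zeta>)) \<notin> half_box (max N n)" by (auto simp: hyp_box_def)
    have "{- real n..real n} \<times> ?I \<subseteq> half_box (max N n)"
      using frac_le[of 1 1 "real (Suc N)" "real (Suc (max N n))"] by (auto simp: half_box_def)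
    with out have "(Re (snd \<zeta>), cmod (fst \<zeta>)) \<notin> {- real n..real n} \<times> ?I" by blast
    then show "angular_lift k (wave_packet \<gamma> k r N n) \<zeta> = 0"
      by (auto simp: angular_lift_def wave_packet_def packet_profile_def indicator_def simp del: of_nat_Suc)
  qed
qed

text \<open>The lifted wave packets belong to the dense subspace, so a bound on that subspace alone suffices for
  \<open>leray_lower_bound\<close>.\<close>

lemma sub_leray_lower_bound:
  assumes \<gamma>: "\<gamma> > 1" and D: "D \<ge> 0"
    and L: "\<And>f. f \<in> L2_comp_core \<gamma> r (int k) \<Longrightarrow> sub_leray \<gamma> k f \<in> L2_comp \<gamma> r (int k)"
    and le: "\<And>f. f \<in> L2_comp_core \<gamma> r (int k) \<Longrightarrow> L2_norm (\<mu>_meas \<gamma> r) (sub_leray \<gamma> k f)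
        \<le> D * L2_norm (\<mu>_meas \<gamma> r) f"
  shows "r \<in> r_interval \<gamma> k" and "sqrt (C_const \<gamma> r k) \<le> D"
proof -
  have "half_norm2 r (reduced_leray \<gamma> k (wave_packet \<gamma> k r N n))
      \<le> ennreal (D\<^sup>2) * half_norm2 r (wave_packet \<gamma> k r N n)" for N n
  proof -
    let ?f = "angular_lift k (wave_packet \<gamma> k r N n)"
    have f: "?f \<in> L2_comp_core \<gamma> r (int k)" by (rule wave_packet_core[OF \<gamma>])
    then have fc: "?f \<in> L2_comp \<gamma> r (int k)" by (simp add: L2_comp_core_def)
    have sl: "sub_leray \<gamma> k ?f = angular_lift k (reduced_leray \<gamma> k (wave_packet \<gamma> k r N n))"
      by (rule sub_leray_eq_angular_lift[where r=r]) (auto intro!: angular_lift_measurable)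
    have "L2_sq (\<mu>_meas \<gamma> r) (sub_leray \<gamma> k ?f) \<le> ennreal (D\<^sup>2) * L2_sq (\<mu>_meas \<gamma> r) ?f"
      using le[OF f] L[OF f] fc D by (subst (asm) L2_norm_le_iff) (auto simp: L2_comp_iff)
    then have "ennreal (2 * pi) * half_norm2 r (reduced_leray \<gamma> k (wave_packet \<gamma> k r N n))
        \<le> ennreal (D\<^sup>2) * (ennreal (2 * pi) * half_norm2 r (wave_packet \<gamma> k r N n))"
      unfolding sl by (subst (asm) (1 2) nn_integral_angular_lift) auto
    then have "ennreal (2 * pi) * half_norm2 r (reduced_leray \<gamma> k (wave_packet \<gamma> k r N n))
        \<le> ennreal (2 * pi) * (ennreal (D\<^sup>2) * half_norm2 r (wave_packet \<gamma> k r N n))"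
      by (simp only: mult_ac)
    then show ?thesis by (subst (asm) ennreal_mult_le_mult_iff) auto
  qed
  from leray_lower_bound[OF \<gamma> this] show "r \<in> r_interval \<gamma> k" and "sqrt (C_const \<gamma> r k) \<le> D"
    using D by (auto intro: real_le_lsqrt)
qed

definition hyp_truncate :: "real \<Rightarrow> nat \<Rightarrow> (complex \<times> complex \<Rightarrow> complex) \<Rightarrow> complex \<times> complex \<Rightarrow> complex" where
  "hyp_truncate \<gamma> n f \<zeta> = (if \<zeta> \<in> hyp_box \<gamma> n \<and> cmod (f \<zeta>) \<le> real n then f \<zeta> else 0)"

lemma hyp_truncate_measurable:
  assumes \<gamma>: "\<gamma> > 1" and f[measurable]: "f \<in> borel_measurable (restrict_space borel (M_hyp \<gamma>))"
  shows "hyp_truncate \<gamma> n f \<in> borel_measurable (restrict_space borel (M_hyp \<gamma>))"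
proof -
  have "hyp_box \<gamma> n \<in> sets borel" using compact_hyp_box[OF \<gamma>] by (simp add: borel_compact)
  then have [measurable]: "hyp_box \<gamma> n \<in> sets (restrict_space borel (M_hyp \<gamma>))"
    by (auto simp: sets_restrict_space hyp_box_def intro!: image_eqI[of _ _ "hyp_box \<gamma> n"])
  show ?thesis unfolding hyp_truncate_def by measurable
qed

lemma space_\<mu>_meas: "space (\<mu>_meas \<gamma> r) = M_hyp \<gamma>"
  by (simp add: \<mu>_meas_def space_restrict_space)

text \<open>The truncation depends on \<open>\<zeta>\<close> only through \<open>s\<close>, \<open>\<alpha>\<close> and \<open>\<bar>f \<zeta>\<bar>\<close>, and rotations preserve the
  last up to a null set; hence it stays in the \<open>k\<close>-th component.\<close>

lemma hyp_truncate_core: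
  assumes \<gamma>: "\<gamma> > 1" and f: "f \<in> L2_comp \<gamma> r (int k)"
  shows "hyp_truncate \<gamma> n f \<in> L2_comp_core \<gamma> r (int k)"
    and "(\<lambda>\<zeta>. f \<zeta> - hyp_truncate \<gamma> n f \<zeta>) \<in> L2_comp \<gamma> r (int k)"
    and "L2_norm (\<mu>_meas \<gamma> r) (hyp_truncate \<gamma> n f) \<le> L2_norm (\<mu>_meas \<gamma> r) f"
proof -
  have fm[measurable]: "f \<in> borel_measurable (restrict_space borel (M_hyp \<gamma>))"
      and fin: "L2_sq (\<mu>_meas \<gamma> r) f < \<infinity>"
    using f by (auto simp: L2_comp_iff L2_space_iff measurable_\<mu>_meas)
  note tm[measurable] = hyp_truncate_measurable[OF \<gamma> fm, of n]
  from f obtain g where g[measurable]: "g \<in> borel_measurable (borel \<Otimes>\<^sub>M borel)"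
      and ae: "AE \<zeta> in \<mu>_meas \<gamma> r. f \<zeta> = angular_lift k g \<zeta>"
    by (auto simp: L2_comp_iff)
  have ae1: "AE \<zeta> in \<mu>_meas \<gamma> r. hyp_truncate \<gamma> n f \<zeta> = angular_lift k (half_truncate n g) \<zeta>"
    using ae AE_space
  proof eventually_elim
    case (elim \<zeta>)
    then show ?case by (simp add: hyp_truncate_def half_truncate_def hyp_box_def angular_lift_def norm_mult
        space_\<mu>_meas)
  qed
  then have ae2: "AE \<zeta> in \<mu>_meas \<gamma> r. f \<zeta> - hyp_truncate \<gamma> n f \<zeta>
      = angular_lift k (\<lambda>z. g z - half_truncate n g z) \<zeta>"
    using ae by eventually_elim (simp add: angular_lift_def left_diff_distrib)
  have le: "L2_sq (\<mu>_meas \<gamma> r) (hyp_truncate \<gamma> n f) \<le> L2_sq (\<mu>_meas \<gamma> r) f"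
    and le': "L2_sq (\<mu>_meas \<gamma> r) (\<lambda>\<zeta>. f \<zeta> - hyp_truncate \<gamma> n f \<zeta>) \<le> L2_sq (\<mu>_meas \<gamma> r) f"
    by (auto intro!: nn_integral_mono simp: hyp_truncate_def)
  have s1: "hyp_truncate \<gamma> n f \<in> L2_space (\<mu>_meas \<gamma> r)"
    using le fin le_less_trans by (auto simp: L2_space_iff measurable_\<mu>_meas tm)
  then have c1: "hyp_truncate \<gamma> n f \<in> L2_comp \<gamma> r (int k)"
    using ae1 half_truncate_measurable[OF g] by (auto simp: L2_comp_iff)
  then show "hyp_truncate \<gamma> n f \<in> L2_comp_core \<gamma> r (int k)"
    by (rule L2_comp_coreI[OF \<gamma>, where n = n and B = "real n"]) (auto simp: hyp_truncate_def)
  have "(\<lambda>\<zeta>. f \<zeta> - hyp_truncate \<gamma> n f \<zeta>) \<in> L2_space (\<mu>_meas \<gamma> r)"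
    using le' fin le_less_trans by (auto simp: L2_space_iff measurable_\<mu>_meas)
  moreover have "(\<lambda>z. g z - half_truncate n g z) \<in> borel_measurable (borel \<Otimes>\<^sub>M borel)" by measurable
  ultimately show "(\<lambda>\<zeta>. f \<zeta> - hyp_truncate \<gamma> n f \<zeta>) \<in> L2_comp \<gamma> r (int k)"
    using ae2 by (auto simp: L2_comp_iff)
  show "L2_norm (\<mu>_meas \<gamma> r) (hyp_truncate \<gamma> n f) \<le> L2_norm (\<mu>_meas \<gamma> r) f"
    using L2_norm_le_iff[OF s1, of f 1] f le by (simp add: L2_comp_iff)
qed

lemma hyp_truncate_tendsto:
  assumes \<gamma>: "\<gamma> > 1" and f: "f \<in> L2_comp \<gamma> r (int k)"
  shows "(\<lambda>n. (L2_norm (\<mu>_meas \<gamma> r) (\<lambda>\<zeta>. f \<zeta> - hyp_truncate \<gamma> n f \<zeta>))\<^sup>2) \<longlonglongrightarrow> 0"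
proof -
  have fm[measurable]: "f \<in> borel_measurable (\<mu>_meas \<gamma> r)"
      and fi: "integrable (\<mu>_meas \<gamma> r) (\<lambda>\<zeta>. (cmod (f \<zeta>))\<^sup>2)"
    using f by (auto simp: L2_comp_iff L2_space_def)
  have tm[measurable]: "hyp_truncate \<gamma> n f \<in> borel_measurable (\<mu>_meas \<gamma> r)" for n
    using hyp_truncate_measurable[OF \<gamma>] fm by (simp add: measurable_\<mu>_meas)
  have "(\<lambda>n. \<integral>\<zeta>. (cmod (f \<zeta> - hyp_truncate \<gamma> n f \<zeta>))\<^sup>2 \<partial>\<mu>_meas \<gamma> r) \<longlonglongrightarrow> (\<integral>\<zeta>. 0 \<partial>\<mu>_meas \<gamma> r)"
  proof (rule integral_dominated_convergence[OF _ _ fi])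
    show "AE \<zeta> in \<mu>_meas \<gamma> r. (\<lambda>n. (cmod (f \<zeta> - hyp_truncate \<gamma> n f \<zeta>))\<^sup>2) \<longlonglongrightarrow> 0"
      using AE_\<mu>_meas_off_axis AE_space
    proof eventually_elim
      case (elim \<zeta>)
      have "\<forall>\<^sub>F n in sequentially. (cmod (f \<zeta> - hyp_truncate \<gamma> n f \<zeta>))\<^sup>2 = 0"
        using half_truncate_tendsto[OF elim(1), of "\<lambda>_. f \<zeta>" "Re (snd \<zeta>)"]
        by eventually_elim (use elim(2) in \<open>auto simp: half_truncate_def hyp_truncate_def hyp_box_def
            space_\<mu>_meas split: if_splits\<close>)
      then show ?case by (rule tendsto_eventually)
    qed
    show "AE \<zeta> in \<mu>_meas \<gamma> r. norm ((cmod (f \<zeta> - hyp_truncate \<gamma> n f \<zeta>))\<^sup>2) \<le> (cmod (f \<zeta>))\<^sup>2" for n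
      by (auto simp: hyp_truncate_def)
  qed measurable
  then show ?thesis by (simp add: L2_norm_def)
qed

text \<open>The integral formula is its own extension.  Linearity is asserted almost everywhere only, and
  off the axis the integrals converge absolutely.\<close>

lemma sub_leray_is_extension:
  assumes \<gamma>: "\<gamma> > 1" and r: "r \<in> r_interval \<gamma> k"
  shows "sub_leray_extension \<gamma> r k (sub_leray \<gamma> k)"
  unfolding sub_leray_extension_def
proof (intro conjI ballI allI)
  show "\<exists>C. \<forall>f\<in>L2_comp \<gamma> r (int k). L2_norm (\<mu>_meas \<gamma> r) (sub_leray \<gamma> k f) \<le> C * L2_norm (\<mu>_meas \<gamma> r) f"
    using sub_leray_L2_bound(2)[OF \<gamma> r] by blast
  fix f1 f2 a b assume f: "f1 \<in> L2_comp \<gamma> r (int k)" "f2 \<in> L2_comp \<gamma> r (int k)"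
  from f(1) obtain g1 where g1[measurable]: "g1 \<in> borel_measurable (borel \<Otimes>\<^sub>M borel)"
      and ae1: "AE \<zeta> in \<mu>_meas \<gamma> r. f1 \<zeta> = angular_lift k g1 \<zeta>"
    and fin1: "half_norm2 r g1 < \<infinity>" and sl1: "sub_leray \<gamma> k f1 = angular_lift k (reduced_leray \<gamma> k g1)"
    by (rule L2_compE)
  from f(2) obtain g2 where g2[measurable]: "g2 \<in> borel_measurable (borel \<Otimes>\<^sub>M borel)"
      and ae2: "AE \<zeta> in \<mu>_meas \<gamma> r. f2 \<zeta> = angular_lift k g2 \<zeta>"
    and fin2: "half_norm2 r g2 < \<infinity>" and sl2: "sub_leray \<gamma> k f2 = angular_lift k (reduced_leray \<gamma> k g2)"
    by (rule L2_compE)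
  have [measurable]: "f1 \<in> borel_measurable (restrict_space borel (M_hyp \<gamma>))" "f2
      \<in> borel_measurable (restrict_space borel (M_hyp \<gamma>))"
    using f by (auto simp: L2_comp_iff L2_space_iff measurable_\<mu>_meas)
  have gm: "(\<lambda>z. a * g1 z + b * g2 z) \<in> borel_measurable (borel \<Otimes>\<^sub>M borel)" by measurable
  have sl: "sub_leray \<gamma> k (\<lambda>\<eta>. a * f1 \<eta> + b * f2 \<eta>)
      = angular_lift k (reduced_leray \<gamma> k (\<lambda>z. a * g1 z + b * g2 z))"
  proof (rule sub_leray_eq_angular_lift[OF _ gm])
    show "AE \<zeta> in \<mu>_meas \<gamma> r. a * f1 \<zeta> + b * f2 \<zeta> = angular_lift k (\<lambda>z. a * g1 z + b * g2 z) \<zeta>"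
      using ae1 ae2 by eventually_elim (simp add: angular_lift_def algebra_simps)
  qed measurable
  have lin: "reduced_leray \<gamma> k (\<lambda>z. a * g1 z + b * g2 z) (t, \<beta>)
      = a * reduced_leray \<gamma> k g1 (t, \<beta>) + b * reduced_leray \<gamma> k g2 (t, \<beta>)"
    if \<beta>: "\<beta> > 0" for t \<beta>
  proof -
    let ?K = "\<lambda>g. leray_integrand \<gamma> k g (t, \<beta>)"
    note i1 = leray_integrand_integrable[OF \<gamma> r \<beta> g1 fin1, of t]
        and i2 = leray_integrand_integrable[OF \<gamma> r \<beta> g2 fin2, of t]
    have eq: "?K (\<lambda>z. a * g1 z + b * g2 z) = (\<lambda>z. a * ?K g1 z + b * ?K g2 z)"
      by (auto simp: fun_eq_iff algebra_simps)
    have i3: "integrable plane (?K (\<lambda>z. a * g1 z + b * g2 z))"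
      unfolding eq by (intro Bochner_Integration.integrable_add integrable_mult_right i1 i2)
    have "(\<integral>z. a * ?K g1 z + b * ?K g2 z \<partial>plane) = a * (\<integral>z. ?K g1 z \<partial>plane) + b * (\<integral>z. ?K g2 z \<partial>plane)"
      by (simp only: Bochner_Integration.integral_add[OF integrable_mult_right[OF i1]
          integrable_mult_right[OF i2]] integral_mult_right_zero)
    then show ?thesis
      unfolding reduced_leray_eq_product_integral[OF i1] reduced_leray_eq_product_integral[OF i2]
          reduced_leray_eq_product_integral[OF i3] eq
      by (simp only: distrib_left mult_ac)
  qed
  show "AE \<zeta> in \<mu>_meas \<gamma> r. sub_leray \<gamma> k (\<lambda>\<eta>. a * f1 \<eta> + b * f2 \<eta>) \<zeta>
      = a * sub_leray \<gamma> k f1 \<zeta> + b * sub_leray \<gamma> k f2 \<zeta>"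
    using AE_\<mu>_meas_off_axis by eventually_elim (simp add: sl sl1 sl2 angular_lift_def lin algebra_simps)
qed (simp_all add: sub_leray_L2_bound(1)[OF \<gamma> r])

text \<open>The operator \<open>T\<close> is tied to the integral formula on the dense subspace only.  On the truncations of
  \<open>f\<close> it has the sharp bound, and its own bound \<open>B\<close>, of unknown size, affects the remainder
  \<open>f - hyp_truncate \<gamma> n f\<close> alone, which tends to 0.\<close>

lemma extension_bound:
  assumes \<gamma>: "\<gamma> > 1" and r: "r \<in> r_interval \<gamma> k" and T: "sub_leray_extension \<gamma> r k T"
    and f: "f \<in> L2_comp \<gamma> r (int k)"
  shows "L2_norm (\<mu>_meas \<gamma> r) (T f) \<le> sqrt (C_const \<gamma> r k) * L2_norm (\<mu>_meas \<gamma> r) f"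
proof -
  let ?M = "\<mu>_meas \<gamma> r"
  let ?f = "\<lambda>n. hyp_truncate \<gamma> n f"
  let ?e = "\<lambda>n \<zeta>. f \<zeta> - hyp_truncate \<gamma> n f \<zeta>"
  let ?C = "C_const \<gamma> r k"
  have C: "?C > 0" by (rule C_const_eq_weights(2)[OF \<gamma> r])
  have T0: "\<And>f. f \<in> L2_comp \<gamma> r (int k) \<Longrightarrow> T f \<in> L2_comp \<gamma> r (int k)"
    and T2: "\<And>f g. f \<in> L2_comp \<gamma> r (int k) \<Longrightarrow> g \<in> L2_comp \<gamma> r (int k)
        \<Longrightarrow> AE \<zeta> in ?M. T (\<lambda>\<eta>. 1 * f \<eta> + 1 * g \<eta>) \<zeta> = 1 * T f \<zeta> + 1 * T g \<zeta>"
    and T4: "\<And>f. f \<in> L2_comp_core \<gamma> r (int k) \<Longrightarrow> AE \<zeta> in ?M. T f \<zeta> = sub_leray \<gamma> k f \<zeta>"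
    using T unfolding sub_leray_extension_def by blast+
  then have T1: "\<And>f. f \<in> L2_comp \<gamma> r (int k) \<Longrightarrow> T f \<in> L2_space ?M"
    using L2_comp_iff by blast
  obtain B where B: "\<And>f. f \<in> L2_comp \<gamma> r (int k) \<Longrightarrow> L2_norm ?M (T f) \<le> B * L2_norm ?M f"
    using T unfolding sub_leray_extension_def by blast
  note core = hyp_truncate_core(1)[OF \<gamma> f] and diff = hyp_truncate_core(2)[OF \<gamma> f]
  have comp: "?f n \<in> L2_comp \<gamma> r (int k)" for n using core[of n] by (simp add: L2_comp_core_def)
  have fn: "(L2_norm ?M (T (?f n)))\<^sup>2 \<le> ?C * (L2_norm ?M f)\<^sup>2" for n
  proof -
    have "L2_norm ?M (T (?f n)) = L2_norm ?M (sub_leray \<gamma> k (?f n))"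
      using T1[OF comp] sub_leray_L2_bound(1)[OF \<gamma> r comp] T4[OF core]
      by (intro L2_norm_cong_AE) (auto simp: L2_space_iff L2_comp_iff)
    also have "\<dots> \<le> sqrt ?C * L2_norm ?M (?f n)" by (rule sub_leray_L2_bound(2)[OF \<gamma> r comp])
    also have "\<dots> \<le> sqrt ?C * L2_norm ?M f"
        by (intro mult_left_mono hyp_truncate_core(3)[OF \<gamma> f]) (use C in simp)
    finally have "(L2_norm ?M (T (?f n)))\<^sup>2 \<le> (sqrt ?C * L2_norm ?M f)\<^sup>2"
        by (intro power_mono L2_norm_nonneg)
    then show ?thesis using C by (simp add: power_mult_distrib)
  qed
  let ?Z = "?C * (L2_norm ?M f)\<^sup>2"
  let ?R = "\<lambda>\<epsilon> n. (1 + \<epsilon>) * ?Z + (1 + 1 / \<epsilon>) * (B\<^sup>2 * (L2_norm ?M (?e n))\<^sup>2)"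
  have en: "(L2_norm ?M (T (?e n)))\<^sup>2 \<le> B\<^sup>2 * (L2_norm ?M (?e n))\<^sup>2" for n
    using power_mono[OF B[OF diff[of n]] L2_norm_nonneg, of 2] by (simp add: power_mult_distrib)
  have step: "(L2_norm ?M (T f))\<^sup>2 \<le> (1 + \<epsilon>) * ?Z" if \<epsilon>: "\<epsilon> > 0" for \<epsilon>
  proof (rule LIMSEQ_le_const)
    have "(\<lambda>n. ?R \<epsilon> n)
       \<longlonglongrightarrow> (1 + \<epsilon>) * ?Z + (1 + 1 / \<epsilon>) * (B\<^sup>2 * 0)"
      by (intro tendsto_add tendsto_mult tendsto_const hyp_truncate_tendsto[OF \<gamma> f])
    then show "(\<lambda>n. ?R \<epsilon> n)
       \<longlonglongrightarrow> (1 + \<epsilon>) * ?Z" by simp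
    have "(L2_norm ?M (T f))\<^sup>2 \<le> ?R \<epsilon> n" for n
    proof -
      have "AE \<zeta> in ?M. T f \<zeta> = T (?f n) \<zeta> + T (?e n) \<zeta>"
        using T2[OF comp[of n] diff[of n]] by simp
      then have "(L2_norm ?M (T f))\<^sup>2
          \<le> (1 + \<epsilon>) * (L2_norm ?M (T (?f n)))\<^sup>2 + (1 + 1 / \<epsilon>) * (L2_norm ?M (T (?e n)))\<^sup>2"
        by (rule L2_norm_add_le[OF T1[OF comp] T1[OF diff] T1[OF f] _ \<epsilon>])
      also have "\<dots> \<le> ?R \<epsilon> n"
        using \<epsilon> by (intro add_mono mult_left_mono fn en) auto
      finally show ?thesis .
    qed
    then show "\<exists>N. \<forall>n\<ge>N. (L2_norm ?M (T f))\<^sup>2 \<le> ?R \<epsilon> n"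
      by blast
  qed
  have "(\<lambda>n. (1 + inverse (real (Suc n))) * ?Z) \<longlonglongrightarrow> (1 + 0) * ?Z"
    by (intro tendsto_add tendsto_mult tendsto_const LIMSEQ_inverse_real_of_nat)
  moreover have "\<exists>N. \<forall>n\<ge>N. (L2_norm ?M (T f))\<^sup>2 \<le> (1 + inverse (real (Suc n))) * ?Z"
    using step by (metis inverse_positive_iff_positive of_nat_0_less_iff zero_less_Suc)
  ultimately have "(L2_norm ?M (T f))\<^sup>2 \<le> (1 + 0) * ?Z" by (rule LIMSEQ_le_const)
  then have "(L2_norm ?M (T f))\<^sup>2 \<le> (sqrt ?C * L2_norm ?M f)\<^sup>2" using C by (simp add: power_mult_distrib)
  then show ?thesis by (rule power2_le_imp_le) (use C L2_norm_nonneg[of ?M f] in simp)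
qed

text \<open>The supremum is a bound for \<open>T\<close>, hence for the integral formula on the dense subspace, so
  \<open>sub_leray_lower_bound\<close> applies to it.\<close>

lemma L2_opnorm_extension:
  assumes \<gamma>: "\<gamma> > 1" and r: "r \<in> r_interval \<gamma> k" and T: "sub_leray_extension \<gamma> r k T"
  shows "L2_opnorm \<gamma> r k T = sqrt (C_const \<gamma> r k)"
proof (rule antisym)
  let ?M = "\<mu>_meas \<gamma> r"
  let ?S = "L2_comp \<gamma> r (int k)"
  let ?q = "\<lambda>f. L2_norm ?M (T f) / L2_norm ?M f"
  have C: "C_const \<gamma> r k > 0" by (rule C_const_eq_weights(2)[OF \<gamma> r])
  have zero: "(\<lambda>_. 0) \<in> ?S"
    using angular_lift_L2_comp[where g = "\<lambda>_. 0" and r = r and k = k and \<gamma> = \<gamma>]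
    by (simp add: half_norm2_def angular_lift_def[abs_def])
  have q: "?q f \<le> sqrt (C_const \<gamma> r k)" if "f \<in> ?S" for f
  proof (cases "L2_norm ?M f = 0")
    case False
    then have "L2_norm ?M f > 0" using L2_norm_nonneg[of ?M f] by simp
    then show ?thesis using extension_bound[OF \<gamma> r T that] by (simp add: divide_le_eq)
  qed (use C in simp)
  show "L2_opnorm \<gamma> r k T \<le> sqrt (C_const \<gamma> r k)"
    unfolding L2_opnorm_def using zero q by (intro cSUP_least) auto
  have bdd: "bdd_above (?q ` ?S)" using q by (auto intro!: bdd_aboveI)
  have le: "?q f \<le> L2_opnorm \<gamma> r k T" if "f \<in> ?S" for f
    unfolding L2_opnorm_def by (rule cSUP_upper[OF that bdd])
  have D: "0 \<le> L2_opnorm \<gamma> r k T"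
    using le[OF zero] order_trans[OF _ le[OF zero]] L2_norm_nonneg by (metis divide_nonneg_nonneg)
  show "sqrt (C_const \<gamma> r k) \<le> L2_opnorm \<gamma> r k T"
  proof (rule sub_leray_lower_bound(2)[OF \<gamma> D])
    fix f assume f: "f \<in> L2_comp_core \<gamma> r (int k)"
    then have fc: "f \<in> ?S" by (simp add: L2_comp_core_def)
    show sc: "sub_leray \<gamma> k f \<in> ?S" by (rule sub_leray_L2_bound(1)[OF \<gamma> r fc])
    have "L2_norm ?M (sub_leray \<gamma> k f) = L2_norm ?M (T f)"
      using T f fc sc by (intro L2_norm_cong_AE)
          (auto simp: sub_leray_extension_def L2_comp_iff L2_space_iff)
    also have "\<dots> \<le> L2_opnorm \<gamma> r k T * L2_norm ?M f"
    proof (cases "L2_norm ?M f = 0")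
      case True
      then show ?thesis using extension_bound[OF \<gamma> r T fc] by simp
    next
      case False
      then have "L2_norm ?M f > 0" using L2_norm_nonneg[of ?M f] by simp
      then show ?thesis using le[OF fc] by (simp add: divide_le_eq)
    qed
    finally show "L2_norm ?M (sub_leray \<gamma> k f) \<le> L2_opnorm \<gamma> r k T * L2_norm ?M f" .
  qed
qed

theorem theorem1p7:
  fixes \<gamma> r :: real and k :: nat
  assumes "\<gamma> > 1"
  shows "(sub_leray_bounded \<gamma> r k \<longleftrightarrow> r \<in> r_interval \<gamma> k) \<and>
         (r \<in> r_interval \<gamma> k \<longrightarrow>
            (\<exists>T. sub_leray_extension \<gamma> r k T) \<and>
            (\<forall>T. sub_leray_extension \<gamma> r k T \<longrightarrow>
               L2_opnorm \<gamma> r k T = sqrt (C_const \<gamma> r k)))"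
proof (intro conjI iffI impI allI)
  assume "sub_leray_bounded \<gamma> r k"
  then obtain C where C: "\<And>f. f \<in> L2_comp_core \<gamma> r (int k) \<Longrightarrow> sub_leray \<gamma> k f \<in> L2_comp \<gamma> r (int k) \<and>
        L2_norm (\<mu>_meas \<gamma> r) (sub_leray \<gamma> k f) \<le> C * L2_norm (\<mu>_meas \<gamma> r) f"
    unfolding sub_leray_bounded_def by blast
  show "r \<in> r_interval \<gamma> k"
  proof (rule sub_leray_lower_bound(1)[OF assms abs_ge_zero[of C]])
    fix f assume f: "f \<in> L2_comp_core \<gamma> r (int k)"
    show "sub_leray \<gamma> k f \<in> L2_comp \<gamma> r (int k)" using C[OF f] by simp
    show "L2_norm (\<mu>_meas \<gamma> r) (sub_leray \<gamma> k f) \<le> \<bar>C\<bar> * L2_norm (\<mu>_meas \<gamma> r) f"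
      using C[OF f] mult_right_mono[OF abs_ge_self L2_norm_nonneg] order_trans by blast
  qed
next
  assume r: "r \<in> r_interval \<gamma> k"
  show "sub_leray_bounded \<gamma> r k"
    unfolding sub_leray_bounded_def
    by (intro exI[of _ "sqrt (C_const \<gamma> r k)"] ballI conjI sub_leray_L2_bound[OF assms r])
       (simp_all add: L2_comp_core_def)
  show "\<exists>T. sub_leray_extension \<gamma> r k T"
    using sub_leray_is_extension[OF assms r] by blast
  show "L2_opnorm \<gamma> r k T = sqrt (C_const \<gamma> r k)" if "sub_leray_extension \<gamma> r k T" for T
    by (rule L2_opnorm_extension[OF assms r that])
qed

end
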